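(* Let $X$ be a standard Borel space equipped with a non-atomic probability measure $\mu$. The group $\mathrm{Aut}(X,\mu)$ of all measure-preserving automorphisms of $(X,\mu)$, equipped with the strong topology, is a Lévy group.
   Context: $\mathrm{Aut}(X,\mu)$ is the group of all $\mu$-preserving Borel automorphisms of $X$, where two automorphisms that agree $\mu$-almost everywhere are identified. To $T\in \mathrm{Aut}(X,\mu)$ one associates the linear isometry $\Phi(T)$ of $L^2(X,\mu)$ given by $\Phi(T)f(x)=f(T^{-1}x)$. The strong topology on $\mathrm{Aut}(X,\mu)$ is the topology induced, via $\Phi$, by the strong operator topology on the unitary group of $L^2(X,\mu)$ (it is also called the weak topology on $\mathrm{Aut}(X,\mu)$); it is a Polish group topology. An mm-space is a triple $(Y,d,\nu)$, where $d$ is a metric on a set $Y$ and $\nu$ is a (Borel) probability measure on $(Y,d)$. A net $(Y_\alpha,d_\alpha,\nu_\alpha)$ of mm-spaces forms a Lévy family if, whenever $A_\alpha\subseteq Y_\alpha$ are Borel subsets with $\liminf_\alpha \nu_\alpha(A_\alpha)>0$, one has for each $\epsilon>0$ that $\lim_\alpha \nu_\alpha((A_\alpha)_\epsilon)=1$, where $A_\epsilon$ denotes the $\epsilon$-neighbourhood of a set $A$. A metrizable topological group $G$ is a Lévy group if there is a net $(G_\alpha)_{\alpha\in A}$ of compact subgroups of $G$ with the following two properties. (1) The family of mm-spaces $(G,d,\mu_\alpha)$ is a Lévy family, where $d$ is any compatible right-invariant metric on $G$ and $\mu_\alpha$ denotes the normalized Haar measure on $G_\alpha$ (regarded as a probability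 measure on $G$). (2) For every finite collection $g_1,\dots,g_N\in G$ and every $\epsilon>0$ there is an $\alpha\in A$ such that for all $\beta\geq\alpha$ and all $i=1,\dots,N$ one has $d(g_i,G_\beta)<\epsilon$, where $d(g,G_\beta)=\inf_{h\in G_\beta}d(g,h)$. *)

theory Defs
  imports "HOL-Analysis.Analysis" "HOL-Probability.Probability_Measure"
    "HOL-Algebra.Coset" "HOL-Algebra.Bij"
begin

section \<open>Standard Borel spaces and non-atomic measures\<close>

definition borel_of :: "'a topology \<Rightarrow> 'a measure" where
  "borel_of X = sigma (topspace X) {U. openin X U}"

definition standard_borel :: "'a measure \<Rightarrow> bool" where
  "standard_borel M \<longleftrightarrow>
     (\<exists>X. completely_metrizable_space X \<and> second_countable X \<and>
          topspace X = space M \<and> sets M = sets (borel_of X))"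

definition non_atomic :: "'a measure \<Rightarrow> bool" where
  "non_atomic M \<longleftrightarrow>
     (\<forall>A\<in>sets M. 0 < emeasure M A \<longrightarrow>
        (\<exists>B\<in>sets M. B \<subseteq> A \<and> 0 < emeasure M B \<and> emeasure M B < emeasure M A))"


section \<open>The group of measure-preserving automorphisms\<close>

text \<open>
  \<^const>\<open>Bij\<close> contains only functions that are \<^const>\<open>undefined\<close> outside the underlying set,
  so its members are genuinely functions on the space of the measure.
\<close>

definition mp_auts :: "'a measure \<Rightarrow> ('a \<Rightarrow> 'a) set" where
  "mp_auts M =
     {T \<in> Bij (space M). T \<in> measurable M M \<and> inv_into (space M) T \<in> measurable M M
        \<and> distr M M T = M}"

definition aut_rel :: "'a measure \<Rightarrow> (('a \<Rightarrow> 'a) \<times> ('a \<Rightarrow> 'a)) set" where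
  "aut_rel M = {(S, T). S \<in> mp_auts M \<and> T \<in> mp_auts M \<and> (AE x in M. S x = T x)}"

definition Aut :: "'a measure \<Rightarrow> ('a \<Rightarrow> 'a) set monoid" where
  "Aut M =
     \<lparr>carrier = mp_auts M // aut_rel M,
      mult = (\<lambda>\<sigma> \<tau>. \<Union>S\<in>\<sigma>. \<Union>T\<in>\<tau>. aut_rel M `` {compose (space M) S T}),
      one = aut_rel M `` {\<lambda>x\<in>space M. x}\<rparr>"


section \<open>The Hilbert space of square-integrable functions\<close>

definition square_integrable :: "'a measure \<Rightarrow> ('a \<Rightarrow> complex) set" where
  "square_integrable M = {f \<in> borel_measurable M. integrable M (\<lambda>x. (cmod (f x))\<^sup>2)}"

definition L2_rel :: "'a measure \<Rightarrow> (('a \<Rightarrow> complex) \<times> ('a \<Rightarrow> complex)) set" where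
  "L2_rel M =
     {(f, g). f \<in> square_integrable M \<and> g \<in> square_integrable M \<and> (AE x in M. f x = g x)}"

definition L2 :: "'a measure \<Rightarrow> ('a \<Rightarrow> complex) set set" where
  "L2 M = square_integrable M // L2_rel M"

definition L2_add ::
    "'a measure \<Rightarrow> ('a \<Rightarrow> complex) set \<Rightarrow> ('a \<Rightarrow> complex) set \<Rightarrow> ('a \<Rightarrow> complex) set" where
  "L2_add M F G = (\<Union>f\<in>F. \<Union>g\<in>G. L2_rel M `` {\<lambda>x. f x + g x})"

definition L2_scale ::
    "'a measure \<Rightarrow> complex \<Rightarrow> ('a \<Rightarrow> complex) set \<Rightarrow> ('a \<Rightarrow> complex) set" where
  "L2_scale M c F = (\<Union>f\<in>F. L2_rel M `` {\<lambda>x. c * f x})"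

text \<open>The integral does not depend on the chosen representatives.\<close>

definition L2_dist :: "'a measure \<Rightarrow> ('a \<Rightarrow> complex) set \<Rightarrow> ('a \<Rightarrow> complex) set \<Rightarrow> real" where
  "L2_dist M F G =
     (let f = (SOME f. f \<in> F); g = (SOME g. g \<in> G)
      in sqrt (\<integral>x. (cmod (f x - g x))\<^sup>2 \<partial>M))"

text \<open>Unitary operators, as surjective linear isometries.\<close>

definition unitary_ops ::
    "'a measure \<Rightarrow> (('a \<Rightarrow> complex) set \<Rightarrow> ('a \<Rightarrow> complex) set) set" where
  "unitary_ops M =
     {U \<in> L2 M \<rightarrow>\<^sub>E L2 M.
        U ` L2 M = L2 M \<and>
        (\<forall>F\<in>L2 M. \<forall>G\<in>L2 M. U (L2_add M F G) = L2_add M (U F) (U G)) \<and>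
        (\<forall>c. \<forall>F\<in>L2 M. U (L2_scale M c F) = L2_scale M c (U F)) \<and>
        (\<forall>F\<in>L2 M. \<forall>G\<in>L2 M. L2_dist M (U F) (U G) = L2_dist M F G)}"

text \<open>The strong operator topology is the topology of pointwise convergence in norm.\<close>

definition strong_operator_topology ::
    "'a measure \<Rightarrow> (('a \<Rightarrow> complex) set \<Rightarrow> ('a \<Rightarrow> complex) set) topology" where
  "strong_operator_topology M =
     subtopology
       (product_topology (\<lambda>_. Metric_space.mtopology (L2 M) (L2_dist M)) (L2 M))
       (unitary_ops M)"

text \<open>The operator \<open>\<Phi>(T) f(x) = f(T\<^sup>-\<^sup>1 x)\<close>, on equivalence classes.\<close>

definition koopman ::
    "'a measure \<Rightarrow> ('a \<Rightarrow> 'a) set \<Rightarrow> ('a \<Rightarrow> complex) set \<Rightarrow> ('a \<Rightarrow> complex) set" where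
  "koopman M \<tau> =
     (\<lambda>F\<in>L2 M. \<Union>T\<in>\<tau>. \<Union>f\<in>F. L2_rel M `` {\<lambda>x. f (inv_into (space M) T x)})"

definition Aut_strong_topology :: "'a measure \<Rightarrow> ('a \<Rightarrow> 'a) set topology" where
  "Aut_strong_topology M =
     pullback_topology (carrier (Aut M)) (koopman M) (strong_operator_topology M)"


section \<open>Nets and L\'evy families of mm-spaces\<close>

definition directed_set :: "'i set \<Rightarrow> ('i \<Rightarrow> 'i \<Rightarrow> bool) \<Rightarrow> bool" where
  "directed_set I leq \<longleftrightarrow>
     I \<noteq> {} \<and>
     (\<forall>a\<in>I. leq a a) \<and>
     (\<forall>a\<in>I. \<forall>b\<in>I. \<forall>c\<in>I. leq a b \<longrightarrow> leq b c \<longrightarrow> leq a c) \<and>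
     (\<forall>a\<in>I. \<forall>b\<in>I. \<exists>c\<in>I. leq a c \<and> leq b c)"

definition net_filter :: "'i set \<Rightarrow> ('i \<Rightarrow> 'i \<Rightarrow> bool) \<Rightarrow> 'i filter" where
  "net_filter I leq = (INF a\<in>I. principal {b\<in>I. leq a b})"

definition mm_space :: "'y set \<Rightarrow> ('y \<Rightarrow> 'y \<Rightarrow> real) \<Rightarrow> 'y measure \<Rightarrow> bool" where
  "mm_space Y d \<nu> \<longleftrightarrow>
     Metric_space Y d \<and> prob_space \<nu> \<and> sets \<nu> = sets (borel_of (Metric_space.mtopology Y d))"

definition eps_nbhd ::
    "'y set \<Rightarrow> ('y \<Rightarrow> 'y \<Rightarrow> real) \<Rightarrow> 'y set \<Rightarrow> real \<Rightarrow> 'y set" where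
  "eps_nbhd Y d A \<epsilon> = {y\<in>Y. \<exists>a\<in>A. d y a < \<epsilon>}"

definition levy_family ::
    "'i set \<Rightarrow> ('i \<Rightarrow> 'i \<Rightarrow> bool) \<Rightarrow> ('i \<Rightarrow> 'y set) \<Rightarrow> ('i \<Rightarrow> 'y \<Rightarrow> 'y \<Rightarrow> real) \<Rightarrow>
     ('i \<Rightarrow> 'y measure) \<Rightarrow> bool" where
  "levy_family I leq Y d \<nu> \<longleftrightarrow>
     (\<forall>\<alpha>\<in>I. mm_space (Y \<alpha>) (d \<alpha>) (\<nu> \<alpha>)) \<and>
     (\<forall>A. (\<forall>\<alpha>\<in>I. A \<alpha> \<in> sets (\<nu> \<alpha>)) \<longrightarrow>
          0 < Liminf (net_filter I leq) (\<lambda>\<alpha>. emeasure (\<nu> \<alpha>) (A \<alpha>)) \<longrightarrow>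
          (\<forall>\<epsilon>>0. ((\<lambda>\<alpha>. measure (\<nu> \<alpha>) (eps_nbhd (Y \<alpha>) (d \<alpha>) (A \<alpha>) \<epsilon>)) \<longlongrightarrow> 1)
                   (net_filter I leq)))"


section \<open>L\'evy groups\<close>

definition topological_group :: "'g monoid \<Rightarrow> 'g topology \<Rightarrow> bool" where
  "topological_group G T \<longleftrightarrow>
     group G \<and> topspace T = carrier G \<and>
     continuous_map (prod_topology T T) T (\<lambda>(x, y). x \<otimes>\<^bsub>G\<^esub> y) \<and>
     continuous_map T T (\<lambda>x. inv\<^bsub>G\<^esub> x)"

definition compatible_right_invariant_metric ::
    "'g monoid \<Rightarrow> 'g topology \<Rightarrow> ('g \<Rightarrow> 'g \<Rightarrow> real) \<Rightarrow> bool" where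
  "compatible_right_invariant_metric G T d \<longleftrightarrow>
     Metric_space (carrier G) d \<and> Metric_space.mtopology (carrier G) d = T \<and>
     (\<forall>x\<in>carrier G. \<forall>y\<in>carrier G. \<forall>g\<in>carrier G. d (x \<otimes>\<^bsub>G\<^esub> g) (y \<otimes>\<^bsub>G\<^esub> g) = d x y)"

definition is_normalized_haar :: "'g monoid \<Rightarrow> 'g topology \<Rightarrow> 'g measure \<Rightarrow> bool" where
  "is_normalized_haar G T \<mu> \<longleftrightarrow>
     sets \<mu> = sets (borel_of T) \<and> emeasure \<mu> (space \<mu>) = 1 \<and>
     (\<forall>g\<in>carrier G. \<forall>A\<in>sets \<mu>. emeasure \<mu> (g <#\<^bsub>G\<^esub> A) = emeasure \<mu> A)"

text \<open>
  For a compact metrizable group such a measure exists and is unique (it is automatically regular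
  and right-invariant), so the choice is harmless.
\<close>

definition normalized_haar :: "'g monoid \<Rightarrow> 'g topology \<Rightarrow> 'g measure" where
  "normalized_haar G T = (SOME \<mu>. is_normalized_haar G T \<mu>)"

definition haar_on :: "'g monoid \<Rightarrow> 'g topology \<Rightarrow> 'g set \<Rightarrow> 'g measure" where
  "haar_on G T H =
     distr (normalized_haar (G\<lparr>carrier := H\<rparr>) (subtopology T H)) (borel_of T) (\<lambda>x. x)"

text \<open>
  On a metrizable group all compatible right-invariant metrics induce the same (right) uniformity,
  and one exists by the Birkhoff--Kakutani theorem; the two conditions are required for every one.
\<close>

definition levy_net ::
    "'g monoid \<Rightarrow> 'g topology \<Rightarrow> 'i set \<Rightarrow> ('i \<Rightarrow> 'i \<Rightarrow> bool) \<Rightarrow> ('i \<Rightarrow> 'g set) \<Rightarrow> bool" where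
  "levy_net G T I leq K \<longleftrightarrow>
     directed_set I leq \<and>
     (\<forall>\<alpha>\<in>I. subgroup (K \<alpha>) G \<and> compactin T (K \<alpha>)) \<and>
     (\<forall>d. compatible_right_invariant_metric G T d \<longrightarrow>
        levy_family I leq (\<lambda>_. carrier G) (\<lambda>_. d) (\<lambda>\<alpha>. haar_on G T (K \<alpha>)) \<and>
        (\<forall>S. finite S \<longrightarrow> S \<subseteq> carrier G \<longrightarrow>
           (\<forall>\<epsilon>>0. \<exists>\<alpha>\<in>I. \<forall>\<beta>\<in>I. leq \<alpha> \<beta> \<longrightarrow> (\<forall>g\<in>S. (INF h\<in>K \<beta>. d g h) < \<epsilon>))))"

text \<open>
  A type cannot be quantified inside a definition, so the index set of the net is taken in the
  fixed type of pairs of a subset and a family of subsets of the group.  This is no restriction: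
  see \<open>levy_groupI\<close> below, where the index type is arbitrary.
\<close>

definition levy_group :: "'g monoid \<Rightarrow> 'g topology \<Rightarrow> bool" where
  "levy_group G T \<longleftrightarrow>
     topological_group G T \<and> metrizable_space T \<and>
     (\<exists>(I :: ('g set \<times> 'g set set) set) leq K. levy_net G T I leq K)"

lemma directed_set_nonempty: "directed_set I leq \<Longrightarrow> I \<noteq> {}"
  unfolding directed_set_def by (rule conjunct1)

lemma directed_set_refl: "directed_set I leq \<Longrightarrow> a \<in> I \<Longrightarrow> leq a a"
  unfolding directed_set_def by (elim conjE) (rule bspec)

lemma directed_set_trans:
  assumes "directed_set I leq" and I: "a \<in> I" "b \<in> I" "c \<in> I" and "leq a b" "leq b c"
  shows "leq a c"
proof -
  have "\<forall>a\<in>I. \<forall>b\<in>I. \<forall>c\<in>I. leq a b \<longrightarrow> leq b c \<longrightarrow> leq a c"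
    using assms(1) unfolding directed_set_def by (elim conjE)
  from this[rule_format, OF I assms(5,6)] show ?thesis .
qed

lemma directed_set_ub:
  assumes "directed_set I leq" and I: "a \<in> I" "b \<in> I"
  shows "\<exists>c\<in>I. leq a c \<and> leq b c"
proof -
  have "\<forall>a\<in>I. \<forall>b\<in>I. \<exists>c\<in>I. leq a c \<and> leq b c"
    using assms(1) unfolding directed_set_def by (elim conjE)
  from this[rule_format, OF I] show ?thesis .
qed

lemma eventually_net_filter:
  assumes "directed_set I leq"
  shows "eventually P (net_filter I leq) \<longleftrightarrow> (\<exists>a\<in>I. \<forall>b\<in>I. leq a b \<longrightarrow> P b)"
proof -
  have "eventually P (net_filter I leq) \<longleftrightarrow>
      (\<exists>a\<in>I. eventually P (principal {b\<in>I. leq a b}))"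
    unfolding net_filter_def
  proof (rule eventually_INF_base)
    show "I \<noteq> {}" using directed_set_nonempty[OF assms] .
    fix a b assume "a \<in> I" "b \<in> I"
    then obtain c where c: "c \<in> I" "leq a c" "leq b c"
      using directed_set_ub[OF assms] by blast
    have "leq a x" "leq b x" if "x \<in> I" "leq c x" for x
      using directed_set_trans[OF assms] \<open>a \<in> I\<close> \<open>b \<in> I\<close> c that by (blast, blast)
    then have "{x\<in>I. leq c x} \<subseteq> {x\<in>I. leq a x} \<inter> {x\<in>I. leq b x}" by blast
    then show "\<exists>x\<in>I. principal {c\<in>I. leq x c} \<le>
        inf (principal {b\<in>I. leq a b}) (principal {c\<in>I. leq b c})"
      using c(1) unfolding inf_principal principal_le_iff by (rule bexI)
  qed
  then show ?thesis by (auto simp: eventually_principal)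
qed

lemma levy_family_reindex:
  fixes I :: "'i set" and \<mu> :: "'g set \<Rightarrow> 'g measure"
  defines "tail \<equiv> \<lambda>leq K a. K ` {b\<in>I. leq a b}"
  assumes dir: "directed_set I leq"
    and J: "J = {(H, S). \<exists>a\<in>I. S = tail leq K a \<and> H \<in> S}"
    and dirJ: "directed_set J (\<lambda>p q. snd q \<subseteq> snd p)"
    and L: "levy_family I leq (\<lambda>_. Y) (\<lambda>_. d) (\<lambda>\<alpha>. \<mu> (K \<alpha>))"
  shows "levy_family J (\<lambda>p q. snd q \<subseteq> snd p) (\<lambda>_. Y) (\<lambda>_. d) (\<lambda>p. \<mu> (fst p))"
proof -
  let ?leq = "\<lambda>p q :: 'g set \<times> 'g set set. snd q \<subseteq> snd p"
  note evI = eventually_net_filter[OF dir] and evJ = eventually_net_filter[OF dirJ]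
  note refl = directed_set_refl[OF dir]
  have inJ: "(K a, tail leq K a) \<in> J" if "a \<in> I" for a
    using that refl by (auto simp: J tail_def)
  have memJ: "\<exists>b\<in>I. fst p = K b" if "p \<in> J" for p
    using that by (auto simp: J tail_def)
  have mmI: "mm_space Y d (\<mu> (K a))" if "a \<in> I" for a
    using L that by (auto simp: levy_family_def)
  have mm: "mm_space Y d (\<mu> (fst p))" if "p \<in> J" for p
    using memJ[OF that] mmI by auto
  have sp: "space (\<mu> (K a)) = Y" if "a \<in> I" for a
  proof -
    interpret Metric_space Y d using mmI[OF that] by (simp add: mm_space_def)
    have "sets (\<mu> (K a)) = sets (borel_of mtopology)"
      using mmI[OF that] by (simp add: mm_space_def)
    then have "space (\<mu> (K a)) = space (borel_of mtopology)" by (rule sets_eq_imp_space_eq)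
    also have "\<dots> = Y" by (simp add: borel_of_def space_measure_of_conv)
    finally show ?thesis .
  qed
  have pr: "prob_space (\<mu> (K a))" if "a \<in> I" for a
    using mmI[OF that] by (simp add: mm_space_def)
  have main: "((\<lambda>p. measure (\<mu> (fst p)) (eps_nbhd Y d (A p) \<epsilon>)) \<longlongrightarrow> 1) (net_filter J ?leq)"
    if A: "\<forall>p\<in>J. A p \<in> sets (\<mu> (fst p))"
      and lim: "0 < Liminf (net_filter J ?leq) (\<lambda>p. emeasure (\<mu> (fst p)) (A p))"
      and \<epsilon>: "\<epsilon> > 0" for A and \<epsilon> :: real
  proof (rule order_tendstoI)
    fix r :: real assume r: "r > 1"
    have "measure (\<mu> (fst p)) (eps_nbhd Y d (A p) \<epsilon>) < r" if p: "p \<in> J" for p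
    proof -
      have "prob_space (\<mu> (fst p))" using mm[OF p] by (simp add: mm_space_def)
      then have "measure (\<mu> (fst p)) (eps_nbhd Y d (A p) \<epsilon>) \<le> 1" by (rule prob_space.prob_le_1)
      then show ?thesis using r by linarith
    qed
    moreover obtain p where "p \<in> J" using directed_set_nonempty[OF dirJ] by blast
    ultimately show "\<forall>\<^sub>F p in net_filter J ?leq. measure (\<mu> (fst p)) (eps_nbhd Y d (A p) \<epsilon>) < r"
      unfolding evJ by blast
  next
    fix r :: real assume r: "r < 1"
    define bad where
      "bad p \<longleftrightarrow> p \<in> J \<and> \<not> r < measure (\<mu> (fst p)) (eps_nbhd Y d (A p) \<epsilon>)" for p
    obtain \<delta> :: ennreal where \<delta>: "0 < \<delta>" "\<delta> < Liminf (net_filter J ?leq) (\<lambda>p. emeasure (\<mu> (fst p)) (A p))"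
      using dense[OF lim] by blast
    then have "\<forall>\<^sub>F p in net_filter J ?leq. \<delta> < emeasure (\<mu> (fst p)) (A p)"
      using less_LiminfD by blast
    then obtain p0 where p0: "p0 \<in> J" "\<And>p. p \<in> J \<Longrightarrow> snd p \<subseteq> snd p0 \<Longrightarrow> \<delta> < emeasure (\<mu> (fst p)) (A p)"
      unfolding evJ by blast
    obtain a0 where a0: "a0 \<in> I" "snd p0 = tail leq K a0" using p0(1) by (auto simp: J)
    show "\<forall>\<^sub>F p in net_filter J ?leq. r < measure (\<mu> (fst p)) (eps_nbhd Y d (A p) \<epsilon>)"
    proof (rule ccontr)
      assume "\<not> ?thesis"
      then have ex_bad: "\<exists>q. bad q \<and> snd q \<subseteq> snd p" if "p \<in> J" for p
        unfolding evJ bad_def using that by blast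
      define C where "C a q \<longleftrightarrow> bad q \<and> fst q = K a \<and> snd q \<subseteq> snd p0" for a q
      define w where "w a = (SOME q. C a q)" for a
      define B where "B a = (if \<exists>q. C a q then A (w a) else Y)" for a
      have Cw: "C a (w a)" if "\<exists>q. C a q" for a unfolding w_def using that by (rule someI_ex)
      have w: "w a \<in> J" "fst (w a) = K a" "snd (w a) \<subseteq> snd p0"
        "\<not> r < measure (\<mu> (K a)) (eps_nbhd Y d (A (w a)) \<epsilon>)" if "\<exists>q. C a q" for a
        using Cw[OF that] unfolding C_def bad_def by auto
      have B1: "B a \<in> sets (\<mu> (K a))" if "a \<in> I" for a
      proof (cases "\<exists>q. C a q")
        case True
        with w(1,2)[OF True] A[rule_format, of "w a"] show ?thesis by (simp add: B_def)
      next
        case False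
        then show ?thesis using sets.top[of "\<mu> (K a)"] sp[OF that] by (simp add: B_def)
      qed
      have B2: "min \<delta> 1 \<le> emeasure (\<mu> (K a)) (B a)" if "a \<in> I" for a
      proof (cases "\<exists>q. C a q")
        case True
        with w(1-3)[OF True] p0(2)[of "w a"] show ?thesis
          by (simp add: B_def min.coboundedI1 less_imp_le)
      next
        case False
        then show ?thesis using prob_space.emeasure_space_1[OF pr[OF that]] sp[OF that]
          by (simp add: B_def)
      qed
      have "\<forall>\<^sub>F a in net_filter I leq. min \<delta> 1 \<le> emeasure (\<mu> (K a)) (B a)"
        unfolding evI using a0(1) B2 by blast
      then have "min \<delta> 1 \<le> Liminf (net_filter I leq) (\<lambda>a. emeasure (\<mu> (K a)) (B a))"
        by (rule Liminf_bounded)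
      then have "0 < Liminf (net_filter I leq) (\<lambda>a. emeasure (\<mu> (K a)) (B a))"
        by (rule less_le_trans[rotated]) (simp add: \<delta>(1))
      then have "((\<lambda>a. measure (\<mu> (K a)) (eps_nbhd Y d (B a) \<epsilon>)) \<longlongrightarrow> 1) (net_filter I leq)"
        using L B1 \<epsilon> unfolding levy_family_def by blast
      then have "\<forall>\<^sub>F a in net_filter I leq. r < measure (\<mu> (K a)) (eps_nbhd Y d (B a) \<epsilon>)"
        using r by (rule order_tendstoD)
      then obtain a1 where a1: "a1 \<in> I"
        "\<And>b. b \<in> I \<Longrightarrow> leq a1 b \<Longrightarrow> r < measure (\<mu> (K b)) (eps_nbhd Y d (B b) \<epsilon>)"
        unfolding evI by blast
      obtain a2 where a2: "a2 \<in> I" "leq a0 a2" "leq a1 a2"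
        using directed_set_ub[OF dir a0(1) a1(1)] by blast
      note trans = directed_set_trans[OF dir]
      have sub: "tail leq K a2 \<subseteq> tail leq K a0"
        unfolding tail_def using trans[OF a0(1) a2(1) _ a2(2)] by blast
      obtain q where q: "bad q" "snd q \<subseteq> tail leq K a2" using ex_bad[OF inJ[OF a2(1)]] by auto
      have "fst q \<in> snd q" using q(1) by (auto simp: bad_def J)
      then obtain b where b: "b \<in> I" "leq a2 b" "fst q = K b"
        using q(2) by (auto simp: tail_def)
      have "C b q" using q b sub a0(2) by (auto simp: C_def)
      then have ex: "\<exists>q. C b q" by blast
      from w(4)[OF ex] have "\<not> r < measure (\<mu> (K b)) (eps_nbhd Y d (B b) \<epsilon>)"
        using ex by (simp add: B_def)
      moreover have "leq a1 b" using trans[OF a1(1) a2(1) b(1) a2(3) b(2)] .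
      ultimately show False using a1(2) b by blast
    qed
  qed
  show ?thesis
    unfolding levy_family_def
  proof (intro conjI ballI allI impI)
    fix p assume "p \<in> J" then show "mm_space Y d (\<mu> (fst p))" by (rule mm)
  next
    fix A and \<epsilon> :: real
    assume "\<forall>p\<in>J. A p \<in> sets (\<mu> (fst p))"
      and "0 < Liminf (net_filter J ?leq) (\<lambda>p. emeasure (\<mu> (fst p)) (A p))" and "0 < \<epsilon>"
    then show "((\<lambda>p. measure (\<mu> (fst p)) (eps_nbhd Y d (A p) \<epsilon>)) \<longlongrightarrow> 1) (net_filter J ?leq)"
      by (rule main)
  qed
qed

lemma levy_groupI:
  fixes I :: "'i set"
  assumes "topological_group G T" "metrizable_space T" and net: "levy_net G T I leq K"
  shows "levy_group G T"
proof -
  define tail where "tail a = K ` {b\<in>I. leq a b}" for a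
  define J where "J = {(H, S). \<exists>a\<in>I. S = tail a \<and> H \<in> S}"
  let ?leq = "\<lambda>p q. snd q \<subseteq> snd p"
  have dir: "directed_set I leq" using net by (simp add: levy_net_def)
  note refl = directed_set_refl[OF dir]
  note trans = directed_set_trans[OF dir]
  have inJ: "(K a, tail a) \<in> J" if "a \<in> I" for a
    using that refl by (auto simp: J_def tail_def)
  have dirJ: "directed_set J ?leq"
    unfolding directed_set_def
  proof (intro conjI ballI)
    show "J \<noteq> {}" using directed_set_nonempty[OF dir] inJ by blast
    fix p q assume "p \<in> J" "q \<in> J"
    obtain a where a: "a \<in> I" "snd p = tail a" using \<open>p \<in> J\<close> unfolding J_def by auto
    obtain b where b: "b \<in> I" "snd q = tail b" using \<open>q \<in> J\<close> unfolding J_def by auto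
    note ab = a(1) b(1) a(2) b(2)
    then obtain c where c: "c \<in> I" "leq a c" "leq b c"
      using directed_set_ub[OF dir ab(1,2)] by blast
    have "tail c \<subseteq> tail a" "tail c \<subseteq> tail b"
      unfolding tail_def using trans[OF ab(1) c(1) _ c(2)] trans[OF ab(2) c(1) _ c(3)] by blast+
    then show "\<exists>r\<in>J. snd r \<subseteq> snd p \<and> snd r \<subseteq> snd q"
      unfolding ab(3,4) by (intro bexI[OF _ inJ[OF c(1)]]) simp
  qed auto
  have "levy_net G T J ?leq fst"
    unfolding levy_net_def
  proof (intro conjI allI impI dirJ)
    show "\<forall>p\<in>J. subgroup (fst p) G \<and> compactin T (fst p)"
      using net by (auto simp: levy_net_def J_def tail_def)
    fix d assume d: "compatible_right_invariant_metric G T d"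
    have L: "levy_family I leq (\<lambda>_. carrier G) (\<lambda>_. d) (\<lambda>\<alpha>. haar_on G T (K \<alpha>))"
      using net d by (auto simp: levy_net_def)
    show "levy_family J ?leq (\<lambda>_. carrier G) (\<lambda>_. d) (\<lambda>p. haar_on G T (fst p))"
      by (rule levy_family_reindex[OF dir _ dirJ L]) (simp add: J_def tail_def)
    fix S and \<epsilon> :: real assume S: "finite S" "S \<subseteq> carrier G" "\<epsilon> > 0"
    then obtain a where a: "a \<in> I" "\<forall>b\<in>I. leq a b \<longrightarrow> (\<forall>g\<in>S. (INF h\<in>K b. d g h) < \<epsilon>)"
      using net d unfolding levy_net_def by blast
    show "\<exists>p\<in>J. \<forall>q\<in>J. snd q \<subseteq> snd p \<longrightarrow> (\<forall>g\<in>S. (INF h\<in>fst q. d g h) < \<epsilon>)"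
    proof (intro bexI[OF _ inJ[OF a(1)]] ballI impI)
      fix q g assume q: "q \<in> J" "snd q \<subseteq> snd (K a, tail a)" "g \<in> S"
      have "fst q \<in> snd q" using q(1) by (auto simp: J_def)
      then obtain b where "b \<in> I" "leq a b" "fst q = K b" using q(2) by (auto simp: tail_def)
      then show "(INF h\<in>fst q. d g h) < \<epsilon>" using a q(3) by auto
    qed
  qed
  then show ?thesis using assms unfolding levy_group_def by blast
qed

end

theory Submission
  imports Defs "HOL-Probability.Weak_Convergence"
begin

text \<open>
  The compact subgroups are the finite groups of permutations of the \<open>2\<^sup>n\<close> dyadic pieces of \<open>X\<close>,
  where \<open>X\<close> is identified with the unit interval up to a null set.  For a function on a symmetric
  group on \<open>N\<close> letters that is 1-Lipschitz for the Hamming distance, conditioning on the image of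
  one letter after the other bounds the variance by \<open>9 N\<close>; as the distance is normalised by \<open>N\<close>,
  Chebyshev's inequality already gives concentration.  A right-invariant metric is controlled by
  the normalised Hamming distance, uniformly in \<open>n\<close>, because a permutation that moves few pieces
  is close to the identity in the strong topology.  Density is the weak approximation theorem: the
  dyadic approximations of the images of the pieces of one level are matched with the pieces
  themselves by a permutation of a finer level.
\<close>

section \<open>Concentration of measure in symmetric groups\<close>

text \<open>The conditions must hold for every compatible right-invariant metric \<open>d\<close>,
  of which only the topology and the invariance are known. Distances between permutations are
  therefore reduced to neighbourhoods of the identity: a pair \<open>p\<close>, \<open>s\<close> is
  as far apart as \<open>p\<close> composed with the inverse of \<open>s\<close> is from the
  identity, and this product moves exactly as many letters as \<open>p\<close> and \<open>s\<close>
  have disagreements. The series metric built from countably many vectors is only auxiliary: it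
  yields metrizability and a neighbourhood base described by finitely many dyadic pieces. A second
  moment suffices because the Levy property fixes a lower bound on the measure of the sets, while
  the variance of a normalised Lipschitz function is at most 9 / N. The other obstacle is that the
  coding is invertible only almost everywhere, whereas representatives of group elements are honest
  bijections whose compositions are taken at every point. The subgroups must come from an exact
  action, which is why a conull set invariant under all exchanges is constructed before any
  permutation is lifted.\<close>

lemma sum_square_dev_split:
  fixes f :: "'a \<Rightarrow> real" and c m :: real
  assumes "finite P" "P \<noteq> {}" and c: "c = sum f P / card P"
  shows "(\<Sum>p\<in>P. (f p - m)\<^sup>2) = (\<Sum>p\<in>P. (f p - c)\<^sup>2) + card P * (c - m)\<^sup>2"
proof -
  have "(\<Sum>p\<in>P. f p - c) = 0"
    using assms by (simp add: sum_subtractf)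
  moreover have "(f p - m)\<^sup>2 = (f p - c)\<^sup>2 + 2 * (c - m) * (f p - c) + (c - m)\<^sup>2" for p
    by (simp add: power2_eq_square algebra_simps)
  ultimately show ?thesis
    by (simp add: sum.distrib sum_distrib_left[symmetric])
qed

text \<open>Every permutation of \<open>insert a S\<close> is uniquely a transposition of
  \<open>a\<close> and \<open>b\<close> after some \<open>q\<close> permuting \<open>S\<close>,
  where \<open>b\<close> is the image of \<open>a\<close>. This splits the sum into blocks indexed
  by \<open>b\<close>. Each block inherits the Lipschitz property and is covered by the induction
  hypothesis; the block means lie within 3 of the total mean, so each letter adds at most 9 to the
  variance.\<close>

lemma permutation_variance_bound:
  fixes f :: "('a \<Rightarrow> 'a) \<Rightarrow> real"
  assumes "finite S"
    and "\<And>p q. p permutes S \<Longrightarrow> q permutes S \<Longrightarrow> \<bar>f p - f q\<bar> \<le> card {i\<in>S. p i \<noteq> q i}"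
  shows "(\<Sum>p | p permutes S. (f p - (\<Sum>p | p permutes S. f p) / fact (card S))\<^sup>2)
           \<le> 9 * real (card S) * fact (card S)"
  using assms
proof (induction S arbitrary: f rule: finite_induct)
  case empty
  then show ?case by simp
next
  case (insert a S f)
  let ?P = "{p. p permutes S}" and ?n = "card S"
  define F where "F b q = f (Transposition.transpose a b \<circ> q)" for b q
  define c where "c b = (\<Sum>q\<in>?P. F b q) / fact ?n" for b
  define m where "m = (\<Sum>p | p permutes insert a S. f p) / fact (card (insert a S))"
  have finP: "finite ?P" using insert.hyps by (simp add: finite_permutations)
  have cardP: "card ?P = fact ?n" using insert.hyps by (simp add: card_permutations)
  have neP: "?P \<noteq> {}" using permutes_id by blast
  have perm: "Transposition.transpose a b \<circ> q permutes insert a S" if "q permutes S" "b \<in> insert a S" for b q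
    using that by (intro permutes_compose permutes_swap_id permutes_subset[OF that(1)]) auto
  have lipF: "\<bar>F b p - F b q\<bar> \<le> card {i\<in>S. p i \<noteq> q i}"
    if "b \<in> insert a S" "p permutes S" "q permutes S" for b p q
  proof -
    have "{i \<in> insert a S. (Transposition.transpose a b \<circ> p) i \<noteq> (Transposition.transpose a b \<circ> q) i} = {i\<in>S. p i \<noteq> q i}"
      using insert.hyps that(2,3) by (auto simp: permutes_not_in transpose_eq_iff)
    then show ?thesis
      using insert.prems[OF perm[OF that(2,1)] perm[OF that(3,1)]] by (simp only: F_def)
  qed
  have lip_bc: "\<bar>c b - c b'\<bar> \<le> 3" if b: "b \<in> insert a S" "b' \<in> insert a S" for b b'
  proof -
    have "\<bar>F b q - F b' q\<bar> \<le> 3" if q: "q \<in> ?P" for q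
    proof -
      \<comment> \<open>The two products can disagree only where \<open>q\<close> takes one of the
        values \<open>a\<close>, \<open>b\<close>, \<open>b'\<close>; this is the origin of the
        3.\<close>
      have "{i \<in> insert a S. (Transposition.transpose a b \<circ> q) i \<noteq> (Transposition.transpose a b' \<circ> q) i} \<subseteq> q -` {a, b, b'}"
        by (auto simp: Transposition.transpose_def)
      also have "\<dots> = inv_into UNIV q ` {a, b, b'}"
        using q by (simp add: bij_vimage_eq_inv_image permutes_bij)
      finally have "card {i \<in> insert a S. (Transposition.transpose a b \<circ> q) i \<noteq> (Transposition.transpose a b' \<circ> q) i}
          \<le> card (inv_into UNIV q ` {a, b, b'})"
        by (rule card_mono[rotated]) simp
      also have "\<dots> \<le> card {a, b, b'}" by (rule card_image_le) simp
      also have "\<dots> \<le> 3" by (simp add: card_insert_if)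
      finally have "card {i \<in> insert a S. (Transposition.transpose a b \<circ> q) i \<noteq> (Transposition.transpose a b' \<circ> q) i} \<le> 3" .
      then have le3: "real (card {i \<in> insert a S. (Transposition.transpose a b \<circ> q) i \<noteq> (Transposition.transpose a b' \<circ> q) i}) \<le> 3"
        by linarith
      have qS: "q permutes S" using q by simp
      then show ?thesis
        using insert.prems[OF perm[OF qS b(1)] perm[OF qS b(2)]] le3
        unfolding F_def by linarith
    qed
    then have "\<bar>\<Sum>q\<in>?P. (F b q - F b' q)\<bar> \<le> 3 * fact ?n"
      using sum_bounded_above[of ?P "\<lambda>q. \<bar>F b q - F b' q\<bar>" 3] cardP
      by (intro order.trans[OF sum_abs]) (simp add: mult.commute)
    then show ?thesis
      by (simp add: c_def diff_divide_distrib[symmetric] sum_subtractf[symmetric] field_simps)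
  qed
  have fact_insert: "fact (card (insert a S)) = (real ?n + 1) * fact ?n"
    using insert.hyps by simp
  have "x / fact ?n = (real ?n + 1) * (x / ((real ?n + 1) * fact ?n))" for x
    by (simp add: add_nonneg_eq_0_iff)
  then have m: "(\<Sum>b\<in>insert a S. c b) = (real ?n + 1) * m"
    unfolding m_def sum_over_permutations_insert[OF insert.hyps] c_def F_def
      sum_divide_distrib[symmetric] fact_insert .
  have cm: "\<bar>c b - m\<bar> \<le> 3" if b: "b \<in> insert a S" for b
  proof -
    have "(real ?n + 1) * (c b - m) = (\<Sum>b'\<in>insert a S. c b - c b')"
      using insert.hyps m by (simp add: sum_subtractf algebra_simps)
    also have "\<bar>\<dots>\<bar> \<le> (\<Sum>b'\<in>insert a S. 3)"
      by (intro order.trans[OF sum_abs] sum_mono lip_bc b)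
    also have "\<dots> = (real ?n + 1) * 3" using insert.hyps by simp
    finally have "(real ?n + 1) * \<bar>c b - m\<bar> \<le> (real ?n + 1) * 3" by (simp add: abs_mult)
    then show ?thesis
      by (rule mult_left_le_imp_le) simp
  qed
  have "(\<Sum>p | p permutes insert a S. (f p - m)\<^sup>2)
      = (\<Sum>b\<in>insert a S. \<Sum>q\<in>?P. (F b q - m)\<^sup>2)"
    unfolding sum_over_permutations_insert[OF insert.hyps] F_def ..
  \<comment> \<open>Law of total variance: the first summand bounds the variance inside the block,
    the second the squared offset of the block mean from the total mean.\<close>
  also have "\<dots> \<le> (\<Sum>b\<in>insert a S. 9 * real ?n * fact ?n + fact ?n * 9)"
  proof (intro sum_mono)
    fix b assume b: "b \<in> insert a S"
    have "(\<Sum>q\<in>?P. (F b q - c b)\<^sup>2) \<le> 9 * real ?n * fact ?n"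
      using insert.IH[OF lipF[OF b]] unfolding c_def by blast
    moreover have "(c b - m)\<^sup>2 \<le> 3\<^sup>2"
      using cm[OF b] by (metis abs_le_square_iff abs_numeral)
    then have "fact ?n * (c b - m)\<^sup>2 \<le> fact ?n * 9" by simp
    moreover have "(\<Sum>q\<in>?P. (F b q - m)\<^sup>2) = (\<Sum>q\<in>?P. (F b q - c b)\<^sup>2) + fact ?n * (c b - m)\<^sup>2"
      using sum_square_dev_split[OF finP neP, of "c b" "F b" m] cardP by (simp add: c_def)
    ultimately show "(\<Sum>q\<in>?P. (F b q - m)\<^sup>2) \<le> 9 * real ?n * fact ?n + fact ?n * 9" by linarith
  qed
  also have "\<dots> = 9 * real (card (insert a S)) * fact (card (insert a S))"
    using insert.hyps by (simp add: algebra_simps)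
  finally show ?case unfolding m_def .
qed

text \<open>The variance bound is applied to the Hamming distance \<open>f\<close> to
  \<open>A\<close>. As \<open>f\<close> vanishes on \<open>A\<close>, which is a proportion
  \<open>\<delta>\<close> of the group, the mean satisfies
  \<open>\<delta> * m\<^sup>2 \<le> 9 * N\<close> with \<open>N\<close> the number of letters, and
  \<open>large\<close> turns this into \<open>m \<le> \<eta> * N / 2\<close>. Points at distance at
  least \<open>\<eta> * N\<close> thus deviate from the mean by at least half of that, and
  Chebyshev's inequality counts them. Both occurrences of 36 are 9 times the 4 that comes from
  squaring this half.\<close>

lemma permutation_concentration_bound:
  fixes \<delta> \<eta> :: real
  assumes S: "finite S" "S \<noteq> {}" and A: "A \<subseteq> {p. p permutes S}" "\<delta> * fact (card S) \<le> card A"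
    and pos: "\<delta> > 0" "\<eta> > 0" and large: "36 / (\<delta> * \<eta>\<^sup>2) \<le> card S"
  shows "card {p. p permutes S \<and> (\<forall>q\<in>A. \<eta> * card S \<le> card {i\<in>S. p i \<noteq> q i})}
           \<le> 36 / (\<eta>\<^sup>2 * card S) * fact (card S)"
proof -
  let ?N = "card S" and ?P = "{p. p permutes S}"
  define ham where "ham p q = card {i\<in>S. p i \<noteq> q i}" for p q :: "'a \<Rightarrow> 'a"
  define f where "f p = Min (ham p ` A)" for p
  define m where "m = (\<Sum>p\<in>?P. real (f p)) / fact ?N"
  define B where "B = {p. p permutes S \<and> (\<forall>q\<in>A. \<eta> * ?N \<le> card {i\<in>S. p i \<noteq> q i})}"
  have N: "?N > 0" using S by (simp add: card_gt_0_iff)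
  have finP: "finite ?P" using S by (simp add: finite_permutations)
  have finA: "finite A" using A(1) finP by (rule finite_subset)
  have "0 < \<delta> * fact ?N" using pos by simp
  then have neA: "A \<noteq> {}" using A(2) by auto
  have tri: "ham p r \<le> ham p q + ham q r" for p q r
    unfolding ham_def using S
    by (intro order.trans[OF card_mono card_Un_le]) auto
  have sym: "ham p q = ham q p" for p q by (simp add: ham_def eq_commute)
  have lip1: "f p \<le> ham p q + f q" for p q
  proof -
    have "f q \<in> ham q ` A" unfolding f_def using finA neA by (intro Min_in) auto
    then obtain r where r: "r \<in> A" "f q = ham q r" by auto
    have "f p \<le> ham p r" unfolding f_def using finA r by simp
    then show ?thesis using tri[of p r q] r by simp
  qed
  have lip: "\<bar>real (f p) - real (f q)\<bar> \<le> card {i\<in>S. p i \<noteq> q i}" for p q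
    using lip1[of p q] lip1[of q p] sym[of p q] by (simp add: ham_def)
  have V: "(\<Sum>p\<in>?P. (real (f p) - m)\<^sup>2) \<le> 9 * real ?N * fact ?N"
    using permutation_variance_bound[OF S(1) lip] unfolding m_def .
  have fA: "f p = 0" if "p \<in> A" for p
  proof -
    have "f p \<le> ham p p" unfolding f_def using finA that by simp
    then show ?thesis by (simp add: ham_def)
  qed
  have "card A * m\<^sup>2 = (\<Sum>p\<in>A. (real (f p) - m)\<^sup>2)" using fA by simp
  also have "\<dots> \<le> 9 * real ?N * fact ?N"
    using V A(1) finP by (intro order.trans[OF sum_mono2 V]) auto
  finally have "\<delta> * fact ?N * m\<^sup>2 \<le> 9 * real ?N * fact ?N"
    using A(2) by (meson mult_right_mono order_trans zero_le_power2)
  then have "\<delta> * m\<^sup>2 \<le> 9 * real ?N" by (simp add: field_simps)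
  moreover have "36 \<le> ?N * (\<delta> * \<eta>\<^sup>2)"
    using large pos by (simp add: field_simps)
  ultimately have "\<delta> * (4 * m\<^sup>2) \<le> \<delta> * (\<eta> * ?N)\<^sup>2"
  proof -
    assume 1: "\<delta> * m\<^sup>2 \<le> 9 * real ?N" and 2: "36 \<le> ?N * (\<delta> * \<eta>\<^sup>2)"
    have "36 * real ?N \<le> ?N * (\<delta> * \<eta>\<^sup>2) * ?N" using 2 by (rule mult_right_mono) simp
    then show ?thesis using 1 by (simp add: power2_eq_square algebra_simps)
  qed
  then have "(2 * m)\<^sup>2 \<le> (\<eta> * ?N)\<^sup>2" using pos by (simp add: power_mult_distrib)
  then have m: "m \<le> \<eta> * ?N / 2"
    using pos by (metis (no_types, opaque_lifting) abs_le_square_iff abs_ge_self abs_of_nonneg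
      field_sum_of_halves less_imp_le mult_2 mult_nonneg_nonneg of_nat_0_le_iff order_trans
      add_le_cancel_left linorder_not_le add_strict_mono)
  have fB: "(\<eta> * ?N / 2)\<^sup>2 \<le> (real (f p) - m)\<^sup>2" if "p \<in> B" for p
  proof -
    have "f p \<in> ham p ` A" unfolding f_def using finA neA by (intro Min_in) auto
    then have "\<eta> * ?N \<le> f p" using that by (auto simp: B_def ham_def)
    then have "\<eta> * ?N / 2 \<le> real (f p) - m" using m by linarith
    then show ?thesis using pos by (intro power_mono) auto
  qed
  have "card B * (\<eta> * ?N / 2)\<^sup>2 \<le> (\<Sum>p\<in>B. (real (f p) - m)\<^sup>2)"
    using sum_bounded_below[of B "(\<eta> * ?N / 2)\<^sup>2", OF fB] by simp
  also have "\<dots> \<le> 9 * real ?N * fact ?N"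
    using finP by (intro order.trans[OF sum_mono2 V]) (auto simp: B_def)
  finally have "card B * (\<eta>\<^sup>2 * ?N) * ?N \<le> 36 * fact ?N * real ?N"
    by (simp add: power2_eq_square algebra_simps)
  then have "card B * (\<eta>\<^sup>2 * ?N) \<le> 36 * fact ?N"
    by (rule mult_right_le_imp_le) (use N in simp)
  then show ?thesis
    using N pos unfolding B_def[symmetric] by (simp add: field_simps)
qed

section \<open>Coding a non-atomic standard Borel space by the unit interval\<close>

lemma sets_borel_of: "sets (borel_of X) = sigma_sets (topspace X) {U. openin X U}"
  unfolding borel_of_def by (rule sets_measure_of) (auto dest: openin_subset)

lemma space_borel_of [simp]: "space (borel_of X) = topspace X"
  by (simp add: borel_of_def space_measure_of_conv)

lemma borel_of_open: "openin X U \<Longrightarrow> U \<in> sets (borel_of X)"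
  by (simp add: sets_borel_of)

text \<open>Only the digits 0 and 1 occur, so no carry can happen and the digits of a code are Borel
  functions of it.\<close>

definition ternary_code :: "(nat \<Rightarrow> bool) \<Rightarrow> real" where
  "ternary_code b = (\<Sum>s. of_bool (b s) * (1/3) ^ Suc s)"

primrec ternary_rem :: "nat \<Rightarrow> real \<Rightarrow> real" where
  "ternary_rem 0 y = y"
| "ternary_rem (Suc t) y = 3 * ternary_rem t y - of_bool (1/3 \<le> ternary_rem t y)"

lemma summable_ternary_code: "summable (\<lambda>s. of_bool (b s) * (1/3 :: real) ^ Suc s)"
  by (rule summable_comparison_test'[of "\<lambda>s. (1/3) ^ Suc s" 0])
     (auto simp: summable_geometric summable_mult)

lemma ternary_code_nonneg: "0 \<le> ternary_code b"
  unfolding ternary_code_def by (intro suminf_nonneg summable_ternary_code) auto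

lemma ternary_code_le: "ternary_code b \<le> 1/2"
proof -
  have "(\<lambda>s. (1/3) * (1/3 :: real) ^ s) sums ((1/3) * (1 / (1 - 1/3)))"
    by (intro sums_mult geometric_sums) auto
  then have "(\<lambda>s. (1/3 :: real) ^ Suc s) sums (1/2)" by simp
  then show ?thesis
    unfolding ternary_code_def
    by (intro sums_le[OF _ summable_sums[OF summable_ternary_code]]) auto
qed

lemma ternary_code_Suc: "ternary_code b = (of_bool (b 0) + ternary_code (\<lambda>s. b (Suc s))) / 3"
proof -
  have "(\<Sum>s. of_bool (b (Suc s)) * (1/3 :: real) ^ Suc (Suc s))
      = ternary_code b - of_bool (b 0) * (1/3) ^ Suc 0"
    unfolding ternary_code_def by (rule suminf_split_head[OF summable_ternary_code])
  moreover have "(\<Sum>s. of_bool (b (Suc s)) * (1/3 :: real) ^ Suc (Suc s))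
      = (\<Sum>s. (1/3) * (of_bool (b (Suc s)) * (1/3) ^ Suc s))"
    by (intro suminf_cong) simp
  moreover have "\<dots> = 1/3 * ternary_code (\<lambda>s. b (Suc s))"
    unfolding ternary_code_def by (rule suminf_mult[OF summable_ternary_code])
  ultimately show ?thesis by simp
qed

text \<open>The digits after the first contribute at most 1/6, so a leading 0 stays well below 1/3
  and a leading 1 reaches it. Base 2 would leave no such gap.\<close>

lemma ternary_code_digit: "1/3 \<le> ternary_code b \<longleftrightarrow> b 0"
  using ternary_code_nonneg[of "\<lambda>s. b (Suc s)"] ternary_code_le[of "\<lambda>s. b (Suc s)"]
  by (subst ternary_code_Suc) (auto simp: of_bool_def)

lemma ternary_rem_code: "ternary_rem t (ternary_code b) = ternary_code (\<lambda>s. b (t + s))"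
proof (induction t)
  case (Suc t)
  show ?case
    using ternary_code_Suc[of "\<lambda>s. b (t + s)"] ternary_code_digit[of "\<lambda>s. b (t + s)"]
    by (simp add: Suc)
qed simp

lemma measurable_ternary_rem [measurable]: "ternary_rem t \<in> borel_measurable borel"
  by (induction t) simp_all

text \<open>A point is coded by the sequence whose \<open>n\<close>-th entry is the first member of a dense sequence at
  distance less than \<open>2\<^sup>-\<^sup>n\<close>; by completeness a code is decoded as a limit.  Because the decoder is a
  measurable left inverse, no theorem on images of Borel sets is needed.\<close>

lemma standard_borel_real_coding:
  fixes M :: "'a measure"
  assumes "standard_borel M" "space M \<noteq> {}"
  shows "\<exists>(h :: 'a \<Rightarrow> real) k. h \<in> borel_measurable M \<and> k \<in> measurable borel M \<and> (\<forall>x\<in>space M. k (h x) = x)"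
proof -
  obtain X where X: "completely_metrizable_space X" "second_countable X"
    "topspace X = space M" "sets M = sets (borel_of X)"
    using assms(1) unfolding standard_borel_def by blast
  obtain S d where Sd: "Metric_space S d" "Metric_space.mcomplete S d"
    "X = Metric_space.mtopology S d"
    using X(1) unfolding completely_metrizable_space_def by blast
  interpret Metric_space S d by fact
  have S: "space M = S" using X(3) Sd(3) by simp
  obtain C where C: "countable C" "C \<subseteq> S" "mtopology closure_of C = S"
    using second_countable_imp_separable_space[OF X(2)] Sd(3) unfolding separable_space_def by auto
  have dense: "\<exists>y\<in>C. d y x < r" if "x \<in> S" "r > 0" for x r
  proof -
    have "x \<in> mtopology closure_of C" using C(3) that by simp
    then have "\<forall>r>0. \<exists>y\<in>C. y \<in> mball x r" unfolding metric_closure_of by blast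
    then obtain y where "y \<in> C" "y \<in> mball x r" using \<open>r > 0\<close> by blast
    then show ?thesis using commute[of x y] by (intro bexI[of _ y]) simp_all
  qed
  have "C \<noteq> {}" 
  proof -
    obtain x where "x \<in> S" using assms(2) S by auto
    then show ?thesis using dense[of x 1] by auto
  qed
  define e where "e = from_nat_into C"
  have range_e: "range e = C" unfolding e_def using \<open>C \<noteq> {}\<close> C(1) by (rule range_from_nat_into)
  have eS: "e i \<in> S" for i using range_e C(2) by auto
  have dense_e: "\<exists>i. d (e i) x < r" if "x \<in> S" "r > 0" for x r
    using dense[OF that] range_e by (metis imageE)
  have sets_open: "U \<in> sets M" if "openin mtopology U" for U
    using that Sd(3) X(4) borel_of_open by blast
  \<comment> \<open>The bits run over all pairs \<open>(n, i)\<close> and record whether the dense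
    point \<open>e i\<close> lies within \<open>(1/2) ^ n\<close> of \<open>x\<close>, so the first
    such \<open>i\<close> for each \<open>n\<close> can be read back off the code.\<close>
  define B where "B t x \<longleftrightarrow> d (e (snd (prod_decode t))) x < (1/2) ^ fst (prod_decode t)" for t x
  have B_sets: "{x\<in>space M. B t x} \<in> sets M" for t
  proof -
    have "{x\<in>space M. B t x} = mball (e (snd (prod_decode t))) ((1/2) ^ fst (prod_decode t))"
      using eS by (auto simp: B_def S)
    then show ?thesis using sets_open by simp
  qed
  define h where "h x = ternary_code (\<lambda>t. B t x)" for x
  have h [measurable]: "h \<in> borel_measurable M"
    unfolding h_def ternary_code_def
  proof (intro borel_measurable_suminf borel_measurable_times borel_measurable_const)
    fix t
    have "(\<lambda>x. of_bool (B t x)) = (\<lambda>x. if B t x then 1 else 0 :: real)" by auto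
    then show "(\<lambda>x. of_bool (B t x) :: real) \<in> borel_measurable M"
      using B_sets[of t] by (simp add: measurable_If)
  qed
  define idx where "idx n y = (LEAST i. 1/3 \<le> ternary_rem (prod_encode (n, i)) y)" for n y
  have idx_meas [measurable]: "idx n \<in> measurable borel (count_space UNIV)" for n
    unfolding idx_def by measurable
  \<comment> \<open>\<open>good\<close> is a Borel set of reals whose decoded sequences are Cauchy.
    It contains the codes of all points of the space; elsewhere the decoder takes the default value
    \<open>e 0\<close>.\<close>
  define good where
    "good y \<longleftrightarrow> (\<forall>n m. n \<le> m \<longrightarrow> d (e (idx n y)) (e (idx m y)) < 2 * (1/2) ^ n)" for y
  have good_meas [measurable]: "Measurable.pred borel good"
  proof -
    \<comment> \<open>Once the two indices are named, the metric condition is a constant for each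
      pair, and only countably many measurable events about \<open>idx\<close> remain.\<close>
    have "good = (\<lambda>y. \<forall>n m i j. idx n y = i \<longrightarrow> idx m y = j \<longrightarrow> n \<le> m \<longrightarrow> d (e i) (e j) < 2 * (1/2) ^ n)"
      by (auto simp: good_def fun_eq_iff)
    also have "Measurable.pred borel \<dots>" by measurable
    finally show ?thesis .
  qed
  define lim_pt where "lim_pt y l \<longleftrightarrow> l \<in> S \<and> (\<forall>n. d (e (idx n y)) l \<le> 2 * (1/2) ^ n)" for y l
  have half0: "\<exists>n. c * (1/2) ^ n < r" if "r > 0" "c > 0" for c r :: real
    using real_arch_pow_inv[of "r / c" "1/2"] that by (auto simp: field_simps)
  have ex_lim: "\<exists>l. lim_pt y l" if "good y" for y
  proof -
    have "MCauchy (\<lambda>n. e (idx n y))"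
      unfolding MCauchy_def
    proof (intro conjI allI impI)
      show "range (\<lambda>n. e (idx n y)) \<subseteq> S" using eS by auto
      fix \<epsilon> :: real assume "\<epsilon> > 0"
      then obtain N where N: "2 * (1/2) ^ N < \<epsilon>" using half0[of \<epsilon> 2] by auto
      have *: "d (e (idx n y)) (e (idx m y)) < \<epsilon>" if "N \<le> n" "n \<le> m" for n m
      proof -
        have "d (e (idx n y)) (e (idx m y)) < 2 * (1/2) ^ n" using \<open>good y\<close> that by (simp add: good_def)
        also have "\<dots> \<le> 2 * (1/2) ^ N" using that by (simp add: power_decreasing)
        finally show ?thesis using N by simp
      qed
      show "\<exists>N. \<forall>n n'. N \<le> n \<longrightarrow> N \<le> n' \<longrightarrow> d (e (idx n y)) (e (idx n' y)) < \<epsilon>"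
      proof (intro exI allI impI)
        fix n n' assume "N \<le> n" "N \<le> n'"
        then show "d (e (idx n y)) (e (idx n' y)) < \<epsilon>"
          using *[of n n'] *[of n' n] by (cases "n \<le> n'") (auto simp: commute)
      qed
    qed
    then obtain l where l: "limitin mtopology (\<lambda>n. e (idx n y)) l sequentially"
      using Sd(2) unfolding mcomplete_def by blast
    then have lS: "l \<in> S" using limitin_mspace by blast
    have "d (e (idx n y)) l \<le> 2 * (1/2) ^ n" for n
    proof (rule field_le_epsilon)
      fix \<epsilon> :: real assume "\<epsilon> > 0"
      then have "\<forall>\<^sub>F m in sequentially. d (e (idx m y)) l < \<epsilon>"
        using l unfolding limitin_metric by (auto elim: eventually_mono)
      then obtain m where m: "m \<ge> n" "d (e (idx m y)) l < \<epsilon>"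
        unfolding eventually_sequentially by (meson nle_le)
      have "d (e (idx n y)) l \<le> d (e (idx n y)) (e (idx m y)) + d (e (idx m y)) l"
        using eS lS by (intro triangle)
      also have "d (e (idx n y)) (e (idx m y)) < 2 * (1/2) ^ n" using \<open>good y\<close> m by (simp add: good_def)
      finally show "d (e (idx n y)) l \<le> 2 * (1/2) ^ n + \<epsilon>" using m by simp
    qed
    then show ?thesis using lS by (auto simp: lim_pt_def)
  qed
  define k where "k y = (if good y then SOME l. lim_pt y l else e 0)" for y
  have k_lim: "lim_pt y (k y)" if "good y" for y
    using someI_ex[OF ex_lim[OF that]] that by (simp add: k_def)
  have kS: "k y \<in> S" for y
    using k_lim[of y] eS by (cases "good y") (auto simp: lim_pt_def k_def)
  \<comment> \<open>The closed balls contain the limit and shrink to it, so membership in an open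
    set becomes a countable condition on the indices. This is how the decoder is seen to be
    measurable.\<close>
  have k_open: "k y \<in> U \<longleftrightarrow> (good y \<and> (\<exists>n. mcball (e (idx n y)) (2 * (1/2) ^ n) \<subseteq> U)) \<or> (\<not> good y \<and> e 0 \<in> U)"
    if U: "openin mtopology U" for U y
  proof (cases "good y")
    case True
    have in_ball: "k y \<in> mcball (e (idx n y)) (2 * (1/2) ^ n)" for n
      using k_lim[OF True] eS by (auto simp: lim_pt_def)
    have "\<exists>n. mcball (e (idx n y)) (2 * (1/2) ^ n) \<subseteq> U" if "k y \<in> U"
    proof -
      obtain r where r: "r > 0" "mball (k y) r \<subseteq> U"
        using U \<open>k y \<in> U\<close> unfolding openin_mtopology by blast
      \<comment> \<open>Both the radius of the ball and the distance from its centre to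
        \<open>k y\<close> are at most \<open>2 * (1/2) ^ n\<close>, hence the 4.\<close>
      obtain n where n: "4 * (1/2) ^ n < r" using half0[of r 4] r by auto
      have "mcball (e (idx n y)) (2 * (1/2) ^ n) \<subseteq> mball (k y) r"
      proof
        fix z assume z: "z \<in> mcball (e (idx n y)) (2 * (1/2) ^ n)"
        then have "d (k y) z \<le> d (e (idx n y)) (k y) + d (e (idx n y)) z"
          using triangle''[of "k y" "e (idx n y)" z] kS eS by auto
        also have "\<dots> \<le> 2 * (1/2) ^ n + 2 * (1/2) ^ n"
          using z in_ball[of n] by (intro add_mono) auto
        also have "\<dots> < r" using n by simp
        finally show "z \<in> mball (k y) r" using z kS by auto
      qed
      then show ?thesis using r by blast
    qed
    then show ?thesis using True in_ball by blast
  next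
    case False
    then show ?thesis by (simp add: k_def)
  qed
  have k: "k \<in> measurable borel M"
  proof -
    have "k \<in> measurable borel (borel_of X)"
      unfolding borel_of_def
    proof (rule measurable_measure_of)
      show "{U. openin X U} \<subseteq> Pow (topspace X)" using openin_subset by auto
      show "k \<in> space borel \<rightarrow> topspace X" using kS Sd(3) by simp
      fix U assume "U \<in> {U. openin X U}"
      then have U: "openin mtopology U" using Sd(3) by simp
      have "k -` U \<inter> space borel = {y\<in>space borel. (good y \<and> (\<exists>n i. idx n y = i \<and> mcball (e i) (2 * (1/2) ^ n) \<subseteq> U)) \<or> (\<not> good y \<and> e 0 \<in> U)}"
        using k_open[OF U] by auto
      also have "\<dots> \<in> sets borel" by measurable
      finally show "k -` U \<inter> space borel \<in> sets borel" .
    qed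
    moreover have "measurable borel (borel_of X) = measurable (borel :: real measure) M"
      using X(4) by (intro measurable_cong_sets) auto
    ultimately show ?thesis by simp
  qed
  have kh: "k (h x) = x" if x: "x \<in> space M" for x
  proof -
    have xS: "x \<in> S" using x S by simp
    have bit: "1/3 \<le> ternary_rem (prod_encode (n, i)) (h x) \<longleftrightarrow> d (e i) x < (1/2) ^ n" for n i
      unfolding h_def ternary_rem_code ternary_code_digit by (simp add: B_def)
    have idx: "d (e (idx n (h x))) x < (1/2) ^ n" for n
      unfolding idx_def bit by (rule LeastI_ex[OF dense_e[OF xS]]) simp
    have "good (h x)"
      unfolding good_def
    proof (intro allI impI)
      fix n m :: nat assume "n \<le> m"
      have "d (e (idx n (h x))) (e (idx m (h x))) \<le> d (e (idx n (h x))) x + d (e (idx m (h x))) x"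
        using eS xS by (intro triangle')
      also have "\<dots> < (1/2) ^ n + (1/2) ^ m" using idx by (intro add_strict_mono)
      also have "(1/2 :: real) ^ m \<le> (1/2) ^ n" using \<open>n \<le> m\<close> by (simp add: power_decreasing)
      finally show "d (e (idx n (h x))) (e (idx m (h x))) < 2 * (1/2) ^ n" by simp
    qed
    then have lim: "lim_pt (h x) (k (h x))" by (rule k_lim)
    have "d x (k (h x)) \<le> 3 * (1/2) ^ n" for n
    proof -
      have "d x (k (h x)) \<le> d (e (idx n (h x))) x + d (e (idx n (h x))) (k (h x))"
        using eS xS kS by (intro triangle'')
      also have "\<dots> \<le> (1/2) ^ n + 2 * (1/2) ^ n"
        using idx[of n] lim by (intro add_mono) (auto simp: lim_pt_def less_imp_le)
      finally show ?thesis by simp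
    qed
    then have "\<not> d x (k (h x)) > 0" using half0[of "d x (k (h x))" 3] by (meson not_less zero_less_numeral)
    then show ?thesis using xS kS by auto
  qed
  show ?thesis using h k kh by blast
qed

text \<open>The coding is composed with the distribution function of its law, which is continuous in the
  absence of atoms.\<close>

lemma non_atomic_uniform_coding:
  fixes M :: "'a measure"
  assumes "standard_borel M" "prob_space M" "non_atomic M"
  shows "\<exists>(g :: 'a \<Rightarrow> real) q. g \<in> borel_measurable M \<and> q \<in> measurable borel M \<and>
    (\<forall>x. 0 < g x \<and> g x < 1) \<and>
    (\<forall>B\<in>sets borel. emeasure M (g -` B \<inter> space M) = emeasure lborel (B \<inter> {0<..<1})) \<and>
    (AE x in M. q (g x) = x)"
proof -
  obtain h :: "'a \<Rightarrow> real" and k where hk [measurable]: "h \<in> borel_measurable M" "k \<in> measurable borel M"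
    and kh: "\<forall>x\<in>space M. k (h x) = x"
    using standard_borel_real_coding[OF assms(1) prob_space.not_empty[OF assms(2)]] by blast
  have kh_inj: "x = y" if "h x = h y" "x \<in> space M" "y \<in> space M" for x y
    using kh that by metis
  define N where "N = distr M borel h"
  \<comment> \<open>This supplies the distribution function \<open>C\<close> of \<open>N\<close> and
    its generalised inverse \<open>I\<close>, linked for \<open>u\<close> in the open unit interval
    by \<open>u \<le> C x \<longleftrightarrow> I u \<le> x\<close>.\<close>
  interpret cdf_distribution N
    unfolding N_def cdf_distribution_def 
    by (intro prob_space.real_distribution_distr[OF assms(2)] hk)
  have no_point: "measure N {y} = 0" for y
  proof -
    \<comment> \<open>A subset of a singleton is empty or all of it, so a charged point contradicts
      non-atomicity. Injectivity of \<open>h\<close> then keeps \<open>N\<close> free of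
      atoms.\<close>
    have mono_x: "emeasure M {x} = 0" if "x \<in> space M" for x
    proof (rule ccontr)
      assume "emeasure M {x} \<noteq> 0"
      moreover have "{x} = h -` {h x} \<inter> space M" using kh_inj that by blast
      then have "{x} \<in> sets M" using measurable_sets[OF hk(1), of "{h x}"] by simp
      ultimately obtain B where "B \<subseteq> {x}" "0 < emeasure M B" "emeasure M B < emeasure M {x}"
        using assms(3) unfolding non_atomic_def zero_less_iff_neq_zero by blast
      then show False by (auto simp: subset_singleton_iff)
    qed
    have "h -` {y} \<inter> space M = {} \<or> (\<exists>x\<in>space M. h -` {y} \<inter> space M = {x})"
      using kh_inj by blast
    then have "emeasure M (h -` {y} \<inter> space M) = 0" using mono_x by auto
    then show ?thesis by (simp add: N_def measure_def emeasure_distr)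
  qed
  have CI: "C (I u) = u" if u: "0 < u" "u < 1" for u
  proof (rule antisym)
    show "u \<le> C (I u)" using pseudoinverse[OF u, of "I u"] by simp
    show "C (I u) \<le> u"
    proof (rule ccontr)
      assume "\<not> C (I u) \<le> u"
      moreover have "(C \<longlongrightarrow> C (I u)) (at_left (I u))"
        using isCont_cdf[of "I u"] no_point unfolding isCont_def
        by (simp add: filterlim_at_split)
      ultimately have "\<forall>\<^sub>F x in at_left (I u). u < C x" by (intro order_tendstoD) auto
      moreover have "\<forall>\<^sub>F x in at_left (I u). x < I u" by (simp add: eventually_at_filter)
      ultimately have "\<forall>\<^sub>F x in at_left (I u). u < C x \<and> x < I u" by (rule eventually_conj)
      then obtain x where "u < C x" "x < I u"
        using eventually_happens[of _ "at_left (I u)"] by (auto simp: trivial_limit_at_left_real)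
      then show False using pseudoinverse[OF u, of x] by simp
    qed
  qed
  let ?U = "restrict_space lborel {0<..<1::real}"
  \<comment> \<open>The default 1/2 keeps every value strictly inside the unit interval. It does not
    disturb the law: \<open>N\<close> is carried by the values of \<open>I\<close>, where
    \<open>C\<close> is neither 0 nor 1.\<close>
  define G where "G y = (if 0 < C y \<and> C y < 1 then C y else 1/2)" for y
  have G [measurable]: "G \<in> borel_measurable borel" unfolding G_def by measurable
  have I_meas: "I \<in> measurable ?U borel"
    using measurable_CI by (simp add: measurable_cong_sets[OF sets_restrict_space_cong[OF sets_lborel] refl])
  have N_I: "distr ?U borel I = N" by (rule distr_I_eq_M)
  define q where "q u = k (if u \<in> {0<..<1} then I u else 0)" for u
  have "(\<lambda>u. if u \<in> {0<..<1} then I u else 0) \<in> borel_measurable borel"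
  proof -
    have "{u :: real. 0 < u \<and> u < 1} = {0<..<1}" by auto
    then show ?thesis
      using measurable_CI by (subst measurable_If_restrict_space_iff) auto
  qed
  then have q: "q \<in> measurable borel M"
    unfolding q_def by measurable
  define g where "g x = G (h x)" for x
  have g: "g \<in> borel_measurable M" unfolding g_def by measurable
  have g01: "0 < g x \<and> g x < 1" for x by (simp add: g_def G_def)
  have law: "emeasure M (g -` B \<inter> space M) = emeasure lborel (B \<inter> {0<..<1})" if B [measurable]: "B \<in> sets borel" for B
  proof -
    have "emeasure M (g -` B \<inter> space M) = emeasure M (h -` (G -` B) \<inter> space M)"
      by (simp add: g_def vimage_def)
    also have "\<dots> = emeasure N (G -` B)"
      unfolding N_def using measurable_sets[OF G B] by (simp add: emeasure_distr)
    also have "\<dots> = emeasure (distr ?U borel I) (G -` B)" by (simp only: N_I)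
    also have "\<dots> = emeasure ?U (I -` (G -` B) \<inter> space ?U)"
      using measurable_sets[OF G B] by (simp add: emeasure_distr[OF I_meas])
    also have "I -` (G -` B) \<inter> space ?U = B \<inter> {0<..<1}"
      using CI by (auto simp: space_restrict_space G_def)
    also have "emeasure ?U (B \<inter> {0<..<1}) = emeasure lborel (B \<inter> {0<..<1})"
      by (rule emeasure_restrict_space) auto
    finally show ?thesis .
  qed
  have meas: "{y\<in>space borel. (if G y \<in> {0<..<1} then I (G y) else 0) = y} \<in> sets borel"
  proof -
    have [measurable]: "(\<lambda>u. if u \<in> {0<..<1} then I u else 0) \<in> borel_measurable borel" by fact
    have "(\<lambda>y. if G y \<in> {0<..<1} then I (G y) else 0) \<in> borel_measurable borel"
      by (rule measurable_compose[OF G]) fact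
    then show ?thesis by measurable
  qed
  \<comment> \<open>\<open>C\<close> may be constant on intervals, so it has no inverse as such. But
    \<open>N\<close> is the image of the uniform law under \<open>I\<close>, and at a point
    \<open>I u\<close> the claim follows from \<open>C (I u) = u\<close>.\<close>
  have "AE y in distr ?U borel I. (if G y \<in> {0<..<1} then I (G y) else 0) = y"
    unfolding AE_distr_iff[OF I_meas meas]
    by (rule AE_I2) (use CI in \<open>auto simp: space_restrict_space G_def\<close>)
  then have "AE y in N. (if G y \<in> {0<..<1} then I (G y) else 0) = y" by (simp only: N_I)
  then have "AE y in distr M borel h. (if G y \<in> {0<..<1} then I (G y) else 0) = y"
    unfolding N_def[symmetric] .
  from AE_distrD[OF hk(1) this]
  have "AE x in M. (if G (h x) \<in> {0<..<1} then I (G (h x)) else 0) = h x" .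
  then have "AE x in M. q (g x) = x"
    by (rule AE_mp) (rule AE_I2, auto simp: q_def g_def kh split: if_splits)
  then show ?thesis using g q g01 law by blast
qed

section \<open>Dyadic permutations\<close>

abbreviation level_perm :: "nat \<Rightarrow> (nat \<Rightarrow> nat) \<Rightarrow> bool" where
  "level_perm n p \<equiv> p permutes {..<2 ^ n}"

definition cell :: "nat \<Rightarrow> real \<Rightarrow> nat" where
  "cell n y = nat \<lfloor>2 ^ n * y\<rfloor>"

text \<open>A dyadic interval exchange: each cell is carried to another one by a
  translation.\<close>

definition cell_shift :: "nat \<Rightarrow> (nat \<Rightarrow> nat) \<Rightarrow> real \<Rightarrow> real" where
  "cell_shift n p y = y + (real (p (cell n y)) - real (cell n y)) / 2 ^ n"

lemma cell_eq_iff: "0 \<le> y \<Longrightarrow> cell n y = j \<longleftrightarrow> real j / 2 ^ n \<le> y \<and> y < (real j + 1) / 2 ^ n"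
proof -
  assume "0 \<le> y"
  then have "0 \<le> \<lfloor>2 ^ n * y\<rfloor>" by simp
  then have "cell n y = j \<longleftrightarrow> \<lfloor>2 ^ n * y\<rfloor> = int j" unfolding cell_def by linarith
  also have "\<dots> \<longleftrightarrow> real j \<le> 2 ^ n * y \<and> 2 ^ n * y < real j + 1" by (simp add: floor_eq_iff)
  finally show ?thesis by (simp add: field_simps)
qed

lemma cell_less: "0 \<le> y \<Longrightarrow> y < 1 \<Longrightarrow> cell n y < 2 ^ n"
  unfolding cell_def by (simp add: nat_less_iff floor_less_iff)

lemma cell_bounds: "0 \<le> y \<Longrightarrow> real (cell n y) \<le> 2 ^ n * y \<and> 2 ^ n * y < real (cell n y) + 1"
  using cell_eq_iff[of y n "cell n y"] by (simp add: field_simps)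

lemma measurable_cell [measurable]: "cell n \<in> measurable borel (count_space UNIV)"
  unfolding cell_def by measurable

lemma measurable_cell_shift [measurable]: "cell_shift n p \<in> borel_measurable borel"
  unfolding cell_shift_def by measurable

lemma cell_shift_scaled: "2 ^ n * cell_shift n p y = 2 ^ n * y - real (cell n y) + real (p (cell n y))"
  by (simp add: cell_shift_def field_simps)

lemma cell_shift_nonneg: "0 \<le> y \<Longrightarrow> 0 \<le> cell_shift n p y"
  using cell_bounds[of y n] cell_shift_scaled[of n p y]
  by (smt (verit) of_nat_0_le_iff zero_le_mult_iff zero_less_power)

lemma cell_cell_shift: "0 \<le> y \<Longrightarrow> cell n (cell_shift n p y) = p (cell n y)"
  using cell_bounds[of y n] cell_shift_scaled[of n p y]
  by (subst cell_eq_iff[OF cell_shift_nonneg]) (auto simp: field_simps)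

lemma cell_shift_less_1:
  assumes "0 \<le> y" "y < 1" "level_perm n p"
  shows "cell_shift n p y < 1"
proof -
  have "p (cell n y) < 2 ^ n"
    using permutes_in_image[OF assms(3), of "cell n y"] cell_less[OF assms(1,2)] by simp
  then have "real (p (cell n y)) + 1 \<le> 2 ^ n"
    by (metis Suc_leI of_nat_Suc of_nat_le_iff of_nat_numeral of_nat_power add.commute)
  then have "2 ^ n * cell_shift n p y < 2 ^ n * 1"
    using cell_bounds[OF assms(1), of n] cell_shift_scaled[of n p y] by linarith
  then show ?thesis by (simp only: mult_less_cancel_left_pos zero_less_power zero_less_numeral)
qed

lemma cell_shift_comp:
  "0 \<le> y \<Longrightarrow> cell_shift n p (cell_shift n \<tau> y) = cell_shift n (p \<circ> \<tau>) y"
  unfolding cell_shift_def[of n p "cell_shift n \<tau> y"] cell_cell_shift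
  by (simp add: cell_shift_def field_simps)

lemma cell_shift_id: "cell_shift n id y = y"
  by (simp add: cell_shift_def)

text \<open>All exchanges of all levels move points by dyadic rationals. Since these are countable,
  a single conull set can be closed under every exchange at once.\<close>

lemma cell_shift_dyadic: "\<exists>k::int. cell_shift n p y = y + real_of_int k / 2 ^ n"
  by (rule exI[of _ "int (p (cell n y)) - int (cell n y)"]) (simp add: cell_shift_def)

lemma emeasure_lborel_translate:
  assumes "A \<in> sets borel"
  shows "emeasure lborel ((\<lambda>y. y + c) -` A) = emeasure lborel (A :: real set)"
proof -
  have "emeasure lborel A = emeasure (distr lborel borel ((+) c)) A" by (simp add: lborel_distr_plus)
  also have "\<dots> = emeasure lborel ((\<lambda>y. y + c) -` A)"
    using assms by (subst emeasure_distr) (auto simp: add.commute vimage_def)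
  finally show ?thesis ..
qed

abbreviation dyadic_interval :: "nat \<Rightarrow> nat \<Rightarrow> real set" where
  "dyadic_interval n j \<equiv> {real j / 2 ^ n..<(real j + 1) / 2 ^ n}"

text \<open>The half-open cells cover 0, whereas the coding takes values in the open interval; the
  discrepancy is one null point.\<close>

lemma emeasure_unit_interval:
  assumes [measurable]: "B \<in> sets borel"
  shows "emeasure lborel (B \<inter> {0<..<1::real}) = (\<Sum>j<2 ^ n. emeasure lborel (B \<inter> dyadic_interval n j))"
proof -
  have "emeasure lborel (B \<inter> {0<..<1::real}) = emeasure lborel (B \<inter> {0..<1})"
    using AE_lborel_singleton[of "0::real"] by (intro emeasure_eq_AE) (auto elim!: eventually_mono)
  also have "B \<inter> {0..<1} = (\<Union>j<2 ^ n. B \<inter> dyadic_interval n j)"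
  proof (intro equalityI subsetI)
    fix y assume y: "y \<in> B \<inter> {0..<1}"
    then have "cell n y < 2 ^ n" "y \<in> B \<inter> dyadic_interval n (cell n y)"
      using cell_less[of y n] cell_eq_iff[of y n "cell n y"] by auto
    then show "y \<in> (\<Union>j<2 ^ n. B \<inter> dyadic_interval n j)" by blast
  next
    fix y assume "y \<in> (\<Union>j<2 ^ n. B \<inter> dyadic_interval n j)"
    then obtain j where j: "j < 2 ^ n" "y \<in> B" "real j / 2 ^ n \<le> y" "y < (real j + 1) / 2 ^ n" by auto
    have "real j + 1 \<le> 2 ^ n"
      using j(1) by (metis Suc_leI of_nat_Suc of_nat_le_iff of_nat_numeral of_nat_power add.commute)
    then have "(real j + 1) / 2 ^ n \<le> 1" by simp
    moreover have "0 \<le> real j / 2 ^ n" by simp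
    ultimately have "0 \<le> y" "y < 1" using j(3,4) by linarith+
    then show "y \<in> B \<inter> {0..<1}" using j(2) by simp
  qed
  also have "emeasure lborel \<dots> = (\<Sum>j<2 ^ n. emeasure lborel (B \<inter> dyadic_interval n j))"
  proof (rule sum_emeasure[symmetric])
    show "disjoint_family_on (\<lambda>j. B \<inter> dyadic_interval n j) {..<2 ^ n}"
      unfolding disjoint_family_on_def
    proof (intro ballI impI, rule ccontr)
      fix i j :: nat assume "i \<noteq> j"
        and "(B \<inter> dyadic_interval n i) \<inter> (B \<inter> dyadic_interval n j) \<noteq> {}"
      then obtain y where y: "real i / 2 ^ n \<le> y" "y < (real i + 1) / 2 ^ n" "real j / 2 ^ n \<le> y" "y < (real j + 1) / 2 ^ n"
        by auto
      have "0 \<le> real i / 2 ^ n" by simp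
      then have "0 \<le> y" using y(1) by linarith
      then show False using cell_eq_iff[of y n i] cell_eq_iff[of y n j] y \<open>i \<noteq> j\<close> by auto
    qed
  qed auto
  finally show ?thesis .
qed

text \<open>On a cell the exchange is a translation, which preserves Lebesgue measure, and over all
  cells the permutation only reorders the sum.\<close>

lemma emeasure_cell_shift:
  assumes B [measurable]: "B \<in> sets borel" and p: "level_perm n p"
  shows "emeasure lborel (cell_shift n p -` B \<inter> {0<..<1}) = emeasure lborel (B \<inter> {0<..<1})"
proof -
  let ?J = "dyadic_interval n"
  have piece: "emeasure lborel (cell_shift n p -` B \<inter> ?J j) = emeasure lborel (B \<inter> ?J (p j))" for j
  proof -
    have "cell_shift n p -` B \<inter> ?J j = (\<lambda>y. y + (real (p j) - real j) / 2 ^ n) -` (B \<inter> ?J (p j))"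
      (is "?L = ?R")
    proof (rule Set.set_eqI)
      fix y :: real
      have 1: "real (p j) / 2 ^ n \<le> y + (real (p j) - real j) / 2 ^ n \<longleftrightarrow> real j / 2 ^ n \<le> y"
        and 2: "y + (real (p j) - real j) / 2 ^ n < (real (p j) + 1) / 2 ^ n \<longleftrightarrow> y < (real j + 1) / 2 ^ n"
        by (auto simp: add_divide_distrib diff_divide_distrib)
      have "cell n y = j" if "real j / 2 ^ n \<le> y" "y < (real j + 1) / 2 ^ n"
      proof -
        have "0 \<le> real j / 2 ^ n" by simp
        then have "0 \<le> y" using that by linarith
        then show ?thesis using that cell_eq_iff by blast
      qed
      then show "y \<in> ?L \<longleftrightarrow> y \<in> ?R"
        using 1 2 by (auto simp: cell_shift_def)
    qed
    moreover have "B \<inter> ?J (p j) \<in> sets borel" by simp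
    ultimately show ?thesis by (simp only: emeasure_lborel_translate)
  qed
  have "emeasure lborel (cell_shift n p -` B \<inter> {0<..<1}) = (\<Sum>j<2 ^ n. emeasure lborel (B \<inter> ?J (p j)))"
    using measurable_sets[OF measurable_cell_shift B, of n p]
    by (subst emeasure_unit_interval[of _ n]) (simp_all add: piece)
  also have "\<dots> = (\<Sum>j<2 ^ n. emeasure lborel (B \<inter> ?J j))"
    using sum.permute[OF p, of "\<lambda>j. emeasure lborel (B \<inter> ?J j)"] by (simp add: comp_def)
  also have "\<dots> = emeasure lborel (B \<inter> {0<..<1})"
    by (rule emeasure_unit_interval[OF B, symmetric])
  finally show ?thesis .
qed

text \<open>An isomorphism with the unit interval modulo null sets, kept in the form of a uniformly
  distributed \<open>g\<close> with an almost sure measurable left inverse \<open>q\<close>.\<close>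

locale uniform_coding = prob_space M for M :: "'a measure" +
  fixes g :: "'a \<Rightarrow> real" and q :: "real \<Rightarrow> 'a"
  assumes g [measurable]: "g \<in> borel_measurable M" and q [measurable]: "q \<in> measurable borel M"
    and g_pos: "0 < g x" and g_less: "g x < 1"
    and g_law: "B \<in> sets borel \<Longrightarrow> emeasure M (g -` B \<inter> space M) = emeasure lborel (B \<inter> {0<..<1})"
    and q_g: "AE x in M. q (g x) = x"
begin

definition pos :: "nat \<Rightarrow> 'a \<Rightarrow> nat" where
  "pos n x = cell n (g x)"

lemma measurable_pos [measurable]: "pos n \<in> measurable M (count_space UNIV)"
  unfolding pos_def by measurable

lemma pos_less: "pos n x < 2 ^ n"
  unfolding pos_def by (intro cell_less less_imp_le[OF g_pos] g_less)

definition piece :: "nat \<Rightarrow> nat \<Rightarrow> 'a set" where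
  "piece n j = {x\<in>space M. pos n x = j}"

lemma piece_sets [measurable]: "piece n j \<in> sets M"
  unfolding piece_def by measurable

lemma measure_piece: "j < 2 ^ n \<Longrightarrow> prob (piece n j) = 1 / 2 ^ n"
proof -
  assume j: "j < 2 ^ n"
  have piece: "piece n j = g -` dyadic_interval n j \<inter> space M"
    unfolding piece_def pos_def using cell_eq_iff[OF less_imp_le[OF g_pos]] by auto
  have le: "real j + 1 \<le> 2 ^ n"
    using j by (metis Suc_leI of_nat_Suc of_nat_le_iff of_nat_numeral of_nat_power add.commute)
  have "emeasure M (piece n j) = emeasure lborel (dyadic_interval n j \<inter> {0<..<1})"
    unfolding piece by (rule g_law) simp
  also have "\<dots> = emeasure lborel (dyadic_interval n j)"
  proof (intro emeasure_eq_AE)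
    have "y \<in> {0<..<1}" if "y \<noteq> 0" "y \<in> dyadic_interval n j" for y
    proof -
      have "0 \<le> real j / 2 ^ n" "(real j + 1) / 2 ^ n \<le> 1" using le by simp_all
      then have "0 \<le> y" "y < 1" using that(2) unfolding atLeastLessThan_iff by linarith+
      then show ?thesis using that(1) by simp
    qed
    then show "AE y in lborel. (y \<in> dyadic_interval n j \<inter> {0<..<1})
        = (y \<in> dyadic_interval n j)"
      using AE_lborel_singleton[of "0::real"] by (auto elim!: eventually_mono)
  qed auto
  also have "\<dots> = ennreal (1 / 2 ^ n)"
    by (subst emeasure_lborel_Ico) (auto simp: field_simps)
  finally show ?thesis by (simp add: measure_def)
qed

subsection \<open>Lifting dyadic interval exchanges\<close>

text \<open>Dyadic interval exchanges are invertible on \<open>X\<close> only up to null sets; on a conull set that is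
  exactly invariant under all of them they become bijections.\<close>

lemma conull_invariant_core:
  "\<exists>core\<in>sets M. (AE x in M. x \<in> core) \<and>
     (\<forall>x\<in>core. q (g x) = x \<and>
        (\<forall>n p. level_perm n p \<longrightarrow>
           q (cell_shift n p (g x)) \<in> core \<and> g (q (cell_shift n p (g x))) = cell_shift n p (g x)))"
proof -
  obtain N where N: "N \<in> null_sets M" "{x\<in>space M. q (g x) \<noteq> x} \<subseteq> N"
    using q_g by (elim AE_E) (auto simp: null_sets_def)
  define X1 where "X1 = space M - N"
  have [measurable]: "X1 \<in> sets M" using N by (auto simp: X1_def)
  have X1: "AE x in M. x \<in> X1" using AE_not_in[OF N(1)] by (auto simp: X1_def)
  have qg: "q (g x) = x" if "x \<in> X1" for x using N(2) that by (auto simp: X1_def)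
  \<comment> \<open>\<open>Y0\<close> is the image of \<open>X1\<close> under \<open>g\<close>,
    written through \<open>q\<close> so that its measurability is evident.\<close>
  define Y0 where "Y0 = {y\<in>space borel. g (q y) = y \<and> q y \<in> X1}"
  have Y0 [measurable]: "Y0 \<in> sets borel" unfolding Y0_def by measurable
  have "emeasure lborel ((- Y0) \<inter> {0<..<1}) = emeasure M (g -` (- Y0) \<inter> space M)"
    by (rule g_law[symmetric]) (simp add: borel_comp)
  also have "\<dots> = emeasure M {}"
    by (rule emeasure_eq_AE) (use X1 qg in \<open>auto simp: Y0_def elim!: eventually_mono\<close>)
  finally have "(- Y0) \<inter> {0<..<1} \<in> null_sets lborel" by (auto simp: null_sets_def borel_comp)
  then have AEY0: "AE y in lborel. y \<in> {0<..<1} \<longrightarrow> y \<in> Y0"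
    by (rule AE_I') auto
  \<comment> \<open>The condition is imposed on all dyadic translates together, so it survives
    further dyadic translation. Excluding 0 matters: an exchange can send an inner point to 0, which
    is no code because \<open>g\<close> is positive.\<close>
  define W where "W = {y\<in>space borel. y \<in> {0<..<1} \<and>
      (\<forall>n (k::int). y + real_of_int k / 2 ^ n \<noteq> 0 \<and>
         (y + real_of_int k / 2 ^ n \<in> {0<..<1} \<longrightarrow> y + real_of_int k / 2 ^ n \<in> Y0))}"
  have W [measurable]: "W \<in> sets borel" unfolding W_def by measurable
  have "AE y in lborel. y + c \<noteq> 0" for c :: real
    using AE_lborel_singleton[of "- c"] by (auto elim!: eventually_mono)
  moreover have "AE y in lborel. y + c \<in> {0<..<1} \<longrightarrow> y + c \<in> Y0" for c :: real
  proof -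
    have "AE y in distr lborel borel ((+) c). y \<in> {0<..<1} \<longrightarrow> y \<in> Y0"
      using AEY0 unfolding lborel_distr_plus .
    then show ?thesis by (subst (asm) AE_distr_iff) (auto simp: add.commute)
  qed
  ultimately have "AE y in lborel. \<forall>n (k::int). y + real_of_int k / 2 ^ n \<noteq> 0 \<and>
         (y + real_of_int k / 2 ^ n \<in> {0<..<1} \<longrightarrow> y + real_of_int k / 2 ^ n \<in> Y0)"
    unfolding AE_all_countable by (intro allI AE_conjI)
  then have AEW: "AE y in lborel. y \<in> {0<..<1} \<longrightarrow> y \<in> W"
    by eventually_elim (simp add: W_def)
  have AEgW: "AE x in M. g x \<in> W"
  proof (rule AE_I')
    have "emeasure M (g -` (- W) \<inter> space M) = emeasure lborel ((- W) \<inter> {0<..<1})"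
      by (rule g_law) (simp add: borel_comp)
    also have "\<dots> = emeasure lborel ({} :: real set)"
      by (rule emeasure_eq_AE) (use AEW in \<open>auto simp: borel_comp elim!: eventually_mono\<close>)
    finally show "g -` (- W) \<inter> space M \<in> null_sets M"
      using measurable_sets[OF g, of "- W"] by (auto simp: null_sets_def borel_comp)
  qed auto
  have shiftW: "cell_shift n p y \<in> W" if y: "y \<in> W" and p: "level_perm n p" for y n p
  proof -
    have y01: "0 < y" "y < 1" using y by (auto simp: W_def)
    obtain k :: int where k: "cell_shift n p y = y + real_of_int k / 2 ^ n"
      using cell_shift_dyadic by blast
    have "cell_shift n p y \<noteq> 0" using y unfolding k W_def by auto
    then have "cell_shift n p y \<in> {0<..<1}"
      using cell_shift_nonneg[of y n p] cell_shift_less_1[of y p n] y01 p by auto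
    moreover have eq: "cell_shift n p y + real_of_int k' / 2 ^ m =
        y + real_of_int (k * 2 ^ m + k' * 2 ^ n) / 2 ^ (n + m)" for k' m
      unfolding k by (simp add: field_simps power_add)
    moreover have Wy: "y + real_of_int K / 2 ^ m \<noteq> 0 \<and>
        (y + real_of_int K / 2 ^ m \<in> {0<..<1} \<longrightarrow> y + real_of_int K / 2 ^ m \<in> Y0)" for K m
      using y by (simp add: W_def)
    ultimately show ?thesis
      unfolding W_def
    proof (intro CollectI conjI allI)
      fix m and k' :: int
      show "cell_shift n p y + real_of_int k' / 2 ^ m \<noteq> 0" unfolding eq using Wy by blast
      show "cell_shift n p y + real_of_int k' / 2 ^ m \<in> {0<..<1} \<longrightarrow>
          cell_shift n p y + real_of_int k' / 2 ^ m \<in> Y0"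
        unfolding eq using Wy by blast
    qed simp
  qed
  have WY0: "y \<in> Y0" if "y \<in> W" for y
  proof -
    have "y + real_of_int 0 / 2 ^ 0 \<in> {0<..<1} \<longrightarrow> y + real_of_int 0 / 2 ^ 0 \<in> Y0"
      using that unfolding W_def by blast
    then show ?thesis using that by (simp add: W_def)
  qed
  define core where "core = {x\<in>space M. x \<in> X1 \<and> g x \<in> W}"
  show ?thesis
  proof (intro bexI[of _ core] conjI ballI allI impI)
    show "core \<in> sets M" unfolding core_def by measurable
    show "AE x in M. x \<in> core" using X1 AEgW AE_space unfolding core_def by eventually_elim auto
    fix x assume x: "x \<in> core"
    then show "q (g x) = x" using qg by (auto simp: core_def)
    fix n and p :: "nat \<Rightarrow> nat" assume p: "level_perm n p"
    have W': "cell_shift n p (g x) \<in> W" using x p shiftW by (auto simp: core_def)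
    then have Y': "cell_shift n p (g x) \<in> Y0" by (rule WY0)
    then show eq: "g (q (cell_shift n p (g x))) = cell_shift n p (g x)" by (auto simp: Y0_def)
    show "q (cell_shift n p (g x)) \<in> core"
      using Y' W' eq sets.sets_into_space[OF \<open>X1 \<in> sets M\<close>] by (auto simp: core_def Y0_def)
  qed
qed

definition core :: "'a set" where
  "core = (SOME core. core \<in> sets M \<and> (AE x in M. x \<in> core) \<and>
     (\<forall>x\<in>core. q (g x) = x \<and>
        (\<forall>n p. level_perm n p \<longrightarrow>
           q (cell_shift n p (g x)) \<in> core \<and> g (q (cell_shift n p (g x))) = cell_shift n p (g x))))"

lemma core_props:
  "core \<in> sets M" "AE x in M. x \<in> core" "x \<in> core \<Longrightarrow> q (g x) = x"
  "x \<in> core \<Longrightarrow> level_perm n p \<Longrightarrow> q (cell_shift n p (g x)) \<in> core"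
  "x \<in> core \<Longrightarrow> level_perm n p \<Longrightarrow> g (q (cell_shift n p (g x))) = cell_shift n p (g x)"
  using someI_ex[OF conull_invariant_core[unfolded Bex_def]] unfolding core_def[symmetric] by blast+

lemma core_space: "x \<in> core \<Longrightarrow> x \<in> space M"
  using sets.sets_into_space[OF core_props(1)] by auto

text \<open>The identity off \<open>core\<close> makes the composition law and invertibility hold at
  every point of the space, as the members of \<open>mp_auts\<close> have to be bijections.\<close>

definition cell_perm :: "nat \<Rightarrow> (nat \<Rightarrow> nat) \<Rightarrow> 'a \<Rightarrow> 'a" where
  "cell_perm n p = (\<lambda>x\<in>space M. if x \<in> core then q (cell_shift n p (g x)) else x)"

lemma cell_perm_core: "x \<in> core \<Longrightarrow> cell_perm n p x = q (cell_shift n p (g x))"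
  using core_space by (simp add: cell_perm_def)

lemma cell_perm_core_in: "x \<in> core \<Longrightarrow> level_perm n p \<Longrightarrow> cell_perm n p x \<in> core"
  by (simp add: cell_perm_core core_props)

lemma cell_perm_not_core: "x \<in> space M \<Longrightarrow> x \<notin> core \<Longrightarrow> cell_perm n p x = x"
  by (simp add: cell_perm_def)

lemma cell_perm_in_space: "x \<in> space M \<Longrightarrow> level_perm n p \<Longrightarrow> cell_perm n p x \<in> space M"
  by (cases "x \<in> core") (auto simp: cell_perm_not_core intro: core_space cell_perm_core_in)

lemma cell_perm_comp:
  assumes "x \<in> space M" "level_perm n p" "level_perm n \<tau>"
  shows "cell_perm n p (cell_perm n \<tau> x) = cell_perm n (p \<circ> \<tau>) x"
proof (cases "x \<in> core")
  case True
  then show ?thesis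
    using cell_perm_core[OF cell_perm_core_in[OF True assms(3)]] assms
    by (simp add: cell_perm_core core_props(5) cell_shift_comp less_imp_le[OF g_pos])
next
  case False
  then show ?thesis using assms by (simp add: cell_perm_not_core)
qed

lemma cell_perm_id: "x \<in> space M \<Longrightarrow> cell_perm n id x = x"
  by (cases "x \<in> core") (auto simp: cell_perm_core cell_perm_not_core cell_shift_id core_props)

lemma pos_cell_perm: "x \<in> core \<Longrightarrow> level_perm n p \<Longrightarrow> pos n (cell_perm n p x) = p (pos n x)"
  by (simp add: pos_def cell_perm_core core_props(5) cell_cell_shift less_imp_le[OF g_pos])

lemma cell_perm_measurable: 
  assumes "level_perm n p" shows "cell_perm n p \<in> measurable M M"
proof -
  have [measurable]: "core \<in> sets M" by (rule core_props)
  have "(\<lambda>x. if x \<in> core then q (cell_shift n p (g x)) else x) \<in> measurable M M" by measurable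
  then show ?thesis unfolding cell_perm_def by (simp cong: measurable_cong)
qed

lemma cell_perm_inverse:
  assumes "x \<in> space M" "level_perm n p"
  shows "cell_perm n (inv_into UNIV p) (cell_perm n p x) = x" "cell_perm n p (cell_perm n (inv_into UNIV p) x) = x"
  using cell_perm_comp[OF assms(1) permutes_inv[OF assms(2)] assms(2)] cell_perm_comp[OF assms(1,2) permutes_inv[OF assms(2)]]
    permutes_inv_o[OF assms(2)] cell_perm_id[OF assms(1)] by simp_all

lemma cell_perm_bij: "level_perm n p \<Longrightarrow> bij_betw (cell_perm n p) (space M) (space M)"
  by (rule bij_betw_byWitness[where f' = "cell_perm n (inv_into UNIV p)"])
     (auto simp: cell_perm_inverse cell_perm_in_space permutes_inv)

lemma inv_into_cell_perm:
  assumes "x \<in> space M" "level_perm n p"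
  shows "inv_into (space M) (cell_perm n p) x = cell_perm n (inv_into UNIV p) x"
  using inv_into_f_eq[OF bij_betw_imp_inj_on[OF cell_perm_bij[OF assms(2)]], of "cell_perm n (inv_into UNIV p) x" x]
  by (simp add: assms cell_perm_inverse cell_perm_in_space permutes_inv)

text \<open>On the conull \<open>core\<close> the map is the exchange conjugated by the coding. The
  law of \<open>g\<close> moves the question to Lebesgue measure, which the exchange preserves, and
  \<open>q_g\<close> moves the answer back.\<close>

lemma cell_perm_mp_auts: 
  assumes p: "level_perm n p" shows "cell_perm n p \<in> mp_auts M"
proof -
  have "cell_perm n p \<in> Bij (space M)"
    using cell_perm_bij[OF p] by (simp add: Bij_def cell_perm_def)
  moreover have "inv_into (space M) (cell_perm n p) \<in> measurable M M"
    using cell_perm_measurable[OF permutes_inv[OF p]] by (subst measurable_cong[OF inv_into_cell_perm[OF _ p]])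
  moreover have "distr M M (cell_perm n p) = M"
  proof (rule measure_eqI)
    fix A assume "A \<in> sets (distr M M (cell_perm n p))"
    then have A [measurable]: "A \<in> sets M" by simp
    have [measurable]: "cell_perm n p \<in> measurable M M" by (rule cell_perm_measurable[OF p])
    have B: "q -` A \<in> sets borel" using measurable_sets[OF q A] by simp
    have B': "cell_shift n p -` (q -` A) \<in> sets borel"
      using measurable_sets[OF measurable_cell_shift B] by simp
    have "emeasure (distr M M (cell_perm n p)) A = emeasure M (cell_perm n p -` A \<inter> space M)"
      by (simp add: emeasure_distr)
    also have "\<dots> = emeasure M (g -` (cell_shift n p -` (q -` A)) \<inter> space M)"
    proof (rule emeasure_eq_AE)
      show "AE x in M. (x \<in> cell_perm n p -` A \<inter> space M) = (x \<in> g -` cell_shift n p -` q -` A \<inter> space M)"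
        using core_props(2) by eventually_elim (simp add: cell_perm_core)
      show "g -` cell_shift n p -` q -` A \<inter> space M \<in> sets M"
        by (rule measurable_sets[OF g B'])
    qed measurable
    also have "\<dots> = emeasure lborel (q -` A \<inter> {0<..<1})"
      by (simp add: g_law[OF B'] emeasure_cell_shift[OF B p])
    also have "\<dots> = emeasure M (g -` (q -` A) \<inter> space M)" by (rule g_law[OF B, symmetric])
    also have "\<dots> = emeasure M A"
    proof (rule emeasure_eq_AE)
      show "AE x in M. (x \<in> g -` q -` A \<inter> space M) = (x \<in> A)"
        using q_g AE_space by eventually_elim auto
      show "g -` q -` A \<inter> space M \<in> sets M" by (rule measurable_sets[OF g B])
    qed simp
    finally show "emeasure (distr M M (cell_perm n p)) A = emeasure M A" .
  qed simp
  ultimately show ?thesis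
    using cell_perm_measurable[OF p] by (simp add: mp_auts_def)
qed

subsection \<open>Approximation by dyadic unions\<close>

lemma measure_sym_diff_triangle:
  assumes [measurable]: "A \<in> sets M" "B \<in> sets M" "C \<in> sets M"
  shows "prob (sym_diff A C) \<le> prob (sym_diff A B) + prob (sym_diff B C)"
proof -
  have "prob (sym_diff A C) \<le> prob (sym_diff A B \<union> sym_diff B C)"
    by (intro finite_measure_mono) auto
  also have "\<dots> \<le> prob (sym_diff A B) + prob (sym_diff B C)"
    by (intro measure_Un_le) auto
  finally show ?thesis .
qed

definition level :: "nat \<Rightarrow> nat set \<Rightarrow> 'a set" where
  "level n J = {x\<in>space M. pos n x \<in> J}"

lemma level_sets [measurable]: "level n J \<in> sets M"
  unfolding level_def by measurable

abbreviation approx_at :: "nat \<Rightarrow> 'a set \<Rightarrow> real \<Rightarrow> bool" where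
  "approx_at n A e \<equiv> \<exists>J\<subseteq>{..<2 ^ n}. prob (sym_diff A (level n J)) < e"

text \<open>Asking for all sufficiently fine levels rather than for one gives two sets a common
  level, as unions need, and later gives density along the whole tail of the net.\<close>

definition dyadic_approx :: "'a set \<Rightarrow> bool" where
  "dyadic_approx A \<longleftrightarrow> A \<in> sets M \<and>
     (\<forall>e>0. \<exists>N. \<forall>n\<ge>N. approx_at n A e)"

text \<open>Approximable sets are closed in the pseudometric given by the measure of the symmetric
  difference. This yields both insensitivity to null sets and passage from finite to countable
  unions.\<close>

lemma dyadic_approx_limit:
  assumes A [measurable]: "A \<in> sets M"
    and "\<And>e. e > 0 \<Longrightarrow> \<exists>B. dyadic_approx B \<and> prob (sym_diff A B) < e"
  shows "dyadic_approx A"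
  unfolding dyadic_approx_def
proof (intro conjI allI impI A)
  fix e :: real assume "e > 0"
  then obtain B where B: "dyadic_approx B" "prob (sym_diff A B) < e / 2"
    using assms(2)[of "e / 2"] by auto
  then have [measurable]: "B \<in> sets M" by (simp add: dyadic_approx_def)
  obtain N where N: "\<And>n. n \<ge> N \<Longrightarrow> approx_at n B (e / 2)"
    using B(1) \<open>e > 0\<close> unfolding dyadic_approx_def by (meson half_gt_zero)
  have "approx_at n A e" if n: "n \<ge> N" for n
  proof -
    obtain J where J: "J \<subseteq> {..<2 ^ n}" "prob (sym_diff B (level n J)) < e / 2"
      using N[OF n] by blast
    then show ?thesis
      using measure_sym_diff_triangle[of A B "level n J"] B(2) by (intro exI[of _ J]) auto
  qed
  then show "\<exists>N. \<forall>n\<ge>N. approx_at n A e" by blast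
qed

lemma dyadic_approx_AE:
  assumes "dyadic_approx B" and [measurable]: "A \<in> sets M" and eq: "AE x in M. x \<in> A \<longleftrightarrow> x \<in> B"
  shows "dyadic_approx A"
proof (rule dyadic_approx_limit)
  fix e :: real assume "e > 0"
  have [measurable]: "B \<in> sets M" using assms(1) by (simp add: dyadic_approx_def)
  have "prob (sym_diff A B) = prob {}"
    by (rule measure_eq_AE) (use eq in \<open>auto elim!: eventually_mono\<close>)
  then show "\<exists>B. dyadic_approx B \<and> prob (sym_diff A B) < e"
    using assms(1) \<open>e > 0\<close> by (intro exI[of _ B]) simp
qed fact

lemma dyadic_approx_compl:
  assumes "dyadic_approx A"
  shows "dyadic_approx (space M - A)"
  unfolding dyadic_approx_def
proof (intro conjI allI impI)
  have [measurable]: "A \<in> sets M" using assms by (simp add: dyadic_approx_def)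
  show "space M - A \<in> sets M" by measurable
  fix e :: real assume "e > 0"
  then obtain N where N: "\<And>n. n \<ge> N \<Longrightarrow> approx_at n A e"
    using assms unfolding dyadic_approx_def by meson
  have "approx_at n (space M - A) e" if n: "n \<ge> N" for n
  proof -
    obtain J where J: "J \<subseteq> {..<2 ^ n}" "prob (sym_diff A (level n J)) < e"
      using N[OF n] by blast
    have "sym_diff (space M - A) (level n ({..<2 ^ n} - J)) = sym_diff A (level n J)"
      using sets.sets_into_space[OF \<open>A \<in> sets M\<close>] by (auto simp: level_def pos_less)
    then show ?thesis using J by (intro exI[of _ "{..<2 ^ n} - J"]) auto
  qed
  then show "\<exists>N. \<forall>n\<ge>N. approx_at n (space M - A) e" by blast
qed

lemma dyadic_approx_empty: "dyadic_approx {}"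
  unfolding dyadic_approx_def by (auto intro!: exI[of _ "{}"] simp: level_def)

lemma dyadic_approx_Un:
  assumes "dyadic_approx A" "dyadic_approx B"
  shows "dyadic_approx (A \<union> B)"
  unfolding dyadic_approx_def
proof (intro conjI allI impI)
  have [measurable]: "A \<in> sets M" "B \<in> sets M" using assms by (auto simp: dyadic_approx_def)
  show "A \<union> B \<in> sets M" by measurable
  fix e :: real assume "e > 0"
  then obtain N1 N2 where
    N: "\<And>n. n \<ge> N1 \<Longrightarrow> approx_at n A (e / 2)"
       "\<And>n. n \<ge> N2 \<Longrightarrow> approx_at n B (e / 2)"
    using assms unfolding dyadic_approx_def by (meson half_gt_zero)
  have "approx_at n (A \<union> B) e" if n: "n \<ge> max N1 N2" for n
  proof -
    obtain J K where J: "J \<subseteq> {..<2 ^ n}" "prob (sym_diff A (level n J)) < e / 2"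
      and K: "K \<subseteq> {..<2 ^ n}" "prob (sym_diff B (level n K)) < e / 2"
      using N(1)[of n] N(2)[of n] n by auto
    have "prob (sym_diff (A \<union> B) (level n (J \<union> K)))
        \<le> prob (sym_diff A (level n J) \<union> sym_diff B (level n K))"
      by (intro finite_measure_mono) (auto simp: level_def)
    also have "\<dots> \<le> prob (sym_diff A (level n J)) + prob (sym_diff B (level n K))"
      by (intro measure_Un_le) auto
    finally show ?thesis using J K by (intro exI[of _ "J \<union> K"]) auto
  qed
  then show "\<exists>N. \<forall>n\<ge>N. approx_at n (A \<union> B) e" by blast
qed

lemma dyadic_approx_UN:
  assumes "\<And>i :: nat. dyadic_approx (A i)"
  shows "dyadic_approx (\<Union>i. A i)"
proof -
  have fin: "dyadic_approx (\<Union>i<n. A i)" for n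
    by (induction n) (auto simp: lessThan_Suc dyadic_approx_empty intro!: dyadic_approx_Un assms)
  have [measurable]: "A i \<in> sets M" for i using assms[of i] by (simp add: dyadic_approx_def)
  show ?thesis
  proof (rule dyadic_approx_limit)
    fix e :: real assume "e > 0"
    have "(\<lambda>n. prob (\<Union>i<n. A i)) \<longlonglongrightarrow> prob (\<Union>n. \<Union>i<n. A i)"
    proof (rule finite_Lim_measure_incseq)
      show "incseq (\<lambda>n. \<Union>i<n. A i)" unfolding incseq_def by (intro allI impI UN_mono) auto
    qed auto
    also have "(\<Union>n. \<Union>i<n. A i) = (\<Union>i. A i)" by blast
    finally have "\<forall>\<^sub>F n in sequentially. prob (\<Union>i. A i) - e < prob (\<Union>i<n. A i)"
      using \<open>e > 0\<close> by (intro order_tendstoD) auto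
    then obtain n where "prob (\<Union>i. A i) - e < prob (\<Union>i<n. A i)"
      by (auto simp: eventually_sequentially)
    moreover have "sym_diff (\<Union>i. A i) (\<Union>i<n. A i) = (\<Union>i. A i) - (\<Union>i<n. A i)" by auto
    moreover have "prob ((\<Union>i. A i) - (\<Union>i<n. A i)) = prob (\<Union>i. A i) - prob (\<Union>i<n. A i)"
      by (rule finite_measure_Diff) auto
    ultimately show "\<exists>B. dyadic_approx B \<and> prob (sym_diff (\<Union>i. A i) B) < e"
      using fin[of n] by (intro exI[of _ "\<Union>i<n. A i"]) simp
  qed measurable
qed

lemma dyadic_approx_lessThan: "dyadic_approx (g -` {..<a} \<inter> space M)"
  unfolding dyadic_approx_def
proof (intro conjI allI impI)
  show "g -` {..<a} \<inter> space M \<in> sets M" by (rule measurable_sets[OF g]) simp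
  fix e :: real assume "e > 0"
  then obtain N where N: "(1/2) ^ N < e" using real_arch_pow_inv[of e "1/2"] by auto
  have "approx_at n (g -` {..<a} \<inter> space M) e" if n: "n \<ge> N" for n
  proof -
    let ?J = "{j. j < 2 ^ n \<and> (real j + 1) / 2 ^ n \<le> a}"
    let ?c = "cell n a"
    have cell: "real (pos n x) / 2 ^ n \<le> g x \<and> g x < (real (pos n x) + 1) / 2 ^ n" for x
      unfolding pos_def using cell_eq_iff[OF less_imp_le[OF g_pos]] by blast
    \<comment> \<open>\<open>?J\<close> collects the cells entirely to the left of \<open>a\<close>,
      so only the cell that contains \<open>a\<close> can be misclassified. For \<open>a\<close> at
      least 1 there is no such cell, hence the conditional.\<close>
    have "sym_diff (g -` {..<a} \<inter> space M) (level n ?J) \<subseteq> (if ?c < 2 ^ n then piece n ?c else {})"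
    proof
      fix x assume x: "x \<in> sym_diff (g -` {..<a} \<inter> space M) (level n ?J)"
      have xs: "x \<in> space M" using x by (auto simp: level_def)
      have "g x < a" "a < (real (pos n x) + 1) / 2 ^ n"
        using x cell[of x] pos_less[of n x] by (auto simp: level_def)
      moreover have "0 \<le> a" using g_pos[of x] \<open>g x < a\<close> by linarith
      ultimately have "?c = pos n x"
        using cell[of x] by (subst cell_eq_iff) auto
      then show "x \<in> (if ?c < 2 ^ n then piece n ?c else {})"
        using xs pos_less[of n x] by (simp add: piece_def)
    qed
    then have "prob (sym_diff (g -` {..<a} \<inter> space M) (level n ?J))
        \<le> prob (if ?c < 2 ^ n then piece n ?c else {})"
      by (intro finite_measure_mono) auto
    also have "\<dots> \<le> (1/2) ^ n" by (simp add: measure_piece power_one_over)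
    also have "\<dots> \<le> (1/2) ^ N" using n by (simp add: power_decreasing)
    finally show ?thesis using N by (intro exI[of _ ?J]) auto
  qed
  then show "\<exists>N. \<forall>n\<ge>N. approx_at n (g -` {..<a} \<inter> space M) e"
    by blast
qed

lemma dyadic_approx_vimage: "B \<in> sets borel \<Longrightarrow> dyadic_approx (g -` B \<inter> space M)"
proof -
  assume "B \<in> sets borel"
  then have "B \<in> sigma_sets UNIV (range (\<lambda>a :: real. {..<a}))"
    unfolding borel_Iio by simp
  then show ?thesis
  proof induction
    case (Basic B)
    then show ?case using dyadic_approx_lessThan by auto
  next
    case (Compl B)
    have "g -` (UNIV - B) \<inter> space M = space M - (g -` B \<inter> space M)" by auto
    then show ?case using dyadic_approx_compl[OF Compl.IH] by simp
  next
    case (Union B)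
    have "g -` (\<Union>i. B i) \<inter> space M = (\<Union>i. g -` B i \<inter> space M)" by auto
    then show ?case using dyadic_approx_UN[OF Union.IH] by simp
  qed (simp add: dyadic_approx_empty)
qed

text \<open>Modulo a null set, \<open>A\<close> is the preimage under \<open>g\<close> of the Borel
  set of reals that \<open>q\<close> sends into \<open>A\<close>, and for preimages of Borel sets
  the half-lines generate everything.\<close>

lemma dyadic_approx:
  assumes "A \<in> sets M" shows "dyadic_approx A"
proof (rule dyadic_approx_AE[OF _ assms])
  show "dyadic_approx (g -` (q -` A) \<inter> space M)"
    using measurable_sets[OF q assms] by (intro dyadic_approx_vimage) simp
  show "AE x in M. x \<in> A \<longleftrightarrow> x \<in> g -` (q -` A) \<inter> space M"
    using q_g AE_space by eventually_elim auto
qed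

end

section \<open>The space of square-integrable functions\<close>

definition L2_class :: "'a measure \<Rightarrow> ('a \<Rightarrow> complex) \<Rightarrow> ('a \<Rightarrow> complex) set" where
  "L2_class M f = L2_rel M `` {f}"

lemma square_integrable_measurable [measurable_dest]:
  "f \<in> square_integrable M \<Longrightarrow> f \<in> borel_measurable M"
  by (simp add: square_integrable_def)

lemma square_integrable_integrable:
  "f \<in> square_integrable M \<Longrightarrow> integrable M (\<lambda>x. (cmod (f x))\<^sup>2)"
  by (simp add: square_integrable_def)

text \<open>The gap after the triangle inequality is the square of
  \<open>t * cmod a - cmod b\<close> divided by \<open>t\<close>. The free weight survives
  integration, and optimising it afterwards gives the triangle inequality for the norm.\<close>

lemma cmod_add_square_weighted:
  assumes "0 < t"
  shows "(cmod (a + b))\<^sup>2 \<le> (1 + t) * (cmod a)\<^sup>2 + (1 + 1 / t) * (cmod b)\<^sup>2"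
proof -
  have "(cmod (a + b))\<^sup>2 \<le> (cmod a + cmod b)\<^sup>2"
    by (intro power_mono norm_triangle_ineq) simp
  also have "\<dots> = (1 + t) * (cmod a)\<^sup>2 + (1 + 1 / t) * (cmod b)\<^sup>2 - (t * cmod a - cmod b)\<^sup>2 / t"
    using assms by (simp add: power2_eq_square field_simps)
  also have "\<dots> \<le> (1 + t) * (cmod a)\<^sup>2 + (1 + 1 / t) * (cmod b)\<^sup>2" using assms by simp
  finally show ?thesis .
qed

lemma square_integrable_add:
  assumes f: "f \<in> square_integrable M" and g: "g \<in> square_integrable M"
  shows "(\<lambda>x. f x + g x) \<in> square_integrable M"
proof -
  note [measurable] = square_integrable_measurable[OF f] square_integrable_measurable[OF g]
  have "integrable M (\<lambda>x. (cmod (f x + g x))\<^sup>2)"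
  proof (rule Bochner_Integration.integrable_bound)
    show "integrable M (\<lambda>x. 2 * (cmod (f x))\<^sup>2 + 2 * (cmod (g x))\<^sup>2)"
      using square_integrable_integrable[OF f] square_integrable_integrable[OF g] by simp
    show "AE x in M. norm ((cmod (f x + g x))\<^sup>2) \<le> norm (2 * (cmod (f x))\<^sup>2 + 2 * (cmod (g x))\<^sup>2)"
      using cmod_add_square_weighted[of 1] by (intro AE_I2) auto
  qed measurable
  then show ?thesis by (simp add: square_integrable_def)
qed

lemma square_integrable_scale:
  "f \<in> square_integrable M \<Longrightarrow> (\<lambda>x. c * f x) \<in> square_integrable M"
  by (auto simp: square_integrable_def norm_mult power_mult_distrib)

lemma square_integrable_diff:
  assumes "f \<in> square_integrable M" "g \<in> square_integrable M"
  shows "(\<lambda>x. f x - g x) \<in> square_integrable M"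
  using square_integrable_add[OF assms(1) square_integrable_scale[OF assms(2), of "-1"]] by simp

lemma equiv_L2_rel: "equiv (square_integrable M) (L2_rel M)"
proof (rule equivI)
  show "L2_rel M \<subseteq> square_integrable M \<times> square_integrable M" by (auto simp: L2_rel_def)
  show "refl_on (square_integrable M) (L2_rel M)" by (auto simp: refl_on_def L2_rel_def)
  show "sym (L2_rel M)" by (auto simp: sym_def L2_rel_def elim!: eventually_mono)
  show "trans (L2_rel M)"
    unfolding trans_def
  proof (intro allI impI)
    fix f g h assume fgh: "(f, g) \<in> L2_rel M" "(g, h) \<in> L2_rel M"
    then have "AE x in M. f x = g x" "AE x in M. g x = h x" by (auto simp: L2_rel_def)
    then have "AE x in M. f x = h x" by eventually_elim simp
    then show "(f, h) \<in> L2_rel M" using fgh by (auto simp: L2_rel_def)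
  qed
qed

lemma L2_class_in_L2: "f \<in> square_integrable M \<Longrightarrow> L2_class M f \<in> L2 M"
  unfolding L2_class_def L2_def by (rule quotientI)

lemma L2_cases:
  assumes "F \<in> L2 M" obtains f where "f \<in> square_integrable M" "F = L2_class M f"
  using assms unfolding L2_def L2_class_def by (rule quotientE)

lemma L2_class_eq_iff:
  "f \<in> square_integrable M \<Longrightarrow> g \<in> square_integrable M \<Longrightarrow>
     L2_class M f = L2_class M g \<longleftrightarrow> (AE x in M. f x = g x)"
  unfolding L2_class_def by (subst eq_equiv_class_iff[OF equiv_L2_rel]) (auto simp: L2_rel_def)

lemma mem_L2_class:
  "g \<in> L2_class M f \<longleftrightarrow> f \<in> square_integrable M \<and> g \<in> square_integrable M \<and> (AE x in M. f x = g x)"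
  by (simp add: L2_class_def L2_rel_def)

lemma mem_L2_class_self: "f \<in> square_integrable M \<Longrightarrow> f \<in> L2_class M f"
  by (simp add: mem_L2_class)

lemma L2_dist_class:
  assumes f: "f \<in> square_integrable M" and g: "g \<in> square_integrable M"
  shows "L2_dist M (L2_class M f) (L2_class M g) = sqrt (\<integral>x. (cmod (f x - g x))\<^sup>2 \<partial>M)"
proof -
  define f' where "f' = (SOME f'. f' \<in> L2_class M f)"
  define g' where "g' = (SOME g'. g' \<in> L2_class M g)"
  have "f' \<in> L2_class M f" unfolding f'_def
    by (rule someI[of "\<lambda>x. x \<in> L2_class M f", OF mem_L2_class_self[OF f]])
  then have f': "f' \<in> square_integrable M" "AE x in M. f x = f' x" by (auto simp: mem_L2_class)
  have "g' \<in> L2_class M g" unfolding g'_def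
    by (rule someI[of "\<lambda>x. x \<in> L2_class M g", OF mem_L2_class_self[OF g]])
  then have g': "g' \<in> square_integrable M" "AE x in M. g x = g' x" by (auto simp: mem_L2_class)
  note [measurable] = f g f' g'
  have "(\<integral>x. (cmod (f' x - g' x))\<^sup>2 \<partial>M) = (\<integral>x. (cmod (f x - g x))\<^sup>2 \<partial>M)"
  proof (rule integral_cong_AE)
    show "AE x in M. (cmod (f' x - g' x))\<^sup>2 = (cmod (f x - g x))\<^sup>2"
      using f'(2) g'(2) by eventually_elim simp
  qed measurable
  then show ?thesis by (simp add: L2_dist_def f'_def g'_def)
qed

text \<open>Operations on classes are unions over representatives. Once all representatives give the
  same class, the union collapses to it.\<close>

lemma UN_constant_class: "(\<And>x. x \<in> A \<Longrightarrow> f x = c) \<Longrightarrow> A \<noteq> {} \<Longrightarrow> (\<Union>x\<in>A. f x) = c"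
  by auto

lemma L2_add_class:
  assumes f: "f \<in> square_integrable M" and g: "g \<in> square_integrable M"
  shows "L2_add M (L2_class M f) (L2_class M g) = L2_class M (\<lambda>x. f x + g x)"
  unfolding L2_add_def L2_class_def[symmetric, of M "\<lambda>x. _ x + _ x"]
proof (intro UN_constant_class)
  fix f' g' assume f'g': "f' \<in> L2_class M f" "g' \<in> L2_class M g"
  then have "AE x in M. f x = f' x" "AE x in M. g x = g' x" by (auto simp: mem_L2_class)
  then have "AE x in M. f' x + g' x = f x + g x" by eventually_elim simp
  then show "L2_class M (\<lambda>x. f' x + g' x) = L2_class M (\<lambda>x. f x + g x)"
    using f'g' f g by (subst L2_class_eq_iff) (auto simp: mem_L2_class intro: square_integrable_add)
qed (use mem_L2_class_self f g in blast)+

lemma L2_scale_class: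
  assumes f: "f \<in> square_integrable M"
  shows "L2_scale M c (L2_class M f) = L2_class M (\<lambda>x. c * f x)"
  unfolding L2_scale_def L2_class_def[symmetric, of M "\<lambda>x. _ * _ x"]
proof (intro UN_constant_class)
  fix f' assume f': "f' \<in> L2_class M f"
  then have "AE x in M. f x = f' x" by (auto simp: mem_L2_class)
  then have "AE x in M. c * f' x = c * f x" by eventually_elim simp
  then show "L2_class M (\<lambda>x. c * f' x) = L2_class M (\<lambda>x. c * f x)"
    using f' f by (subst L2_class_eq_iff) (auto simp: mem_L2_class intro: square_integrable_scale)
qed (use mem_L2_class_self f in blast)

text \<open>The optimal weight is \<open>t = b / a\<close>; adding \<open>e\<close> avoids the division by zero.\<close>

lemma weighted_bound_imp_triangle:
  fixes a b c :: real
  assumes "0 \<le> a" "0 \<le> b" "0 \<le> c"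
    and le: "\<And>t. 0 < t \<Longrightarrow> c\<^sup>2 \<le> (1 + t) * a\<^sup>2 + (1 + 1 / t) * b\<^sup>2"
  shows "c \<le> a + b"
proof -
  have "c \<le> a + b + 2 * e" if "e > 0" for e
  proof -
    have ab: "0 < a + e" "0 < b + e" using assms that by auto
    define t where "t = (b + e) / (a + e)"
    have t: "0 < t" using ab by (simp add: t_def)
    have "c\<^sup>2 \<le> (1 + t) * a\<^sup>2 + (1 + 1 / t) * b\<^sup>2" by (rule le[OF t])
    also have "\<dots> \<le> (1 + t) * (a + e)\<^sup>2 + (1 + 1 / t) * (b + e)\<^sup>2"
      using assms t that by (intro add_mono mult_left_mono power_mono) auto
    also have "\<dots> = (a + e + (b + e))\<^sup>2"
      using ab by (simp add: t_def power2_eq_square divide_simps) (simp add: algebra_simps)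
    finally have "c \<le> a + e + (b + e)"
      by (rule power2_le_imp_le) (use ab in auto)
    then show ?thesis by simp
  qed
  note le2 = this
  have "c \<le> a + b + e" if "e > 0" for e
    using le2[of "e / 2"] that by simp
  then show ?thesis by (rule field_le_epsilon)
qed

lemma L2_triangle:
  assumes f: "f \<in> square_integrable M" and g: "g \<in> square_integrable M"
  shows "sqrt (\<integral>x. (cmod (f x + g x))\<^sup>2 \<partial>M) \<le> sqrt (\<integral>x. (cmod (f x))\<^sup>2 \<partial>M) + sqrt (\<integral>x. (cmod (g x))\<^sup>2 \<partial>M)"
proof (rule weighted_bound_imp_triangle)
  fix t :: real assume t: "0 < t"
  note int = square_integrable_integrable[OF f] square_integrable_integrable[OF g]
    square_integrable_integrable[OF square_integrable_add[OF f g]]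
  have "(\<integral>x. (cmod (f x + g x))\<^sup>2 \<partial>M)
      \<le> (\<integral>x. (1 + t) * (cmod (f x))\<^sup>2 + (1 + 1 / t) * (cmod (g x))\<^sup>2 \<partial>M)"
    using int by (intro integral_mono cmod_add_square_weighted t) auto
  also have "\<dots> = (1 + t) * (\<integral>x. (cmod (f x))\<^sup>2 \<partial>M) + (1 + 1 / t) * (\<integral>x. (cmod (g x))\<^sup>2 \<partial>M)"
    using int by simp
  finally show "(sqrt (\<integral>x. (cmod (f x + g x))\<^sup>2 \<partial>M))\<^sup>2
      \<le> (1 + t) * (sqrt (\<integral>x. (cmod (f x))\<^sup>2 \<partial>M))\<^sup>2 + (1 + 1 / t) * (sqrt (\<integral>x. (cmod (g x))\<^sup>2 \<partial>M))\<^sup>2"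
    by simp
qed simp_all

lemma Metric_space_L2: "Metric_space (L2 M) (L2_dist M)"
proof
  show "0 \<le> L2_dist M F G" for F G by (simp add: L2_dist_def Let_def)
  show "L2_dist M F G = L2_dist M G F" for F G by (simp add: L2_dist_def Let_def norm_minus_commute)
  show "L2_dist M F G = 0 \<longleftrightarrow> F = G" if "F \<in> L2 M" "G \<in> L2 M" for F G
  proof -
    obtain f where f: "f \<in> square_integrable M" "F = L2_class M f" using \<open>F \<in> L2 M\<close> by (rule L2_cases)
    obtain g where g: "g \<in> square_integrable M" "G = L2_class M g" using \<open>G \<in> L2 M\<close> by (rule L2_cases)
    show ?thesis
      using square_integrable_integrable[OF square_integrable_diff[OF f(1) g(1)]]
      by (simp add: f g L2_dist_class L2_class_eq_iff integral_nonneg_eq_0_iff_AE)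
  qed
  show "L2_dist M F H \<le> L2_dist M F G + L2_dist M G H" if "F \<in> L2 M" "G \<in> L2 M" "H \<in> L2 M" for F G H
  proof -
    obtain f where f: "f \<in> square_integrable M" "F = L2_class M f" using \<open>F \<in> L2 M\<close> by (rule L2_cases)
    obtain g where g: "g \<in> square_integrable M" "G = L2_class M g" using \<open>G \<in> L2 M\<close> by (rule L2_cases)
    obtain h where h: "h \<in> square_integrable M" "H = L2_class M h" using \<open>H \<in> L2 M\<close> by (rule L2_cases)
    show ?thesis
      using L2_triangle[OF square_integrable_diff[OF f(1) g(1)] square_integrable_diff[OF g(1) h(1)]]
      by (simp add: f g h L2_dist_class)
  qed
qed

section \<open>The automorphism group\<close>

abbreviation mp_inv :: "'a measure \<Rightarrow> ('a \<Rightarrow> 'a) \<Rightarrow> 'a \<Rightarrow> 'a" where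
  "mp_inv M T \<equiv> inv_into (space M) T"

definition aut_class :: "'a measure \<Rightarrow> ('a \<Rightarrow> 'a) \<Rightarrow> ('a \<Rightarrow> 'a) set" where
  "aut_class M T = aut_rel M `` {T}"

lemma mp_autsD:
  assumes "T \<in> mp_auts M"
  shows "T \<in> measurable M M" "mp_inv M T \<in> measurable M M" "distr M M T = M"
    "bij_betw T (space M) (space M)" "T \<in> extensional (space M)"
  using assms by (auto simp: mp_auts_def Bij_def)

lemma mp_auts_simps:
  assumes "T \<in> mp_auts M" "x \<in> space M"
  shows "T x \<in> space M" "mp_inv M T x \<in> space M" "T (mp_inv M T x) = x" "mp_inv M T (T x) = x"
  using mp_autsD[OF assms(1)] assms(2)
  by (auto simp: bij_betw_def f_inv_into_f inv_into_f_f inv_into_into)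

lemma mp_auts_AE:
  assumes T: "T \<in> mp_auts M" and P: "AE x in M. P x"
  shows "AE x in M. P (T x)"
  by (rule AE_distrD[OF mp_autsD(1)[OF T]]) (simp only: mp_autsD(3)[OF T] P)

lemma distr_mp_inv:
  assumes T: "T \<in> mp_auts M" shows "distr M M (mp_inv M T) = M"
proof (rule measure_eqI)
  fix A assume "A \<in> sets (distr M M (mp_inv M T))"
  then have A: "A \<in> sets M" by simp
  let ?B = "mp_inv M T -` A \<inter> space M"
  have B: "?B \<in> sets M" using mp_autsD(2)[OF T] A by (rule measurable_sets)
  have "emeasure (distr M M (mp_inv M T)) A = emeasure M ?B"
    using mp_autsD(2)[OF T] A by (rule emeasure_distr)
  also have "\<dots> = emeasure (distr M M T) ?B" by (simp add: mp_autsD[OF T])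
  also have "\<dots> = emeasure M (T -` ?B \<inter> space M)"
    using mp_autsD(1)[OF T] B by (rule emeasure_distr)
  also have "T -` ?B \<inter> space M = A"
    using sets.sets_into_space[OF A] by (auto simp: mp_auts_simps[OF T])
  finally show "emeasure (distr M M (mp_inv M T)) A = emeasure M A" .
qed simp

lemma mp_inv_AE:
  assumes T: "T \<in> mp_auts M" and P: "AE x in M. P x"
  shows "AE x in M. P (mp_inv M T x)"
  by (rule AE_distrD[OF mp_autsD(2)[OF T]]) (simp only: distr_mp_inv[OF T] P)

lemma mp_autsI:
  assumes T: "T \<in> measurable M M" "T \<in> extensional (space M)" and S: "S \<in> measurable M M"
    and inv: "\<And>x. x \<in> space M \<Longrightarrow> S (T x) = x" "\<And>x. x \<in> space M \<Longrightarrow> T (S x) = x"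
    and "distr M M T = M"
  shows "T \<in> mp_auts M" "x \<in> space M \<Longrightarrow> mp_inv M T x = S x"
proof -
  have sp: "T x \<in> space M" "S x \<in> space M" if "x \<in> space M" for x
    using measurable_space[OF T(1)] measurable_space[OF S] that by auto
  have bij: "bij_betw T (space M) (space M)"
    by (rule bij_betw_byWitness[where f' = S]) (auto simp: inv sp)
  have eq: "mp_inv M T x = S x" if "x \<in> space M" for x
    using inv_into_f_eq[OF bij_betw_imp_inj_on[OF bij], of "S x" x] sp inv that by auto
  then show "x \<in> space M \<Longrightarrow> mp_inv M T x = S x" .
  have "mp_inv M T \<in> measurable M M" using S by (subst measurable_cong[OF eq])
  then show "T \<in> mp_auts M" using bij assms by (simp add: mp_auts_def Bij_def)
qed

lemma mp_auts_id: "(\<lambda>x\<in>space M. x) \<in> mp_auts M"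
proof (rule mp_autsI(1)[where S = "\<lambda>x. x"])
  show *: "(\<lambda>x\<in>space M. x) \<in> measurable M M" by (subst measurable_cong[of M _ "\<lambda>x. x"]) auto
  have "distr M M (\<lambda>x\<in>space M. x) = distr M M (\<lambda>x. x)" by (rule distr_cong) auto
  then show "distr M M (\<lambda>x\<in>space M. x) = M" by (simp add: distr_id2)
qed auto

lemma mp_auts_compose:
  assumes S: "S \<in> mp_auts M" and T: "T \<in> mp_auts M"
  shows "compose (space M) S T \<in> mp_auts M"
    and "x \<in> space M \<Longrightarrow> mp_inv M (compose (space M) S T) x = mp_inv M T (mp_inv M S x)"
proof -
  note ST = mp_autsD[OF S] mp_autsD[OF T]
  have m: "(\<lambda>x. S (T x)) \<in> measurable M M" using ST by (intro measurable_compose[OF ST(6) ST(1)])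
  have 1: "compose (space M) S T \<in> measurable M M"
    using m by (subst measurable_cong[of M _ "\<lambda>x. S (T x)"]) (auto simp: compose_def)
  have 2: "(\<lambda>x. mp_inv M T (mp_inv M S x)) \<in> measurable M M"
    by (intro measurable_compose[OF ST(2) ST(7)])
  have "distr M M (compose (space M) S T) = distr M M (\<lambda>x. S (T x))"
    by (rule distr_cong) (auto simp: compose_def)
  also have "\<dots> = distr (distr M M T) M S" using distr_distr[OF ST(1) ST(6)] by (simp add: comp_def)
  also have "\<dots> = M" using ST by simp
  finally have 3: "distr M M (compose (space M) S T) = M" .
  have e: "compose (space M) S T \<in> extensional (space M)" by (auto simp: compose_def)
  note I = mp_autsI[OF 1 e 2 _ _ 3]
  show "compose (space M) S T \<in> mp_auts M"
    by (rule I) (auto simp: compose_def mp_auts_simps[OF S] mp_auts_simps[OF T])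
  show "x \<in> space M \<Longrightarrow> mp_inv M (compose (space M) S T) x = mp_inv M T (mp_inv M S x)"
    by (rule I) (auto simp: compose_def mp_auts_simps[OF S] mp_auts_simps[OF T])
qed

lemma mp_auts_inverse:
  assumes T: "T \<in> mp_auts M"
  shows "(\<lambda>x\<in>space M. mp_inv M T x) \<in> mp_auts M"
    and "x \<in> space M \<Longrightarrow> mp_inv M (\<lambda>x\<in>space M. mp_inv M T x) x = T x"
proof -
  have 1: "(\<lambda>x\<in>space M. mp_inv M T x) \<in> measurable M M"
    using mp_autsD(2)[OF T] by (subst measurable_cong[of M _ "mp_inv M T"]) auto
  have "distr M M (\<lambda>x\<in>space M. mp_inv M T x) = distr M M (mp_inv M T)" by (rule distr_cong) auto
  then have 2: "distr M M (\<lambda>x\<in>space M. mp_inv M T x) = M" by (simp add: distr_mp_inv[OF T])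
  note I = mp_autsI[OF 1 _ mp_autsD(1)[OF T] _ _ 2]
  show "(\<lambda>x\<in>space M. mp_inv M T x) \<in> mp_auts M" by (rule I) (auto simp: mp_auts_simps[OF T])
  show "x \<in> space M \<Longrightarrow> mp_inv M (\<lambda>x\<in>space M. mp_inv M T x) x = T x"
    by (rule I) (auto simp: mp_auts_simps[OF T])
qed

lemma equiv_aut_rel: "equiv (mp_auts M) (aut_rel M)"
proof (rule equivI)
  show "aut_rel M \<subseteq> mp_auts M \<times> mp_auts M" by (auto simp: aut_rel_def)
  show "refl_on (mp_auts M) (aut_rel M)" by (auto simp: refl_on_def aut_rel_def)
  show "sym (aut_rel M)" by (auto simp: sym_def aut_rel_def elim!: eventually_mono)
  show "trans (aut_rel M)"
    unfolding trans_def
  proof (intro allI impI)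
    fix f g h assume fgh: "(f, g) \<in> aut_rel M" "(g, h) \<in> aut_rel M"
    then have "AE x in M. f x = g x" "AE x in M. g x = h x" by (auto simp: aut_rel_def)
    then have "AE x in M. f x = h x" by eventually_elim simp
    then show "(f, h) \<in> aut_rel M" using fgh by (auto simp: aut_rel_def)
  qed
qed

lemma aut_class_in_carrier: "T \<in> mp_auts M \<Longrightarrow> aut_class M T \<in> carrier (Aut M)"
  unfolding aut_class_def Aut_def by (simp add: quotientI)

lemma Aut_cases:
  assumes "\<tau> \<in> carrier (Aut M)" obtains T where "T \<in> mp_auts M" "\<tau> = aut_class M T"
  using assms unfolding Aut_def aut_class_def by (auto elim: quotientE)

lemma aut_class_eq_iff:
  "S \<in> mp_auts M \<Longrightarrow> T \<in> mp_auts M \<Longrightarrow> aut_class M S = aut_class M T \<longleftrightarrow> (AE x in M. S x = T x)"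
  unfolding aut_class_def by (subst eq_equiv_class_iff[OF equiv_aut_rel]) (auto simp: aut_rel_def)

lemma mem_aut_class:
  "S \<in> aut_class M T \<longleftrightarrow> T \<in> mp_auts M \<and> S \<in> mp_auts M \<and> (AE x in M. T x = S x)"
  by (simp add: aut_class_def aut_rel_def)

lemma mem_aut_class_self: "T \<in> mp_auts M \<Longrightarrow> T \<in> aut_class M T"
  by (simp add: mem_aut_class)

text \<open>If \<open>S\<close> and \<open>T\<close> agree at the \<open>S\<close>-preimage of
  \<open>x\<close>, then that point is the \<open>T\<close>-preimage of \<open>x\<close> as well.
  The exceptional null set is pulled back along the measure-preserving inverse of
  \<open>S\<close>.\<close>

lemma AE_mp_inv_eq:
  assumes S: "S \<in> mp_auts M" and T: "T \<in> mp_auts M" and "AE x in M. S x = T x"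
  shows "AE x in M. mp_inv M S x = mp_inv M T x"
  using mp_inv_AE[OF S assms(3)] AE_space
proof eventually_elim
  case (elim x)
  then show ?case using mp_auts_simps[OF S] mp_auts_simps[OF T] by metis
qed

lemma mult_aut_class:
  assumes S: "S \<in> mp_auts M" and T: "T \<in> mp_auts M"
  shows "aut_class M S \<otimes>\<^bsub>Aut M\<^esub> aut_class M T = aut_class M (compose (space M) S T)"
  unfolding Aut_def monoid.simps aut_class_def[symmetric, of M "compose _ _ _"]
proof (intro UN_constant_class)
  fix S' T' assume S': "S' \<in> aut_class M S" and T': "T' \<in> aut_class M T"
  then have ae: "AE x in M. S x = S' x" "AE x in M. T x = T' x" by (auto simp: mem_aut_class)
  have "AE x in M. compose (space M) S' T' x = compose (space M) S T x"
    using mp_auts_AE[OF T ae(1)] ae(2) AE_space by eventually_elim (simp add: compose_def)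
  then show "aut_class M (compose (space M) S' T') = aut_class M (compose (space M) S T)"
    using S' T' S T by (subst aut_class_eq_iff) (auto simp: mem_aut_class intro: mp_auts_compose)
qed (use mem_aut_class_self S T in blast)+

lemma one_Aut: "\<one>\<^bsub>Aut M\<^esub> = aut_class M (\<lambda>x\<in>space M. x)"
  by (simp add: Aut_def aut_class_def)

lemma inverse_aut_class:
  assumes T: "T \<in> mp_auts M"
  shows "aut_class M (\<lambda>x\<in>space M. mp_inv M T x) \<otimes>\<^bsub>Aut M\<^esub> aut_class M T = \<one>\<^bsub>Aut M\<^esub>"
proof -
  have "compose (space M) (\<lambda>x\<in>space M. mp_inv M T x) T = (\<lambda>x\<in>space M. x)"
    by (auto simp: compose_def mp_auts_simps[OF T] fun_eq_iff)
  then show ?thesis by (simp add: mult_aut_class mp_auts_inverse T one_Aut)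
qed

lemma group_Aut: "group (Aut M)"
proof (rule groupI)
  show "\<one>\<^bsub>Aut M\<^esub> \<in> carrier (Aut M)"
    unfolding one_Aut by (intro aut_class_in_carrier mp_auts_id)
  fix \<sigma> assume "\<sigma> \<in> carrier (Aut M)"
  then obtain S where S: "S \<in> mp_auts M" "\<sigma> = aut_class M S" by (rule Aut_cases)
  have "compose (space M) (\<lambda>x\<in>space M. x) S = S"
    using mp_autsD(5)[OF S(1)] mp_auts_simps(1)[OF S(1)]
    by (auto simp: compose_def fun_eq_iff extensional_def)
  then show "\<one>\<^bsub>Aut M\<^esub> \<otimes>\<^bsub>Aut M\<^esub> \<sigma> = \<sigma>"
    by (simp add: S one_Aut mult_aut_class mp_auts_id)
  show "\<exists>\<tau>\<in>carrier (Aut M). \<tau> \<otimes>\<^bsub>Aut M\<^esub> \<sigma> = \<one>\<^bsub>Aut M\<^esub>"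
    unfolding S(2) using inverse_aut_class[OF S(1)]
    by (rule bexI) (intro aut_class_in_carrier mp_auts_inverse S)
  fix \<tau> assume "\<tau> \<in> carrier (Aut M)"
  then obtain T where T: "T \<in> mp_auts M" "\<tau> = aut_class M T" by (rule Aut_cases)
  show "\<sigma> \<otimes>\<^bsub>Aut M\<^esub> \<tau> \<in> carrier (Aut M)"
    by (simp add: S T mult_aut_class aut_class_in_carrier mp_auts_compose)
  fix \<rho> assume "\<rho> \<in> carrier (Aut M)"
  then obtain R where R: "R \<in> mp_auts M" "\<rho> = aut_class M R" by (rule Aut_cases)
  have "compose (space M) (compose (space M) S T) R = compose (space M) S (compose (space M) T R)"
    using mp_auts_simps(1)[OF R(1)] by (auto simp: compose_def fun_eq_iff)
  then show "\<sigma> \<otimes>\<^bsub>Aut M\<^esub> \<tau> \<otimes>\<^bsub>Aut M\<^esub> \<rho> = \<sigma> \<otimes>\<^bsub>Aut M\<^esub> (\<tau> \<otimes>\<^bsub>Aut M\<^esub> \<rho>)"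
    by (simp add: S T R mult_aut_class mp_auts_compose)
qed

section \<open>The Koopman representation\<close>

lemma square_integrable_mp_inv:
  assumes f: "f \<in> square_integrable M" and T: "T \<in> mp_auts M"
  shows "(\<lambda>x. f (mp_inv M T x)) \<in> square_integrable M"
proof -
  note [measurable] = square_integrable_measurable[OF f] mp_autsD(2)[OF T]
  have "integrable (distr M M (mp_inv M T)) (\<lambda>x. (cmod (f x))\<^sup>2)"
    using square_integrable_integrable[OF f] by (simp add: distr_mp_inv[OF T])
  then show ?thesis
    by (subst (asm) integrable_distr_eq) (auto simp: square_integrable_def)
qed

lemma integral_mp_inv:
  assumes T: "T \<in> mp_auts M" and [measurable]: "f \<in> borel_measurable M"
  shows "(\<integral>x. f (mp_inv M T x) \<partial>M) = (\<integral>x. (f x :: real) \<partial>M)"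
  using integral_distr[OF mp_autsD(2)[OF T] assms(2)] by (simp add: distr_mp_inv[OF T])

lemma koopman_class:
  assumes T: "T \<in> mp_auts M" and f: "f \<in> square_integrable M"
  shows "koopman M (aut_class M T) (L2_class M f) = L2_class M (\<lambda>x. f (mp_inv M T x))"
  unfolding koopman_def restrict_apply'[OF L2_class_in_L2[OF f]]
    L2_class_def[symmetric, of M "\<lambda>x. _ (mp_inv M _ x)"]
proof (intro UN_constant_class)
  fix T' f' assume T': "T' \<in> aut_class M T" and f': "f' \<in> L2_class M f"
  then have ae: "AE x in M. T x = T' x" "AE x in M. f x = f' x" and T'': "T' \<in> mp_auts M"
    and f'': "f' \<in> square_integrable M"
    by (auto simp: mem_aut_class mem_L2_class)
  have "AE x in M. f' (mp_inv M T' x) = f (mp_inv M T x)"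
    using mp_inv_AE[OF T ae(2)] AE_mp_inv_eq[OF T T'' ae(1)] by eventually_elim simp
  then show "L2_class M (\<lambda>x. f' (mp_inv M T' x)) = L2_class M (\<lambda>x. f (mp_inv M T x))"
    using T T'' f f'' by (subst L2_class_eq_iff) (auto intro: square_integrable_mp_inv)
qed (use mem_aut_class_self mem_L2_class_self T f in blast)+

lemma koopman_in_L2:
  assumes "\<tau> \<in> carrier (Aut M)" "F \<in> L2 M" shows "koopman M \<tau> F \<in> L2 M"
proof -
  obtain T where T: "T \<in> mp_auts M" "\<tau> = aut_class M T" using assms(1) by (rule Aut_cases)
  obtain f where f: "f \<in> square_integrable M" "F = L2_class M f" using assms(2) by (rule L2_cases)
  show ?thesis by (simp add: T f koopman_class L2_class_in_L2 square_integrable_mp_inv)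
qed

lemma koopman_isometry:
  assumes "\<tau> \<in> carrier (Aut M)" "F \<in> L2 M" "G \<in> L2 M"
  shows "L2_dist M (koopman M \<tau> F) (koopman M \<tau> G) = L2_dist M F G"
proof -
  obtain T where T: "T \<in> mp_auts M" "\<tau> = aut_class M T" using assms(1) by (rule Aut_cases)
  obtain f where f: "f \<in> square_integrable M" "F = L2_class M f" using assms(2) by (rule L2_cases)
  obtain g where g: "g \<in> square_integrable M" "G = L2_class M g" using assms(3) by (rule L2_cases)
  note [measurable] = square_integrable_measurable[OF f(1)] square_integrable_measurable[OF g(1)]
  show ?thesis
    using integral_mp_inv[OF T(1), of "\<lambda>x. (cmod (f x - g x))\<^sup>2"]
    by (simp add: T f g koopman_class L2_dist_class square_integrable_mp_inv)
qed

text \<open>Inverting a composite and precomposing each reverse the order, so the representation is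
  a homomorphism and not an antihomomorphism.\<close>

lemma koopman_mult:
  assumes "\<sigma> \<in> carrier (Aut M)" "\<tau> \<in> carrier (Aut M)" "F \<in> L2 M"
  shows "koopman M (\<sigma> \<otimes>\<^bsub>Aut M\<^esub> \<tau>) F = koopman M \<sigma> (koopman M \<tau> F)"
proof -
  obtain S where S: "S \<in> mp_auts M" "\<sigma> = aut_class M S" using assms(1) by (rule Aut_cases)
  obtain T where T: "T \<in> mp_auts M" "\<tau> = aut_class M T" using assms(2) by (rule Aut_cases)
  obtain f where f: "f \<in> square_integrable M" "F = L2_class M f" using assms(3) by (rule L2_cases)
  note ST = mp_auts_compose[OF S(1) T(1)]
  have "AE x in M. f (mp_inv M (compose (space M) S T) x) = f (mp_inv M T (mp_inv M S x))"
    by (rule AE_I2) (simp add: ST)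
  then show ?thesis
    using square_integrable_mp_inv[OF square_integrable_mp_inv[OF f(1) T(1)] S(1)]
    by (simp add: S T f mult_aut_class koopman_class ST square_integrable_mp_inv L2_class_eq_iff)
qed

lemma koopman_one:
  assumes "F \<in> L2 M" shows "koopman M \<one>\<^bsub>Aut M\<^esub> F = F"
proof -
  obtain f where f: "f \<in> square_integrable M" "F = L2_class M f" using assms by (rule L2_cases)
  have "mp_inv M (\<lambda>x\<in>space M. x) x = x" if "x \<in> space M" for x
    using mp_auts_simps(4)[OF mp_auts_id that] that by simp
  then have "AE x in M. f (mp_inv M (\<lambda>x\<in>space M. x) x) = f x" by (intro AE_I2) simp
  then show ?thesis
    by (simp add: f one_Aut koopman_class mp_auts_id L2_class_eq_iff square_integrable_mp_inv)
qed

lemma koopman_inv: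
  assumes "\<tau> \<in> carrier (Aut M)" "F \<in> L2 M"
  shows "koopman M \<tau> (koopman M (inv\<^bsub>Aut M\<^esub> \<tau>) F) = F"
proof -
  interpret group "Aut M" by (rule group_Aut)
  show ?thesis using assms by (simp add: koopman_mult[symmetric] koopman_one)
qed

lemma koopman_unitary:
  assumes "\<tau> \<in> carrier (Aut M)" shows "koopman M \<tau> \<in> unitary_ops M"
  unfolding unitary_ops_def
proof (intro CollectI conjI ballI allI)
  interpret group "Aut M" by (rule group_Aut)
  show "koopman M \<tau> \<in> L2 M \<rightarrow>\<^sub>E L2 M"
    using koopman_in_L2[OF assms] by (auto simp: koopman_def)
  show "koopman M \<tau> ` L2 M = L2 M"
  proof
    show "koopman M \<tau> ` L2 M \<subseteq> L2 M" using koopman_in_L2[OF assms] by auto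
    show "L2 M \<subseteq> koopman M \<tau> ` L2 M"
    proof
      fix F assume "F \<in> L2 M"
      then show "F \<in> koopman M \<tau> ` L2 M"
        using koopman_inv[OF assms \<open>F \<in> L2 M\<close>] koopman_in_L2[OF inv_closed[OF assms] \<open>F \<in> L2 M\<close>]
        by (metis imageI)
    qed
  qed
  obtain T where T: "T \<in> mp_auts M" "\<tau> = aut_class M T" using assms by (rule Aut_cases)
  fix F assume "F \<in> L2 M"
  then obtain f where f: "f \<in> square_integrable M" "F = L2_class M f" by (rule L2_cases)
  show "koopman M \<tau> (L2_scale M c F) = L2_scale M c (koopman M \<tau> F)" for c
    by (simp add: T f L2_scale_class koopman_class square_integrable_scale square_integrable_mp_inv)
  fix G assume "G \<in> L2 M"
  then obtain g where g: "g \<in> square_integrable M" "G = L2_class M g" by (rule L2_cases)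
  show "koopman M \<tau> (L2_add M F G) = L2_add M (koopman M \<tau> F) (koopman M \<tau> G)"
    by (simp add: T f g L2_add_class koopman_class square_integrable_add square_integrable_mp_inv)
  show "L2_dist M (koopman M \<tau> F) (koopman M \<tau> G) = L2_dist M F G"
    using assms \<open>F \<in> L2 M\<close> \<open>G \<in> L2 M\<close> by (rule koopman_isometry)
qed

section \<open>The strong topology as a group topology\<close>

abbreviation L2_topology :: "'a measure \<Rightarrow> ('a \<Rightarrow> complex) set topology" where
  "L2_topology M \<equiv> Metric_space.mtopology (L2 M) (L2_dist M)"

lemma topspace_Aut: "topspace (Aut_strong_topology M) = carrier (Aut M)"
proof -
  interpret Metric_space "L2 M" "L2_dist M" by (rule Metric_space_L2)
  have "unitary_ops M \<subseteq> L2 M \<rightarrow>\<^sub>E L2 M" by (auto simp: unitary_ops_def)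
  then have "topspace (strong_operator_topology M) = unitary_ops M"
    by (auto simp: strong_operator_topology_def)
  then show ?thesis
    using koopman_unitary by (auto simp: Aut_strong_topology_def topspace_pullback_topology)
qed

lemma continuous_map_koopman:
  assumes "F \<in> L2 M"
  shows "continuous_map (Aut_strong_topology M) (L2_topology M) (\<lambda>\<tau>. koopman M \<tau> F)"
proof -
  have "continuous_map (strong_operator_topology M) (L2_topology M) (\<lambda>U. U F)"
    unfolding strong_operator_topology_def
    by (intro continuous_map_from_subtopology continuous_map_product_projection assms)
  from continuous_map_pullback[OF this] show ?thesis
    by (simp add: Aut_strong_topology_def comp_def)
qed

text \<open>The strong topology is the initial topology of the orbit maps on vectors, so continuity
  into the group is tested on one vector at a time.\<close>

lemma continuous_map_into_Aut:
  assumes "f \<in> topspace Z \<rightarrow> carrier (Aut M)"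
    and "\<And>F. F \<in> L2 M \<Longrightarrow> continuous_map Z (L2_topology M) (\<lambda>z. koopman M (f z) F)"
  shows "continuous_map Z (Aut_strong_topology M) f"
  unfolding Aut_strong_topology_def
proof (rule continuous_map_pullback')
  show "topspace Z \<subseteq> f -` carrier (Aut M)" using assms(1) by auto
  have "koopman M \<circ> f \<in> topspace Z \<rightarrow> unitary_ops M" using assms(1) koopman_unitary by fastforce
  moreover have "(koopman M \<circ> f) ` topspace Z \<subseteq> extensional (L2 M)"
    by (auto simp: koopman_def)
  ultimately show "continuous_map Z (strong_operator_topology M) (koopman M \<circ> f)"
    unfolding strong_operator_topology_def
    using assms(2) by (auto simp: continuous_map_in_subtopology continuous_map_componentwise comp_def)
qed

lemma openin_koopman_ball:
  assumes "F \<in> L2 M" "G \<in> L2 M"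
  shows "openin (Aut_strong_topology M) {\<tau>\<in>carrier (Aut M). L2_dist M G (koopman M \<tau> F) < e}"
proof -
  interpret Metric_space "L2 M" "L2_dist M" by (rule Metric_space_L2)
  have "openin (Aut_strong_topology M)
      {\<tau>\<in>topspace (Aut_strong_topology M). koopman M \<tau> F \<in> mball G e}"
    by (rule openin_continuous_map_preimage[OF continuous_map_koopman[OF assms(1)] openin_mball])
  also have "{\<tau>\<in>topspace (Aut_strong_topology M). koopman M \<tau> F \<in> mball G e}
      = {\<tau>\<in>carrier (Aut M). L2_dist M G (koopman M \<tau> F) < e}"
    using assms koopman_in_L2 by (auto simp: topspace_Aut)
  finally show ?thesis .
qed

text \<open>Both parts rest on the operators being isometries. For products, the triangle inequality
  through \<open>koopman M x G\<close> with \<open>G = koopman M t F\<close> separates the two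
  variables, as \<open>x\<close> can then be cancelled. For inverses, applying \<open>x\<close>
  turns the distance of the inverse images of \<open>F\<close> into the distance of
  \<open>koopman M x G\<close> from \<open>F\<close>, where \<open>G\<close> is the image of
  \<open>F\<close> under the inverse of \<open>s\<close>.\<close>

lemma topological_group_Aut: "topological_group (Aut M) (Aut_strong_topology M)"
  unfolding topological_group_def
proof (intro conjI group_Aut topspace_Aut)
  let ?T = "Aut_strong_topology M"
  interpret group "Aut M" by (rule group_Aut)
  interpret Metric_space "L2 M" "L2_dist M" by (rule Metric_space_L2)
  note kL = koopman_in_L2
  show "continuous_map (prod_topology ?T ?T) ?T (\<lambda>(x, y). x \<otimes>\<^bsub>Aut M\<^esub> y)"
  proof (rule continuous_map_into_Aut)
    fix F assume F: "F \<in> L2 M"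
    show "continuous_map (prod_topology ?T ?T) mtopology (\<lambda>z. koopman M (case z of (x, y) \<Rightarrow> x \<otimes>\<^bsub>Aut M\<^esub> y) F)"
      unfolding continuous_map_to_metric
    proof (intro ballI allI impI)
      fix z and e :: real assume "z \<in> topspace (prod_topology ?T ?T)" and e: "0 < e"
      then obtain s t where z: "z = (s, t)" and st: "s \<in> carrier (Aut M)" "t \<in> carrier (Aut M)"
        by (auto simp: topspace_Aut)
      define G where "G = koopman M t F"
      have G: "G \<in> L2 M" unfolding G_def by (intro kL st F)
      let ?U = "{x\<in>carrier (Aut M). L2_dist M (koopman M s G) (koopman M x G) < e / 2}"
      let ?V = "{y\<in>carrier (Aut M). L2_dist M G (koopman M y F) < e / 2}"
      have "openin ?T ?U" "openin ?T ?V" by (intro openin_koopman_ball kL st F G)+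
      then have "openin (prod_topology ?T ?T) (?U \<times> ?V)"
        by (simp only: openin_prod_Times_iff) blast
      moreover have "z \<in> ?U \<times> ?V"
        using st e G kL[OF st(1) G] by (auto simp: z G_def[symmetric])
      moreover have "koopman M (case w of (x, y) \<Rightarrow> x \<otimes>\<^bsub>Aut M\<^esub> y) F
          \<in> mball (koopman M (case z of (x, y) \<Rightarrow> x \<otimes>\<^bsub>Aut M\<^esub> y) F) e" if w_in: "w \<in> ?U \<times> ?V" for w
      proof -
        obtain x y where w: "w = (x, y)" and xy: "x \<in> ?U" "y \<in> ?V" using w_in by blast
        have c: "x \<in> carrier (Aut M)" "y \<in> carrier (Aut M)" using xy by auto
        have "L2_dist M (koopman M s G) (koopman M x (koopman M y F))
            \<le> L2_dist M (koopman M s G) (koopman M x G) + L2_dist M (koopman M x G) (koopman M x (koopman M y F))"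
          by (intro triangle kL st c F G)
        also have "L2_dist M (koopman M x G) (koopman M x (koopman M y F)) = L2_dist M G (koopman M y F)"
          by (intro koopman_isometry kL c F G)
        finally have "L2_dist M (koopman M s G) (koopman M x (koopman M y F)) < e" using xy by simp
        then show ?thesis
          using st c F by (simp add: w z koopman_mult G_def kL)
      qed
      ultimately show "\<exists>U. openin (prod_topology ?T ?T) U \<and> z \<in> U \<and>
          (\<forall>w\<in>U. koopman M (case w of (x, y) \<Rightarrow> x \<otimes>\<^bsub>Aut M\<^esub> y) F
            \<in> mball (koopman M (case z of (x, y) \<Rightarrow> x \<otimes>\<^bsub>Aut M\<^esub> y) F) e)" by blast
    qed
  qed (auto simp: topspace_Aut)
  show "continuous_map ?T ?T (\<lambda>x. inv\<^bsub>Aut M\<^esub> x)"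
  proof (rule continuous_map_into_Aut)
    fix F assume F: "F \<in> L2 M"
    show "continuous_map ?T mtopology (\<lambda>z. koopman M (inv\<^bsub>Aut M\<^esub> z) F)"
      unfolding continuous_map_to_metric
    proof (intro ballI allI impI)
      fix s and e :: real assume "s \<in> topspace ?T" and e: "0 < e"
      then have s: "s \<in> carrier (Aut M)" by (simp add: topspace_Aut)
      define G where "G = koopman M (inv\<^bsub>Aut M\<^esub> s) F"
      have G: "G \<in> L2 M" unfolding G_def by (intro kL inv_closed s F)
      let ?U = "{x\<in>carrier (Aut M). L2_dist M F (koopman M x G) < e}"
      have "openin ?T ?U" by (intro openin_koopman_ball F G)
      moreover have "s \<in> ?U" using s e F koopman_inv[OF s F] by (simp add: G_def)
      moreover have "koopman M (inv\<^bsub>Aut M\<^esub> x) F \<in> mball (koopman M (inv\<^bsub>Aut M\<^esub> s) F) e" if "x \<in> ?U" for x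
      proof -
        have x: "x \<in> carrier (Aut M)" "L2_dist M F (koopman M x G) < e" using that by auto
        have "L2_dist M G (koopman M (inv\<^bsub>Aut M\<^esub> x) F) = L2_dist M (koopman M x G) F"
          using koopman_isometry[OF x(1) G kL[OF inv_closed[OF x(1)] F]] koopman_inv[OF x(1) F] by simp
        then show ?thesis using x G F kL[OF inv_closed[OF x(1)] F] by (simp add: G_def[symmetric] commute)
      qed
      ultimately show "\<exists>U. openin ?T U \<and> s \<in> U \<and>
          (\<forall>x\<in>U. koopman M (inv\<^bsub>Aut M\<^esub> x) F \<in> mball (koopman M (inv\<^bsub>Aut M\<^esub> s) F) e)" by blast
    qed
  qed (auto simp: topspace_Aut)
qed

section \<open>A metric for the strong topology\<close>

lemma L2_add_in: "F \<in> L2 M \<Longrightarrow> G \<in> L2 M \<Longrightarrow> L2_add M F G \<in> L2 M"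
  by (elim L2_cases) (simp add: L2_add_class L2_class_in_L2 square_integrable_add)

lemma L2_scale_in: "F \<in> L2 M \<Longrightarrow> L2_scale M c F \<in> L2 M"
  by (elim L2_cases) (simp add: L2_scale_class L2_class_in_L2 square_integrable_scale)

lemma L2_dist_add_le:
  assumes "F \<in> L2 M" "G \<in> L2 M" "F' \<in> L2 M" "G' \<in> L2 M"
  shows "L2_dist M (L2_add M F G) (L2_add M F' G') \<le> L2_dist M F F' + L2_dist M G G'"
proof -
  obtain f where f: "f \<in> square_integrable M" "F = L2_class M f" using assms(1) by (rule L2_cases)
  obtain g where g: "g \<in> square_integrable M" "G = L2_class M g" using assms(2) by (rule L2_cases)
  obtain f' where f': "f' \<in> square_integrable M" "F' = L2_class M f'" using assms(3) by (rule L2_cases)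
  obtain g' where g': "g' \<in> square_integrable M" "G' = L2_class M g'" using assms(4) by (rule L2_cases)
  have "f x + g x - (f' x + g' x) = (f x - f' x) + (g x - g' x)" for x by simp
  then show ?thesis
    using L2_triangle[OF square_integrable_diff[OF f(1) f'(1)] square_integrable_diff[OF g(1) g'(1)]]
    by (simp only: f g f' g' L2_add_class L2_dist_class square_integrable_add)
qed

lemma L2_dist_scale:
  assumes "F \<in> L2 M" "G \<in> L2 M"
  shows "L2_dist M (L2_scale M c F) (L2_scale M c G) = cmod c * L2_dist M F G"
proof -
  obtain f where f: "f \<in> square_integrable M" "F = L2_class M f" using assms(1) by (rule L2_cases)
  obtain g where g: "g \<in> square_integrable M" "G = L2_class M g" using assms(2) by (rule L2_cases)
  have "(cmod (c * f x - c * g x))\<^sup>2 = (cmod c)\<^sup>2 * (cmod (f x - g x))\<^sup>2" for x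
    by (simp add: right_diff_distrib[symmetric] norm_mult power_mult_distrib)
  then show ?thesis
    by (simp add: f g L2_scale_class L2_dist_class square_integrable_scale real_sqrt_mult)
qed

lemma koopman_add:
  "\<tau> \<in> carrier (Aut M) \<Longrightarrow> F \<in> L2 M \<Longrightarrow> G \<in> L2 M \<Longrightarrow>
     koopman M \<tau> (L2_add M F G) = L2_add M (koopman M \<tau> F) (koopman M \<tau> G)"
  using koopman_unitary[of \<tau> M] by (simp add: unitary_ops_def)

lemma koopman_scale:
  "\<tau> \<in> carrier (Aut M) \<Longrightarrow> F \<in> L2 M \<Longrightarrow>
     koopman M \<tau> (L2_scale M c F) = L2_scale M c (koopman M \<tau> F)"
  using koopman_unitary[of \<tau> M] by (simp add: unitary_ops_def)

text \<open>Closed subspaces, used as an induction principle: a property of vectors that is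
  preserved by sums, multiples and limits needs checking only on a total set.\<close>

definition closed_linear :: "'a measure \<Rightarrow> ('a \<Rightarrow> complex) set set \<Rightarrow> bool" where
  "closed_linear M P \<longleftrightarrow> P \<subseteq> L2 M \<and>
     (\<forall>F\<in>P. \<forall>G\<in>P. L2_add M F G \<in> P) \<and> (\<forall>c. \<forall>F\<in>P. L2_scale M c F \<in> P) \<and>
     (\<forall>F\<in>L2 M. (\<forall>e>0. \<exists>G\<in>P. L2_dist M F G < e) \<longrightarrow> F \<in> P)"

text \<open>\<open>total\<close> says that the sequence has dense span, phrased as induction over
  closed subspaces. \<open>faithful\<close> says that the Koopman representation is injective, which
  makes the series metric definite.\<close>

locale total_sequence =
  fixes M :: "'a measure" and F :: "nat \<Rightarrow> ('a \<Rightarrow> complex) set"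
  assumes F_L2: "F k \<in> L2 M"
    and total: "closed_linear M P \<Longrightarrow> (\<And>k. F k \<in> P) \<Longrightarrow> P = L2 M"
    and faithful: "\<sigma> \<in> carrier (Aut M) \<Longrightarrow> \<tau> \<in> carrier (Aut M) \<Longrightarrow>
      (\<And>F. F \<in> L2 M \<Longrightarrow> koopman M \<sigma> F = koopman M \<tau> F) \<Longrightarrow> \<sigma> = \<tau>"
begin

sublocale L: Metric_space "L2 M" "L2_dist M" by (rule Metric_space_L2)

definition dist_at :: "nat \<Rightarrow> ('a \<Rightarrow> 'a) set \<Rightarrow> ('a \<Rightarrow> 'a) set \<Rightarrow> real" where
  "dist_at k \<sigma> \<tau> = L2_dist M (koopman M \<sigma> (F k)) (koopman M \<tau> (F k))"

definition \<rho> :: "('a \<Rightarrow> 'a) set \<Rightarrow> ('a \<Rightarrow> 'a) set \<Rightarrow> real" where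
  "\<rho> \<sigma> \<tau> = (\<Sum>k. (1/2) ^ k * min 1 (dist_at k \<sigma> \<tau>))"

lemma dist_at_nonneg: "0 \<le> dist_at k \<sigma> \<tau>"
  by (simp add: dist_at_def)

lemma summable_\<rho>: "summable (\<lambda>k. (1/2) ^ k * min 1 (dist_at k \<sigma> \<tau>))"
  by (rule summable_comparison_test'[of "\<lambda>k. (1/2) ^ k" 0])
     (auto simp: dist_at_nonneg abs_mult mult_left_le)

lemma \<rho>_ge: "(1/2) ^ k * min 1 (dist_at k \<sigma> \<tau>) \<le> \<rho> \<sigma> \<tau>"
  unfolding \<rho>_def using sum_le_suminf[OF summable_\<rho>, of "{k}" \<sigma> \<tau>] by (simp add: dist_at_nonneg)

text \<open>The first \<open>K\<close> weights add up to at most 2, so the head contributes at most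
  \<open>r / 2\<close>; the tail is at most \<open>2 * (1/2) ^ K\<close>, again below
  \<open>r / 2\<close>.\<close>

lemma \<rho>_less:
  assumes "\<And>k. k < K \<Longrightarrow> dist_at k \<sigma> \<tau> < r / 4" and K: "4 * (1/2) ^ K < r"
  shows "\<rho> \<sigma> \<tau> < r"
proof -
  let ?a = "\<lambda>k. (1/2) ^ k * min 1 (dist_at k \<sigma> \<tau>)"
  have r: "0 < r" using K by (rule le_less_trans[rotated]) simp
  have "\<rho> \<sigma> \<tau> = (\<Sum>k. ?a (k + K)) + (\<Sum>k<K. ?a k)"
    unfolding \<rho>_def by (rule suminf_split_initial_segment[OF summable_\<rho>])
  also have "(\<Sum>k. ?a (k + K)) \<le> (\<Sum>k. (1/2) ^ K * (1/2) ^ k)"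
  proof (rule suminf_le)
    show "?a (k + K) \<le> (1/2) ^ K * (1/2) ^ k" for k
      by (simp add: power_add mult_left_le mult.commute)
  qed (auto simp: summable_\<rho>[THEN summable_ignore_initial_segment] summable_geometric intro!: summable_mult)
  also have "\<dots> = 2 * (1/2) ^ K"
    by (simp add: suminf_mult summable_geometric suminf_geometric)
  also have "(\<Sum>k<K. ?a k) \<le> (\<Sum>k<K. (1/2) ^ k * (r / 4))"
    by (intro sum_mono mult_left_mono min.coboundedI2 less_imp_le[OF assms(1)]) auto
  also have "\<dots> = (\<Sum>k<K. (1/2) ^ k) * (r / 4)" by (simp add: sum_distrib_right)
  also have "(\<Sum>k<K. (1/2 :: real) ^ k) \<le> 2"
    by (simp add: sum_gp_strict)
  finally show ?thesis using K r by (simp add: mult_right_mono)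
qed

lemma exists_tail: "0 < r \<Longrightarrow> \<exists>K. 4 * (1/2 :: real) ^ K < r"
  using real_arch_pow_inv[of "r / 4" "1/2"] by (auto simp: field_simps)

text \<open>The vectors whose orbit map is continuous at \<open>\<tau>\<close> for
  \<open>\<rho>\<close> form a closed subspace that contains every \<open>F k\<close>, hence all
  vectors.\<close>

lemma \<rho>_continuous:
  assumes "G \<in> L2 M" "\<tau> \<in> carrier (Aut M)" "e > 0"
  shows "\<exists>\<delta>>0. \<forall>\<sigma>\<in>carrier (Aut M). \<rho> \<tau> \<sigma> < \<delta> \<longrightarrow> L2_dist M (koopman M \<tau> G) (koopman M \<sigma> G) < e"
proof -
  let ?d = "\<lambda>G \<sigma>. L2_dist M (koopman M \<tau> G) (koopman M \<sigma> G)"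
  let ?Q = "\<lambda>G e. \<exists>\<delta>>0. \<forall>\<sigma>\<in>carrier (Aut M). \<rho> \<tau> \<sigma> < \<delta> \<longrightarrow> ?d G \<sigma> < e"
  let ?P = "{G\<in>L2 M. \<forall>e>0. ?Q G e}"
  note kL = koopman_in_L2
  have "closed_linear M ?P"
    unfolding closed_linear_def
  proof (intro conjI ballI allI impI)
    show "?P \<subseteq> L2 M" by auto
  next
    fix G H assume GH: "G \<in> ?P" "H \<in> ?P"
    have "?Q (L2_add M G H) e" if e: "e > 0" for e
    proof -
      obtain d1 where d1: "d1 > 0" "\<And>\<sigma>. \<sigma> \<in> carrier (Aut M) \<Longrightarrow> \<rho> \<tau> \<sigma> < d1 \<Longrightarrow> ?d G \<sigma> < e / 2"
        using GH(1) half_gt_zero[OF e] by blast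
      obtain d2 where d2: "d2 > 0" "\<And>\<sigma>. \<sigma> \<in> carrier (Aut M) \<Longrightarrow> \<rho> \<tau> \<sigma> < d2 \<Longrightarrow> ?d H \<sigma> < e / 2"
        using GH(2) half_gt_zero[OF e] by blast
      show ?thesis
      proof (intro exI[of _ "min d1 d2"] conjI ballI impI)
        show "0 < min d1 d2" using d1 d2 by simp
        fix \<sigma> assume s: "\<sigma> \<in> carrier (Aut M)" "\<rho> \<tau> \<sigma> < min d1 d2"
        have "?d (L2_add M G H) \<sigma>
            \<le> ?d G \<sigma> + ?d H \<sigma>"
          using GH s assms by (simp add: koopman_add L2_dist_add_le kL)
        then show "?d (L2_add M G H) \<sigma> < e"
          using d1(2)[of \<sigma>] d2(2)[of \<sigma>] s by simp
      qed
    qed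
    then show "L2_add M G H \<in> ?P" using GH by (simp add: L2_add_in)
  next
    fix c G assume G: "G \<in> ?P"
    have "?Q (L2_scale M c G) e" if e: "e > 0" for e
    proof -
      \<comment> \<open>Adding 1 covers the scalar 0.\<close>
      have c: "0 < cmod c + 1" by (simp add: add_nonneg_pos)
      then have "e / (cmod c + 1) > 0" using e by simp
      then obtain d where d: "d > 0" "\<And>\<sigma>. \<sigma> \<in> carrier (Aut M) \<Longrightarrow> \<rho> \<tau> \<sigma> < d \<Longrightarrow> ?d G \<sigma> < e / (cmod c + 1)"
        using G by blast
      show ?thesis
      proof (intro exI[of _ d] conjI ballI impI d(1))
        fix \<sigma> assume s: "\<sigma> \<in> carrier (Aut M)" "\<rho> \<tau> \<sigma> < d"
        have "?d (L2_scale M c G) \<sigma>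
            = cmod c * ?d G \<sigma>"
          using G s assms by (simp add: koopman_scale L2_dist_scale kL)
        also have "\<dots> \<le> (cmod c + 1) * ?d G \<sigma>"
          by (intro mult_right_mono) auto
        also have "\<dots> < e" using d(2)[OF s] pos_less_divide_eq[OF c] by (simp only: mult.commute)
        finally show "?d (L2_scale M c G) \<sigma> < e" .
      qed
    qed
    then show "L2_scale M c G \<in> ?P" using G by (simp add: L2_scale_in)
  next
    fix G assume G: "G \<in> L2 M" and lim: "\<forall>e>0. \<exists>H\<in>?P. L2_dist M G H < e"
    have "?Q G e" if e: "e > 0" for e
    proof -
      have e3: "e / 3 > 0" using e by simp
      \<comment> \<open>As the operators are isometries, replacing \<open>G\<close> by
        \<open>H\<close> costs the same at every \<open>\<sigma>\<close>, so the \<open>d\<close>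
        found for \<open>H\<close> serves for \<open>G\<close>.\<close>
      then obtain H where H: "H \<in> ?P" "L2_dist M G H < e / 3" using lim by blast
      obtain d where d: "d > 0" "\<And>\<sigma>. \<sigma> \<in> carrier (Aut M) \<Longrightarrow> \<rho> \<tau> \<sigma> < d \<Longrightarrow> ?d H \<sigma> < e / 3"
        using H(1) e3 by blast
      have HL: "H \<in> L2 M" using H by simp
      show ?thesis
      proof (intro exI[of _ d] conjI ballI impI d(1))
        fix \<sigma> assume s: "\<sigma> \<in> carrier (Aut M)" "\<rho> \<tau> \<sigma> < d"
        have "?d G \<sigma>
            \<le> L2_dist M (koopman M \<tau> G) (koopman M \<tau> H) + L2_dist M (koopman M \<tau> H) (koopman M \<sigma> G)"
          using G HL s assms by (intro L.triangle kL)
        moreover have "L2_dist M (koopman M \<tau> H) (koopman M \<sigma> G)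
            \<le> ?d H \<sigma> + L2_dist M (koopman M \<sigma> G) (koopman M \<sigma> H)"
          using G HL s assms by (intro L.triangle' kL)
        moreover have "L2_dist M (koopman M \<tau> G) (koopman M \<tau> H) = L2_dist M G H"
          "L2_dist M (koopman M \<sigma> G) (koopman M \<sigma> H) = L2_dist M G H"
          using G HL s assms by (simp_all add: koopman_isometry)
        ultimately show "?d G \<sigma> < e"
          using d(2)[OF s] H(2) by linarith
      qed
    qed
    then show "G \<in> ?P" using G by simp
  qed
  moreover have "F k \<in> ?P" for k
  proof -
    have "?Q (F k) e" if e: "e > 0" for e
    proof (intro exI[of _ "(1/2) ^ k * min 1 e"] conjI ballI impI)
      show "0 < (1/2) ^ k * min 1 e" using e by simp
      fix \<sigma> assume "\<rho> \<tau> \<sigma> < (1/2) ^ k * min 1 e"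
      then have "(1/2) ^ k * min 1 (dist_at k \<tau> \<sigma>) < (1/2) ^ k * min 1 e"
        using \<rho>_ge[of k \<tau> \<sigma>] by linarith
      then have "min 1 (dist_at k \<tau> \<sigma>) < min 1 e" by simp
      then show "L2_dist M (koopman M \<tau> (F k)) (koopman M \<sigma> (F k)) < e"
        unfolding dist_at_def by (auto simp: min_def split: if_splits)
    qed
    then show ?thesis by (simp add: F_L2)
  qed
  ultimately have "?P = L2 M" by (rule total)
  then show ?thesis using assms by blast
qed

lemma eq_if_agree:
  assumes "\<sigma> \<in> carrier (Aut M)" "\<tau> \<in> carrier (Aut M)" and "\<And>k. dist_at k \<sigma> \<tau> = 0"
  shows "\<sigma> = \<tau>"
proof (rule faithful[OF assms(1,2)])
  fix G assume G: "G \<in> L2 M"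
  have "\<rho> \<sigma> \<tau> = 0" by (simp add: \<rho>_def assms(3))
  then have "L2_dist M (koopman M \<sigma> G) (koopman M \<tau> G) < e" if "e > 0" for e
    using \<rho>_continuous[OF G assms(1) that] assms(2) by auto
  then have "\<not> 0 < L2_dist M (koopman M \<sigma> G) (koopman M \<tau> G)" by blast
  then show "koopman M \<sigma> G = koopman M \<tau> G"
    using koopman_in_L2[OF assms(1) G] koopman_in_L2[OF assms(2) G] by simp
qed

lemma Metric_space_\<rho>: "Metric_space (carrier (Aut M)) \<rho>"
proof
  show "0 \<le> \<rho> \<sigma> \<tau>" for \<sigma> \<tau>
    unfolding \<rho>_def by (intro suminf_nonneg summable_\<rho>) (simp add: dist_at_nonneg)
  show "\<rho> \<sigma> \<tau> = \<rho> \<tau> \<sigma>" for \<sigma> \<tau>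
    by (simp add: \<rho>_def dist_at_def L.commute)
  show "\<rho> \<sigma> \<tau> = 0 \<longleftrightarrow> \<sigma> = \<tau>" if "\<sigma> \<in> carrier (Aut M)" "\<tau> \<in> carrier (Aut M)" for \<sigma> \<tau>
  proof
    assume "\<rho> \<sigma> \<tau> = 0"
    then have "\<not> 0 < (1/2) ^ k * min 1 (dist_at k \<sigma> \<tau>)" for k
      using \<rho>_ge[of k \<sigma> \<tau>] by simp
    then have "\<not> 0 < min 1 (dist_at k \<sigma> \<tau>)" for k
      using mult_pos_pos[of "(1/2) ^ k" "min 1 (dist_at k \<sigma> \<tau>)"] by fastforce
    then have "\<not> 0 < dist_at k \<sigma> \<tau>" for k by (simp add: min_less_iff_disj)
    then have "dist_at k \<sigma> \<tau> = 0" for k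
      using dist_at_nonneg[of k \<sigma> \<tau>] by (metis order_le_less)
    then show "\<sigma> = \<tau>"
      using that by (intro eq_if_agree)
  next
    assume "\<sigma> = \<tau>"
    then show "\<rho> \<sigma> \<tau> = 0" using that by (simp add: \<rho>_def dist_at_def koopman_in_L2 F_L2)
  qed
  show "\<rho> \<sigma> \<upsilon> \<le> \<rho> \<sigma> \<tau> + \<rho> \<tau> \<upsilon>"
    if "\<sigma> \<in> carrier (Aut M)" "\<tau> \<in> carrier (Aut M)" "\<upsilon> \<in> carrier (Aut M)" for \<sigma> \<tau> \<upsilon>
    unfolding \<rho>_def suminf_add[OF summable_\<rho> summable_\<rho>]
  proof (intro suminf_le summable_add summable_\<rho>)
    fix k
    have "dist_at k \<sigma> \<upsilon> \<le> dist_at k \<sigma> \<tau> + dist_at k \<tau> \<upsilon>"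
      unfolding dist_at_def using that by (intro L.triangle koopman_in_L2 F_L2)
    then have "min 1 (dist_at k \<sigma> \<upsilon>) \<le> min 1 (dist_at k \<sigma> \<tau>) + min 1 (dist_at k \<tau> \<upsilon>)"
      using dist_at_nonneg[of k \<sigma> \<tau>] dist_at_nonneg[of k \<tau> \<upsilon>] by (auto simp: min_def)
    then show "(1/2) ^ k * min 1 (dist_at k \<sigma> \<upsilon>)
        \<le> (1/2) ^ k * min 1 (dist_at k \<sigma> \<tau>) + (1/2) ^ k * min 1 (dist_at k \<tau> \<upsilon>)"
      by (simp add: distrib_left[symmetric] mult_left_mono)
  qed
qed

sublocale R: Metric_space "carrier (Aut M)" \<rho> by (rule Metric_space_\<rho>)

lemma openin_basic:
  assumes "\<tau> \<in> carrier (Aut M)"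
  shows "openin (Aut_strong_topology M) {\<sigma>\<in>carrier (Aut M). \<forall>k<K. dist_at k \<tau> \<sigma> < e}"
proof (induction K)
  case 0
  show ?case using openin_topspace[of "Aut_strong_topology M"] by (simp add: topspace_Aut)
next
  case (Suc K)
  have "openin (Aut_strong_topology M) {\<sigma>\<in>carrier (Aut M). dist_at K \<tau> \<sigma> < e}"
    unfolding dist_at_def by (intro openin_koopman_ball F_L2 koopman_in_L2 assms)
  from openin_Int[OF Suc.IH this] show ?case
    by (rule back_subst) (auto simp: less_Suc_eq)
qed

text \<open>The identity is continuous both ways: into the strong topology by testing vectors with
  \<open>\<rho>_continuous\<close>, and back because the tail of the series leaves only finitely
  many coordinates to control.\<close>

lemma Aut_topology_eq: "Aut_strong_topology M = R.mtopology"
proof (rule topology_eq[THEN iffD2], intro allI iffI)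
  fix U assume U: "openin (Aut_strong_topology M) U"
  have "continuous_map R.mtopology (Aut_strong_topology M) (\<lambda>x. x)"
  proof (rule continuous_map_into_Aut)
    fix G assume G: "G \<in> L2 M"
    show "continuous_map R.mtopology (L2_topology M) (\<lambda>z. koopman M z G)"
      unfolding R.metric_continuous_map[OF Metric_space_L2]
      using \<rho>_continuous[OF G] koopman_in_L2[OF _ G] by blast
  qed auto
  from openin_continuous_map_preimage[OF this U]
  show "openin R.mtopology U"
    by (rule back_subst) (use openin_subset[OF U] in \<open>auto simp: topspace_Aut\<close>)
next
  fix U assume U: "openin R.mtopology U"
  have "continuous_map (Aut_strong_topology M) R.mtopology (\<lambda>x. x)"
    unfolding R.continuous_map_to_metric
  proof (intro ballI allI impI)
    fix \<tau> and e :: real assume t: "\<tau> \<in> topspace (Aut_strong_topology M)" and e: "e > 0"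
    then have t: "\<tau> \<in> carrier (Aut M)" by (simp add: topspace_Aut)
    obtain K where K: "4 * (1/2 :: real) ^ K < e" using exists_tail[OF e] by blast
    let ?U = "{\<sigma>\<in>carrier (Aut M). \<forall>k<K. dist_at k \<tau> \<sigma> < e / 4}"
    have "\<tau> \<in> ?U" using t e koopman_in_L2[OF t F_L2] by (simp add: dist_at_def)
    moreover have "\<forall>\<sigma>\<in>?U. \<sigma> \<in> R.mball \<tau> e" using \<rho>_less[OF _ K, of \<tau>] t by auto
    ultimately show "\<exists>U. openin (Aut_strong_topology M) U \<and> \<tau> \<in> U \<and> (\<forall>\<sigma>\<in>U. \<sigma> \<in> R.mball \<tau> e)"
      using openin_basic[OF t, of K "e / 4"] by blast
  qed
  from openin_continuous_map_preimage[OF this U]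
  show "openin (Aut_strong_topology M) U"
    by (rule back_subst) (use openin_subset[OF U] in \<open>auto simp: topspace_Aut\<close>)
qed

lemma metrizable_Aut: "metrizable_space (Aut_strong_topology M)"
  unfolding Aut_topology_eq by (rule R.metrizable_space_mtopology)

lemma Aut_local_base:
  assumes "openin (Aut_strong_topology M) U" "\<tau> \<in> U"
  shows "\<exists>K e. e > 0 \<and> (\<forall>\<sigma>\<in>carrier (Aut M). (\<forall>k<K. dist_at k \<tau> \<sigma> < e) \<longrightarrow> \<sigma> \<in> U)"
proof -
  obtain r where r: "r > 0" "R.mball \<tau> r \<subseteq> U"
    using assms unfolding Aut_topology_eq R.openin_mtopology by blast
  have t: "\<tau> \<in> carrier (Aut M)" using openin_subset[OF assms(1)] assms(2) by (auto simp: topspace_Aut)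
  obtain K where K: "4 * (1/2 :: real) ^ K < r" using exists_tail[OF r(1)] by blast
  show ?thesis
    using r t \<rho>_less[OF _ K, of \<tau>]
    by (intro exI[of _ K] exI[of _ "r / 4"]) (auto intro!: subsetD[OF r(2)])
qed

end

section \<open>Density of the dyadic permutations\<close>

text \<open>A permutation maximising the number of points of some \<open>I i\<close> that land in \<open>J i\<close> has the required
  property: otherwise a transposition would produce one more such point.\<close>

lemma exists_matching_permutation:
  fixes I J :: "'i \<Rightarrow> 'b set"
  assumes A: "finite A" and sub: "\<And>i. i \<in> X \<Longrightarrow> I i \<subseteq> A" "\<And>i. i \<in> X \<Longrightarrow> J i \<subseteq> A"
    and disj: "disjoint_family_on I X" "disjoint_family_on J X"
  shows "\<exists>p. p permutes A \<and> (\<forall>i\<in>X. p ` I i \<subseteq> J i \<or> J i \<subseteq> p ` I i)"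
proof -
  define hits where "hits p = {x\<in>A. \<exists>i\<in>X. x \<in> I i \<and> p x \<in> J i}" for p :: "'b \<Rightarrow> 'b"
  have "\<forall>\<tau>. \<tau> permutes A \<longrightarrow> card (hits \<tau>) \<le> card A"
    using A by (auto simp: hits_def intro!: card_mono)
  then have "\<exists>p. p permutes A \<and> (\<forall>\<tau>. \<tau> permutes A \<longrightarrow> card (hits \<tau>) \<le> card (hits p))"
    using ex_has_greatest_nat[of "\<lambda>p. p permutes A" id "\<lambda>p. card (hits p)" "Suc (card A)"] permutes_id
    by (simp add: less_Suc_eq_le le_SucI)
  then obtain p where p: "p permutes A" and max: "\<And>\<tau>. \<tau> permutes A \<Longrightarrow> card (hits \<tau>) \<le> card (hits p)"
    by blast
  have "p ` I i \<subseteq> J i \<or> J i \<subseteq> p ` I i" if i: "i \<in> X" for i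
  proof (rule ccontr)
    assume "\<not> ?thesis"
    then obtain x y where x: "x \<in> I i" "p x \<notin> J i" and y: "y \<in> J i" "y \<notin> p ` I i" by blast
    have "y \<in> A" using sub(2)[OF i] y by auto
    then have "y \<in> p ` A" using permutes_image[OF p] by simp
    then obtain z where z: "z \<in> A" "y = p z" by auto
    have zI: "z \<notin> I i" using y(2) z(2) by auto
    have xA: "x \<in> A" using sub(1)[OF i] x by auto
    \<comment> \<open>Exchanging the values at \<open>x\<close> and \<open>z\<close> sends
      \<open>x\<close> to \<open>y\<close>, a new hit. By disjointness neither \<open>x\<close> nor
      \<open>z\<close> was a hit under \<open>p\<close>, so none is lost and maximality is
      violated.\<close>
    define \<tau> where "\<tau> = p \<circ> Transposition.transpose x z"
    have \<tau>: "\<tau> permutes A" unfolding \<tau>_def by (intro permutes_compose permutes_swap_id xA z p)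
    have x_not: "x \<notin> hits p"
      using x i disj(1) by (fastforce simp: hits_def disjoint_family_on_def)
    have z_not: "z \<notin> hits p"
    proof
      assume "z \<in> hits p"
      then obtain k where k: "k \<in> X" "z \<in> I k" "y \<in> J k" using z by (auto simp: hits_def)
      then have "k \<noteq> i" using zI by auto
      then show False using disj(2) k(1,3) i y(1) by (auto simp: disjoint_family_on_def)
    qed
    have "insert x (hits p) \<subseteq> hits \<tau>"
    proof
      fix w assume w: "w \<in> insert x (hits p)"
      show "w \<in> hits \<tau>"
      proof (cases "w = x")
        case True
        then show ?thesis using xA x y z i by (auto simp: hits_def \<tau>_def)
      next
        case False
        then have "w \<in> hits p" "w \<noteq> z" using w z_not by auto
        then show ?thesis using False by (auto simp: hits_def \<tau>_def Transposition.transpose_def)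
      qed
    qed
    moreover have "finite (hits \<tau>)" "finite (hits p)" using A by (auto simp: hits_def)
    ultimately have "card (insert x (hits p)) \<le> card (hits \<tau>)" by (intro card_mono)
    then show False using max[OF \<tau>] x_not \<open>finite (hits p)\<close> by simp
  qed
  then show ?thesis using p by blast
qed

lemma square_integrable_cong_AE:
  assumes f: "f \<in> square_integrable M" and g: "g \<in> borel_measurable M" and "AE x in M. f x = g x"
  shows "g \<in> square_integrable M"
proof -
  note [measurable] = square_integrable_measurable[OF f] g
  have "integrable M (\<lambda>x. (cmod (f x))\<^sup>2) = integrable M (\<lambda>x. (cmod (g x))\<^sup>2)"
    by (rule integrable_cong_AE) (use assms(3) in \<open>auto elim!: eventually_mono\<close>)
  then show ?thesis using f by (simp add: square_integrable_def)
qed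

section \<open>Indicator functions and their closed span\<close>

context prob_space
begin

definition ind :: "'a set \<Rightarrow> ('a \<Rightarrow> complex) set" where
  "ind A = L2_class M (indicator A)"

lemma square_integrable_indicator:
  assumes [measurable]: "A \<in> sets M" shows "(indicator A :: 'a \<Rightarrow> complex) \<in> square_integrable M"
proof -
  have "(\<lambda>x. (cmod (indicator A x))\<^sup>2) = (indicator A :: 'a \<Rightarrow> real)"
    by (auto simp: indicator_def)
  then show ?thesis by (simp add: square_integrable_def integrable_indicator_iff less_top[symmetric])
qed

lemma ind_in_L2: "A \<in> sets M \<Longrightarrow> ind A \<in> L2 M"
  unfolding ind_def by (intro L2_class_in_L2 square_integrable_indicator)

lemma L2_dist_ind:
  assumes [measurable]: "A \<in> sets M" "B \<in> sets M"
  shows "L2_dist M (ind A) (ind B) = sqrt (prob (sym_diff A B))"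
proof -
  have "(\<integral>x. (cmod (indicator A x - indicator B x))\<^sup>2 \<partial>M) = (\<integral>x. indicator (sym_diff A B) x \<partial>M)"
    by (rule Bochner_Integration.integral_cong) (auto simp: indicator_def)
  then show ?thesis
    unfolding ind_def by (simp add: L2_dist_class square_integrable_indicator)
qed

lemma koopman_ind:
  assumes T: "T \<in> mp_auts M" and A: "A \<in> sets M"
  shows "koopman M (aut_class M T) (ind A) = ind {x\<in>space M. mp_inv M T x \<in> A}"
proof -
  note [measurable] = mp_autsD(2)[OF T] A
  note si = square_integrable_indicator[OF A]
  have "{x\<in>space M. mp_inv M T x \<in> A} \<in> sets M" by measurable
  note si' = square_integrable_indicator[OF this]
  have "L2_class M (\<lambda>x. indicator A (mp_inv M T x)) = L2_class M (indicator {x\<in>space M. mp_inv M T x \<in> A})"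
    unfolding L2_class_eq_iff[OF square_integrable_mp_inv[OF si T] si']
    by (rule AE_I2) (simp add: indicator_def)
  then show ?thesis by (simp only: ind_def koopman_class[OF T si])
qed

lemma sets_mp_inv_vimage:
  assumes T: "T \<in> mp_auts M" and A: "A \<in> sets M"
  shows "{x\<in>space M. mp_inv M T x \<in> A} \<in> sets M"
  using measurable_sets[OF mp_autsD(2)[OF T] A] by (simp add: vimage_def Int_def conj_commute)

lemma measure_mp_inv_vimage:
  assumes T: "T \<in> mp_auts M" and A: "A \<in> sets M"
  shows "prob {x\<in>space M. mp_inv M T x \<in> A} = measure M A"
  using measure_distr[OF mp_autsD(2)[OF T] A] distr_mp_inv[OF T]
  by (simp add: vimage_def Int_def conj_commute)

lemma closed_linear_sum:
  fixes A :: "'i \<Rightarrow> 'a set" and c :: "'i \<Rightarrow> complex"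
  assumes P: "closed_linear M P" "\<And>A. A \<in> sets M \<Longrightarrow> ind A \<in> P"
    and Y: "finite Y" "\<And>y. y \<in> Y \<Longrightarrow> A y \<in> sets M"
  shows "(\<lambda>x. \<Sum>y\<in>Y. c y * indicator (A y) x) \<in> square_integrable M \<and>
    L2_class M (\<lambda>x. \<Sum>y\<in>Y. c y * indicator (A y) x) \<in> P"
  using Y
proof (induction rule: finite_induct)
  case empty
  have "L2_scale M 0 (ind {}) \<in> P" using P unfolding closed_linear_def by auto
  then show ?case
    by (simp add: ind_def L2_scale_class square_integrable_indicator)
       (simp add: square_integrable_def)
next
  case (insert y Y)
  let ?h = "\<lambda>x. \<Sum>y\<in>Y. c y * indicator (A y) x"
  have h: "?h \<in> square_integrable M" "L2_class M ?h \<in> P" using insert by auto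
  have i: "(indicator (A y) :: 'a \<Rightarrow> complex) \<in> square_integrable M" "ind (A y) \<in> P"
    using insert.prems P by (auto intro: square_integrable_indicator)
  have "L2_add M (L2_scale M (c y) (ind (A y))) (L2_class M ?h) \<in> P"
    using P(1) i h unfolding closed_linear_def by blast
  moreover have "(\<lambda>x. \<Sum>y\<in>insert y Y. c y * indicator (A y) x) = (\<lambda>x. c y * indicator (A y) x + ?h x)"
    by (rule ext) (rule sum.insert[OF insert.hyps])
  ultimately show ?case
    using square_integrable_add[OF square_integrable_scale[OF i(1)] h(1)]
    by (simp only: ind_def L2_scale_class[OF i(1)] L2_add_class[OF square_integrable_scale[OF i(1)] h(1)])
qed

text \<open>Simple functions are dense in the space of square-integrable functions.\<close>

lemma closed_linear_ind_imp_all: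
  assumes P: "closed_linear M P" "\<And>A. A \<in> sets M \<Longrightarrow> ind A \<in> P"
  shows "P = L2 M"
proof
  show "P \<subseteq> L2 M" using P(1) by (simp add: closed_linear_def)
  have simple: "s \<in> square_integrable M \<and> L2_class M s \<in> P" if s: "simple_function M s" for s
  proof -
    let ?h = "\<lambda>x. \<Sum>y\<in>s ` space M. y * indicator (s -` {y} \<inter> space M) x"
    have h: "?h \<in> square_integrable M" "L2_class M ?h \<in> P"
      using closed_linear_sum[OF P, of "s ` space M" "\<lambda>y. s -` {y} \<inter> space M" "\<lambda>y. y"]
        simple_functionD[OF s] by auto
    have "?h x = s x" if x: "x \<in> space M" for x
    proof -
      have "s x = (\<Sum>y\<in>s ` space M. indicator (s -` {y} \<inter> space M) x *\<^sub>R y)"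
        by (rule simple_function_indicator_representation_banach[OF s x])
      also have "\<dots> = ?h x" by (rule sum.cong) (auto simp: indicator_def)
      finally show ?thesis by (rule sym)
    qed
    then have ae: "AE x in M. ?h x = s x" by (intro AE_I2)
    have s': "s \<in> square_integrable M"
      using h(1) borel_measurable_simple_function[OF s] ae by (rule square_integrable_cong_AE)
    then have "L2_class M ?h = L2_class M s" using h(1) ae by (simp add: L2_class_eq_iff)
    then show ?thesis using s' h(2) by simp
  qed
  show "L2 M \<subseteq> P"
  proof
    fix G assume G: "G \<in> L2 M"
    then obtain f where f: "f \<in> square_integrable M" "G = L2_class M f" by (rule L2_cases)
    note [measurable] = square_integrable_measurable[OF f(1)]
    obtain s where s_all: "\<forall>i. simple_function M (s i)"
      "\<forall>x\<in>space M. (\<lambda>i. s i x) \<longlonglongrightarrow> f x" "\<forall>i. \<forall>x\<in>space M. dist (s i x) 0 \<le> 2 * dist (f x) 0"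
      using borel_measurable_implies_sequence_metric[of f M 0] \<open>f \<in> borel_measurable M\<close> by blast
    then have s: "\<And>i. simple_function M (s i)" "\<And>x. x \<in> space M \<Longrightarrow> (\<lambda>i. s i x) \<longlonglongrightarrow> f x"
      "\<And>i x. x \<in> space M \<Longrightarrow> dist (s i x) 0 \<le> 2 * dist (f x) 0"
      by blast+
    have [measurable]: "s i \<in> borel_measurable M" for i
      using s(1) by (rule borel_measurable_simple_function)
    have "(\<lambda>i. \<integral>x. (cmod (f x - s i x))\<^sup>2 \<partial>M) \<longlonglongrightarrow> (\<integral>x. 0 \<partial>M)"
    proof (rule integral_dominated_convergence[where w = "\<lambda>x. 9 * (cmod (f x))\<^sup>2"])
      \<comment> \<open>The simple functions are bounded by twice \<open>f\<close> in modulus, so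
        the difference is at most three times \<open>f\<close>, and its square at most nine times
        the square.\<close>
      show "integrable M (\<lambda>x. 9 * (cmod (f x))\<^sup>2)" using square_integrable_integrable[OF f(1)] by simp
      show "AE x in M. (\<lambda>i. (cmod (f x - s i x))\<^sup>2) \<longlonglongrightarrow> 0"
      proof (rule AE_I2)
        fix x assume "x \<in> space M"
        from tendsto_power[OF tendsto_norm[OF tendsto_diff[OF tendsto_const[of "f x"] s(2)[OF this]]], of 2]
        show "(\<lambda>i. (cmod (f x - s i x))\<^sup>2) \<longlonglongrightarrow> 0" by simp
      qed
      show "AE x in M. norm ((cmod (f x - s i x))\<^sup>2) \<le> 9 * (cmod (f x))\<^sup>2" for i
      proof (rule AE_I2)
        fix x assume "x \<in> space M"
        then have "cmod (f x - s i x) \<le> 3 * cmod (f x)"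
          using s(3)[of x i] norm_triangle_ineq4[of "f x" "s i x"] by simp
        then have "(cmod (f x - s i x))\<^sup>2 \<le> (3 * cmod (f x))\<^sup>2" by (intro power_mono) auto
        then show "norm ((cmod (f x - s i x))\<^sup>2) \<le> 9 * (cmod (f x))\<^sup>2" by (simp add: power_mult_distrib)
      qed
    qed measurable
    then have "(\<lambda>i. sqrt (\<integral>x. (cmod (f x - s i x))\<^sup>2 \<partial>M)) \<longlonglongrightarrow> sqrt 0"
      by (intro tendsto_real_sqrt) simp
    moreover have "L2_dist M G (L2_class M (s i)) = sqrt (\<integral>x. (cmod (f x - s i x))\<^sup>2 \<partial>M)" for i
      using simple[OF s(1)] f by (simp add: L2_dist_class)
    ultimately have lim: "(\<lambda>i. L2_dist M G (L2_class M (s i))) \<longlonglongrightarrow> 0" by simp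
    have "\<exists>H\<in>P. L2_dist M G H < e" if e: "e > 0" for e
    proof -
      obtain i where "L2_dist M G (L2_class M (s i)) < e"
        using order_tendstoD(2)[OF lim e] by (auto simp: eventually_sequentially)
      then show ?thesis using simple[OF s(1)] by blast
    qed
    then show "G \<in> P" using P(1) G unfolding closed_linear_def by blast
  qed
qed

end

section \<open>The dyadic indicators as a total sequence\<close>

context uniform_coding
begin

text \<open>The pieces of all levels in one sequence. Indices beyond the number of cells give empty
  pieces and hence the zero vector.\<close>

definition dyadic_ind :: "nat \<Rightarrow> ('a \<Rightarrow> complex) set" where
  "dyadic_ind k = ind (piece (fst (prod_decode k)) (snd (prod_decode k)))"

text \<open>Dyadic unions are finite sums of dyadic indicators. The distance of two indicators is
  the square root of a measure, so set approximation within \<open>e\<^sup>2\<close> gives vector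
  approximation within \<open>e\<close>.\<close>

lemma closed_linear_dyadic_imp_ind:
  assumes P: "closed_linear M P" "\<And>k. dyadic_ind k \<in> P" and A: "A \<in> sets M"
  shows "ind A \<in> P"
proof -
  have cell_P: "ind (piece n j) \<in> P" for n j
    using P(2)[of "prod_encode (n, j)"] by (simp add: dyadic_ind_def)
  have level_P: "ind (level n J) \<in> P" if "finite J" for n J
    using that
  proof (induction rule: finite_induct)
    case empty
    have "L2_scale M 0 (ind (piece n 0)) \<in> P" using P cell_P unfolding closed_linear_def by blast
    moreover have "L2_scale M 0 (ind (piece n 0)) = ind (level n {})"
    proof -
      have "(indicator {} :: 'a \<Rightarrow> complex) = (\<lambda>x. 0)" by (rule ext) simp
      then show ?thesis by (simp add: ind_def L2_scale_class square_integrable_indicator level_def)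
    qed
    ultimately show ?case by simp
  next
    case (insert j J)
    have "L2_add M (ind (piece n j)) (ind (level n J)) \<in> P"
      using P(1) cell_P insert.IH unfolding closed_linear_def by blast
    also have "L2_add M (ind (piece n j)) (ind (level n J))
        = L2_class M (\<lambda>x. indicator (piece n j) x + indicator (level n J) x)"
      by (simp add: ind_def L2_add_class square_integrable_indicator)
    also have "(\<lambda>x. indicator (piece n j) x + indicator (level n J) x) = (indicator (level n (insert j J)) :: 'a \<Rightarrow> complex)"
      using insert.hyps by (auto simp: indicator_def piece_def level_def fun_eq_iff)
    finally show ?case by (simp add: ind_def)
  qed
  have "\<exists>G\<in>P. L2_dist M (ind A) G < e" if e: "e > 0" for e
  proof -
    have "e\<^sup>2 > 0" using e by simp
    then obtain N where N: "\<forall>n\<ge>N. approx_at n A (e\<^sup>2)"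
      using dyadic_approx[OF A] unfolding dyadic_approx_def by blast
    obtain J where J: "J \<subseteq> {..<2 ^ N}" "prob (sym_diff A (level N J)) < e\<^sup>2"
      using N by blast
    have "L2_dist M (ind A) (ind (level N J)) < sqrt (e\<^sup>2)"
      unfolding L2_dist_ind[OF A level_sets] using J(2) by (simp only: real_sqrt_less_iff)
    then show ?thesis
      using level_P[OF finite_subset[OF J(1)]] e by auto
  qed
  then show ?thesis using P(1) ind_in_L2[OF A] unfolding closed_linear_def by blast
qed

text \<open>Equal action on indicators means that the two inverses fall almost surely into the same
  measurable sets. Countably many such sets, the \<open>g\<close>-preimages of rational half-lines,
  determine the code of a point, and \<open>q\<close> recovers the point from it.\<close>

lemma koopman_faithful:
  assumes S: "S \<in> mp_auts M" and R: "R \<in> mp_auts M"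
    and eq: "\<And>F. F \<in> L2 M \<Longrightarrow> koopman M (aut_class M S) F = koopman M (aut_class M R) F"
  shows "aut_class M S = aut_class M R"
proof -
  note [measurable] = mp_autsD(1,2)[OF S] mp_autsD(1,2)[OF R]
  have sep: "AE x in M. mp_inv M S x \<in> A \<longleftrightarrow> mp_inv M R x \<in> A" if A: "A \<in> sets M" for A
  proof -
    have "ind {x\<in>space M. mp_inv M S x \<in> A} = ind {x\<in>space M. mp_inv M R x \<in> A}"
      using eq[OF ind_in_L2[OF A]] by (simp add: koopman_ind S R A)
    then have "AE x in M. indicator {x\<in>space M. mp_inv M S x \<in> A} x = (indicator {x\<in>space M. mp_inv M R x \<in> A} x :: complex)"
      unfolding ind_def
      by (subst (asm) L2_class_eq_iff) (auto intro!: square_integrable_indicator sets_mp_inv_vimage S R A)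
    then show ?thesis
      using AE_space by eventually_elim (auto simp: indicator_def split: if_splits)
  qed
  have "AE x in M. mp_inv M S x \<in> g -` {..<real_of_rat r} \<inter> space M \<longleftrightarrow> mp_inv M R x \<in> g -` {..<real_of_rat r} \<inter> space M" for r
    by (rule sep) (rule measurable_sets[OF g], simp)
  then have "AE x in M. \<forall>r. mp_inv M S x \<in> g -` {..<real_of_rat r} \<inter> space M \<longleftrightarrow> mp_inv M R x \<in> g -` {..<real_of_rat r} \<inter> space M"
    by (simp only: AE_all_countable) blast
  then have "AE x in M. mp_inv M S x = mp_inv M R x"
    using mp_inv_AE[OF S q_g] mp_inv_AE[OF R q_g] AE_space
  proof eventually_elim
    case (elim x)
    then have *: "g (mp_inv M S x) < real_of_rat r \<longleftrightarrow> g (mp_inv M R x) < real_of_rat r" for r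
      using mp_auts_simps(2)[OF S] mp_auts_simps(2)[OF R] by auto
    have "g (mp_inv M S x) = g (mp_inv M R x)"
    proof (rule ccontr)
      assume "\<not> ?thesis"
      then consider "g (mp_inv M S x) < g (mp_inv M R x)" | "g (mp_inv M R x) < g (mp_inv M S x)" by linarith
      then show False
        by cases (use of_rat_dense * in \<open>meson less_asym\<close>)+
    qed
    then show ?case using elim by metis
  qed
  then have "AE x in M. (\<lambda>x\<in>space M. mp_inv M S x) x = (\<lambda>x\<in>space M. mp_inv M R x) x"
    using AE_space by eventually_elim simp
  from AE_mp_inv_eq[OF mp_auts_inverse(1)[OF S] mp_auts_inverse(1)[OF R] this] AE_space
  have "AE x in M. S x = R x"
  proof eventually_elim
    case (elim x)
    show ?case using elim(1) unfolding mp_auts_inverse(2)[OF S elim(2)] mp_auts_inverse(2)[OF R elim(2)] .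
  qed
  then show ?thesis using S R by (simp add: aut_class_eq_iff)
qed

sublocale total_sequence M dyadic_ind
proof
  show "dyadic_ind k \<in> L2 M" for k unfolding dyadic_ind_def by (intro ind_in_L2 piece_sets)
  show "P = L2 M" if "closed_linear M P" "\<And>k. dyadic_ind k \<in> P" for P
    using that by (intro closed_linear_ind_imp_all closed_linear_dyadic_imp_ind)
  show "p = \<tau>" if st: "p \<in> carrier (Aut M)" "\<tau> \<in> carrier (Aut M)"
    "\<And>F. F \<in> L2 M \<Longrightarrow> koopman M p F = koopman M \<tau> F" for p \<tau>
  proof -
    obtain S where S: "S \<in> mp_auts M" "p = aut_class M S" using st(1) by (rule Aut_cases)
    obtain R where R: "R \<in> mp_auts M" "\<tau> = aut_class M R" using st(2) by (rule Aut_cases)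
    show ?thesis using koopman_faithful[OF S(1) R(1)] st(3) by (simp add: S R)
  qed
qed

section \<open>Distances to dyadic permutations near the identity\<close>

abbreviation disagree :: "('a \<Rightarrow> 'a) \<Rightarrow> ('a \<Rightarrow> 'a) \<Rightarrow> 'a set \<Rightarrow> 'a set" where
  "disagree S R A \<equiv> {x\<in>space M. (mp_inv M S x \<in> A) \<noteq> (mp_inv M R x \<in> A)}"

lemma dist_at_eq:
  assumes S: "S \<in> mp_auts M" and R: "R \<in> mp_auts M"
  shows "dist_at (prod_encode (n, j)) (aut_class M S) (aut_class M R)
    = sqrt (prob (disagree S R (piece n j)))"
proof -
  have "sym_diff {x\<in>space M. mp_inv M S x \<in> piece n j} {x\<in>space M. mp_inv M R x \<in> piece n j}
      = disagree S R (piece n j)" by auto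
  then show ?thesis
    by (simp add: dist_at_def dyadic_ind_def koopman_ind S R L2_dist_ind sets_mp_inv_vimage)
qed

text \<open>The pairing code of \<open>(n, j)\<close> is at least \<open>n\<close>, so the first
  \<open>K\<close> test vectors involve only pieces of level at most \<open>K\<close>. This turns a
  finite set of coordinates into a bounded dyadic level.\<close>

lemma dist_at_less:
  assumes S: "S \<in> mp_auts M" and R: "R \<in> mp_auts M" and "e > 0"
    and "\<And>n j. n \<le> K \<Longrightarrow>
      prob (disagree S R (piece n j)) < e\<^sup>2"
    and "k < K"
  shows "dist_at k (aut_class M S) (aut_class M R) < e"
proof -
  obtain n j where k: "k = prod_encode (n, j)" by (metis prod_decode_inverse surj_pair)
  have "n \<le> K" using le_prod_encode_1[of n j] \<open>k < K\<close> k by simp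
  then have "sqrt (prob (disagree S R (piece n j))) < sqrt (e\<^sup>2)"
    using assms(4) by (simp only: real_sqrt_less_iff)
  then show ?thesis using \<open>e > 0\<close> by (simp add: k dist_at_eq S R)
qed

lemma measure_level:
  assumes "J \<subseteq> {..<2 ^ n}" shows "prob (level n J) = card J / 2 ^ n"
proof -
  have fin: "finite J" using assms by (rule finite_subset) simp
  have "level n J = (\<Union>j\<in>J. piece n j)" by (auto simp: level_def piece_def)
  then have "prob (level n J) = (\<Sum>j\<in>J. prob (piece n j))"
    using fin by (simp only:) (rule measure_finite_Union, auto simp: disjoint_family_on_def piece_def)
  also have "\<dots> = (\<Sum>j\<in>J. 1 / 2 ^ n)" using assms by (intro sum.cong measure_piece) auto
  finally show ?thesis by simp
qed

lemma cell_perm_inv_core: "x \<in> core \<Longrightarrow> level_perm n p \<Longrightarrow> pos n (mp_inv M (cell_perm n p) x) = inv_into UNIV p (pos n x)"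
  by (simp add: inv_into_cell_perm core_space pos_cell_perm permutes_inv)

text \<open>A piece whose index is fixed by \<open>p\<close> is fixed pointwise on
  \<open>core\<close>, so the change is confined to the moved pieces, whatever \<open>A\<close>
  is.\<close>

lemma measure_moved_le:
  assumes p: "level_perm n p" and A: "A \<in> sets M"
  shows "prob {x\<in>space M. (x \<in> A) \<noteq> (mp_inv M (cell_perm n p) x \<in> A)} \<le> card {i\<in>{..<2 ^ n}. p i \<noteq> i} / 2 ^ n"
proof -
  let ?J = "{i\<in>{..<2 ^ n}. p i \<noteq> i}"
  note [measurable] = mp_autsD(2)[OF cell_perm_mp_auts[OF p]] A
  have "AE x in M. x \<in> {x\<in>space M. (x \<in> A) \<noteq> (mp_inv M (cell_perm n p) x \<in> A)} \<longrightarrow> x \<in> level n ?J"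
    using core_props(2)
  proof eventually_elim
    case (elim x)
    have "mp_inv M (cell_perm n p) x = x" if "p (pos n x) = pos n x"
    proof -
      have "inv_into UNIV p (pos n x) = pos n x"
        using that permutes_inv_eq[OF p] by blast
      then have "cell_shift n (inv_into UNIV p) (g x) = g x"
        by (simp add: cell_shift_def pos_def)
      then show ?thesis
        using elim by (simp add: inv_into_cell_perm[OF core_space p] cell_perm_core core_props(3))
    qed
    then show ?case using pos_less[of n x] by (auto simp: level_def)
  qed
  then have "prob {x\<in>space M. (x \<in> A) \<noteq> (mp_inv M (cell_perm n p) x \<in> A)} \<le> prob (level n ?J)"
    by (rule finite_measure_mono_AE) measurable
  also have "\<dots> = card ?J / 2 ^ n" by (rule measure_level) auto
  finally show ?thesis .
qed

lemma aut_class_cell_perm_id: "aut_class M (cell_perm n id) = \<one>\<^bsub>Aut M\<^esub>"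
proof -
  have "cell_perm n id = (\<lambda>x\<in>space M. x)" by (rule ext) (simp add: cell_perm_id, simp add: cell_perm_def)
  then show ?thesis by (simp add: one_Aut)
qed

text \<open>The bound of \<open>measure_moved_le\<close> depends on neither the level nor the test
  set, so one \<open>\<eta>\<close> serves for all \<open>n\<close>. It is \<open>e\<^sup>2\<close>
  because coordinate distances are square roots of measures.\<close>

lemma near_one:
  assumes "openin (Aut_strong_topology M) U" "\<one>\<^bsub>Aut M\<^esub> \<in> U"
  shows "\<exists>\<eta>>0 :: real. \<forall>n p. level_perm n p \<longrightarrow> real (card {i\<in>{..<2 ^ n}. p i \<noteq> i}) < \<eta> * 2 ^ n \<longrightarrow>
    aut_class M (cell_perm n p) \<in> U"
proof -
  obtain K e where e: "e > 0" and U: "\<And>p. p \<in> carrier (Aut M) \<Longrightarrow> (\<forall>k<K. dist_at k \<one>\<^bsub>Aut M\<^esub> p < e) \<Longrightarrow> p \<in> U"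
    using Aut_local_base[OF assms] by blast
  show ?thesis
  proof (intro exI[of _ "e\<^sup>2"] conjI allI impI)
    show "0 < e\<^sup>2" using e by simp
    fix n and p :: "nat \<Rightarrow> nat"
    assume p: "level_perm n p" and card: "card {i\<in>{..<2 ^ n}. p i \<noteq> i} < e\<^sup>2 * 2 ^ n"
    show "aut_class M (cell_perm n p) \<in> U"
    proof (rule U)
      show "aut_class M (cell_perm n p) \<in> carrier (Aut M)" by (intro aut_class_in_carrier cell_perm_mp_auts p)
      show "\<forall>k<K. dist_at k \<one>\<^bsub>Aut M\<^esub> (aut_class M (cell_perm n p)) < e"
        unfolding one_Aut
      proof (intro allI impI dist_at_less[OF mp_auts_id cell_perm_mp_auts[OF p] e])
        fix m j
        have "mp_inv M (\<lambda>x\<in>space M. x) x = x" if "x \<in> space M" for x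
          using mp_auts_simps(4)[OF mp_auts_id that] that by simp
        then have "(disagree (\<lambda>x\<in>space M. x) (cell_perm n p) (piece m j))
            = {x\<in>space M. (x \<in> piece m j) \<noteq> (mp_inv M (cell_perm n p) x \<in> piece m j)}" by auto
        also have "prob \<dots> \<le> card {i\<in>{..<2 ^ n}. p i \<noteq> i} / 2 ^ n"
          by (rule measure_moved_le[OF p piece_sets])
        also have "\<dots> < e\<^sup>2" using card by (simp add: divide_less_eq)
        finally show "prob (disagree (\<lambda>x\<in>space M. x) (cell_perm n p) (piece m j)) < e\<^sup>2" .
      qed
    qed
  qed
qed

section \<open>Weak approximation by dyadic permutations\<close>

lemma pos_div:
  assumes "m \<le> n" shows "pos m x = pos n x div 2 ^ (n - m)"
proof -
  have "(2 :: real) ^ n = 2 ^ m * 2 ^ (n - m)" using assms by (simp add: power_add[symmetric])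
  then have "2 ^ m * g x = (2 ^ n * g x) / of_int (2 ^ (n - m))" by simp
  then have "\<lfloor>2 ^ m * g x\<rfloor> = \<lfloor>2 ^ n * g x\<rfloor> div 2 ^ (n - m)"
    using floor_divide_real_eq_div[of "2 ^ (n - m)" "2 ^ n * g x"] by simp
  then show ?thesis
    using less_imp_le[OF g_pos[of x]] by (simp add: pos_def cell_def nat_div_distrib nat_power_eq)
qed

text \<open>Choosing pieces by majority costs nothing and, unlike an arbitrary good approximation, keeps
  disjoint sets disjoint.\<close>

definition majority :: "nat \<Rightarrow> 'a set \<Rightarrow> nat set" where
  "majority n B = {l. l < 2 ^ n \<and> 1 / 2 / 2 ^ n < prob (piece n l \<inter> B)}"

lemma measure_sym_diff_level:
  assumes B [measurable]: "B \<in> sets M" and J: "J \<subseteq> {..<2 ^ n}"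
  shows "prob (sym_diff B (level n J))
    = (\<Sum>l<2 ^ n. if l \<in> J then 1 / 2 ^ n - prob (piece n l \<inter> B) else prob (piece n l \<inter> B))"
proof -
  have "sym_diff B (level n J) = (\<Union>l<2 ^ n. sym_diff B (level n J) \<inter> piece n l)"
    using pos_less sets.sets_into_space[OF B] by (auto simp: level_def piece_def)
  then have "prob (sym_diff B (level n J)) = prob (\<Union>l<2 ^ n. sym_diff B (level n J) \<inter> piece n l)"
    by (rule arg_cong)
  also have "\<dots> = (\<Sum>l<2 ^ n. prob (sym_diff B (level n J) \<inter> piece n l))"
    by (rule measure_finite_Union) (auto simp: disjoint_family_on_def piece_def)
  also have "\<dots> = (\<Sum>l<2 ^ n. if l \<in> J then 1 / 2 ^ n - prob (piece n l \<inter> B) else prob (piece n l \<inter> B))"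
  proof (rule sum.cong)
    fix l :: nat assume l: "l \<in> {..<2 ^ n}"
    show "prob (sym_diff B (level n J) \<inter> piece n l)
        = (if l \<in> J then 1 / 2 ^ n - prob (piece n l \<inter> B) else prob (piece n l \<inter> B))"
    proof (cases "l \<in> J")
      case True
      then have "sym_diff B (level n J) \<inter> piece n l = piece n l - piece n l \<inter> B" by (auto simp: level_def piece_def)
      moreover have "prob (piece n l - piece n l \<inter> B) = prob (piece n l) - prob (piece n l \<inter> B)"
        by (rule finite_measure_Diff) auto
      ultimately show ?thesis using True l by (simp add: measure_piece)
    next
      case False
      then have "sym_diff B (level n J) \<inter> piece n l = piece n l \<inter> B" by (auto simp: level_def piece_def)
      then show ?thesis using False by simp
    qed
  qed simp
  finally show ?thesis .
qed

text \<open>The error is a sum over pieces with an independent choice in each, and the majority rule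
  makes the cheaper choice every time.\<close>

lemma majority_optimal:
  assumes B: "B \<in> sets M" and J: "J \<subseteq> {..<2 ^ n}"
  shows "prob (sym_diff B (level n (majority n B))) \<le> prob (sym_diff B (level n J))"
proof -
  have "majority n B \<subseteq> {..<2 ^ n}" by (auto simp: majority_def)
  then show ?thesis
    unfolding measure_sym_diff_level[OF B J] measure_sym_diff_level[OF B \<open>majority n B \<subseteq> {..<2 ^ n}\<close>]
    by (intro sum_mono) (auto simp: majority_def)
qed

text \<open>Two disjoint sets cannot both fill strictly more than half of a piece; the strict
  inequality in \<open>majority\<close> excludes ties.\<close>

lemma majority_disjoint:
  assumes [measurable]: "B \<in> sets M" "C \<in> sets M" and "B \<inter> C = {}"
  shows "majority n B \<inter> majority n C = {}"
proof (rule ccontr)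
  assume "majority n B \<inter> majority n C \<noteq> {}"
  then obtain l where l: "l < 2 ^ n" "1 / 2 / 2 ^ n < prob (piece n l \<inter> B)" "1 / 2 / 2 ^ n < prob (piece n l \<inter> C)"
    by (auto simp: majority_def)
  have "prob (piece n l \<inter> B) + prob (piece n l \<inter> C) = prob ((piece n l \<inter> B) \<union> (piece n l \<inter> C))"
    by (rule finite_measure_Union[symmetric]) (use assms in auto)
  also have "\<dots> \<le> prob (piece n l)" by (rule finite_measure_mono) auto
  also have "\<dots> = 1 / 2 / 2 ^ n + 1 / 2 / 2 ^ n" using l by (simp add: measure_piece)
  finally show False using l by linarith
qed

text \<open>The error on one piece has two sources, each below \<open>\<delta>\<close>: replacing
  the target set \<open>B i\<close> by the dyadic union of \<open>J i\<close>, and the mismatch of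
  \<open>J i\<close> with the image of \<open>I i\<close> under \<open>p\<close>. The latter is only
  a difference in size, as the matching makes the two nested.\<close>

lemma cell_perms_dense:
  assumes U: "openin (Aut_strong_topology M) U" and "\<tau> \<in> U"
  shows "\<exists>N. \<forall>n\<ge>N. \<exists>p. level_perm n p \<and> aut_class M (cell_perm n p) \<in> U"
proof -
  have "\<tau> \<in> carrier (Aut M)" using openin_subset[OF U] assms(2) by (auto simp: topspace_Aut)
  then obtain S where S: "S \<in> mp_auts M" "\<tau> = aut_class M S" by (rule Aut_cases)
  obtain m e where e: "e > 0" and U': "\<And>p. p \<in> carrier (Aut M) \<Longrightarrow> (\<forall>k<m. dist_at k \<tau> p < e) \<Longrightarrow> p \<in> U"
    using Aut_local_base[OF U assms(2)] by blast
  \<comment> \<open>Here \<open>m\<close> bounds the number of test vectors and thereby their dyadic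
    levels. Each of the \<open>2 ^ m\<close> pieces of level \<open>m\<close> is allowed the error
    \<open>2 * \<delta>\<close>, which adds up to \<open>e\<^sup>2\<close>.\<close>
  define \<delta> where "\<delta> = e\<^sup>2 / (2 * 2 ^ m)"
  have \<delta>: "\<delta> > 0" using e by (simp add: \<delta>_def)
  define B where "B i = {x\<in>space M. mp_inv M S x \<in> piece m i}" for i
  have B [measurable]: "B i \<in> sets M" for i
    unfolding B_def by (intro sets_mp_inv_vimage S piece_sets)
  have mB: "prob (B i) = 1 / 2 ^ m" if "i < 2 ^ m" for i
    unfolding B_def using measure_mp_inv_vimage[OF S(1) piece_sets] measure_piece[OF that] by simp
  have "\<exists>N. \<forall>n\<ge>N. approx_at n (B i) \<delta>" for i
    using dyadic_approx[OF B] \<delta> unfolding dyadic_approx_def by blast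
  then obtain N where N: "\<And>i n. n \<ge> N i \<Longrightarrow> approx_at n (B i) \<delta>"
    by metis
  \<comment> \<open>Being at least \<open>m\<close> makes the partition of level \<open>n\<close>
    refine that of level \<open>m\<close>; the maximum makes it fine enough for all the sets
    \<open>B i\<close> at once.\<close>
  define N0 where "N0 = max m (Max (N ` {..<2 ^ m}))"
  have "\<exists>p. level_perm n p \<and> aut_class M (cell_perm n p) \<in> U" if n: "n \<ge> N0" for n
  proof -
    have mn: "m \<le> n" using n by (simp add: N0_def)
    define J where "J i = majority n (B i)" for i
    define I where "I i = {l. l < 2 ^ n \<and> l div 2 ^ (n - m) = i}" for i :: nat
    have JA: "J i \<subseteq> {..<2 ^ n}" and IA: "I i \<subseteq> {..<2 ^ n}" for i
      by (auto simp: J_def I_def majority_def)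
    have J_approx: "prob (sym_diff (B i) (level n (J i))) < \<delta>" if i: "i < 2 ^ m" for i
    proof -
      have "N i \<le> Max (N ` {..<2 ^ m})" using i by (intro Max_ge) auto
      then have "N i \<le> n" using n by (simp add: N0_def)
      then obtain J' where "J' \<subseteq> {..<2 ^ n}" "prob (sym_diff (B i) (level n J')) < \<delta>" using N by blast
      then show ?thesis using majority_optimal[OF B, of J' n i] by (simp add: J_def)
    qed
    have "disjoint_family_on I {..<2 ^ m}" by (auto simp: disjoint_family_on_def I_def)
    moreover have "disjoint_family_on J {..<2 ^ m}"
      unfolding disjoint_family_on_def J_def
      by (intro ballI impI majority_disjoint B) (auto simp: B_def piece_def)
    ultimately obtain p where p: "level_perm n p"
      and match: "\<And>i. i < 2 ^ m \<Longrightarrow> p ` I i \<subseteq> J i \<or> J i \<subseteq> p ` I i"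
      using exists_matching_permutation[of "{..<2 ^ n}" "{..<2 ^ m}" I J] IA JA by (auto simp: lessThan_iff)
    have pI: "p ` I i \<subseteq> {..<2 ^ n}" for i
      using image_mono[OF IA, of p i] permutes_image[OF p] by simp
    have level_I: "level n (I i) = piece m i" for i
      using pos_div[OF mn] pos_less by (auto simp: level_def piece_def I_def)
    note [measurable] = mp_autsD(2)[OF S(1)] mp_autsD(2)[OF cell_perm_mp_auts[OF p]]
    have E [measurable]: "disagree S (cell_perm n p) (piece m i) \<in> sets M" for i
      by measurable
    have err: "prob (disagree S (cell_perm n p) (piece m i)) < 2 * \<delta>"
      if i: "i < 2 ^ m" for i
    proof -
      have "card (p ` I i) = card (I i)"
        by (rule card_image) (use permutes_inj[OF p] in \<open>auto simp: inj_on_def inj_def\<close>)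
      then have mp: "prob (level n (p ` I i)) = prob (B i)"
        using mB[OF i] measure_piece[OF i] measure_level[OF pI, of i] measure_level[OF IA, of i] level_I[of i] by simp
      have "AE x in M. x \<in> disagree S (cell_perm n p) (piece m i) \<longleftrightarrow>
          x \<in> sym_diff (B i) (level n (p ` I i))"
        using core_props(2)
      proof eventually_elim
        case (elim x)
        have x: "x \<in> space M" "mp_inv M (cell_perm n p) x \<in> space M"
          using elim core_space mp_auts_simps(2)[OF cell_perm_mp_auts[OF p]] by auto
        have "mp_inv M (cell_perm n p) x \<in> piece m i \<longleftrightarrow> inv_into UNIV p (pos n x) \<in> I i"
          unfolding level_I[symmetric] using x cell_perm_inv_core[OF elim p] by (simp add: level_def)
        also have "\<dots> \<longleftrightarrow> pos n x \<in> p ` I i"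
          by (metis p bij_vimage_eq_inv_image image_eqI image_iff permutes_bij permutes_inverses(1) permutes_inverses(2))
        finally show ?case using x by (auto simp: B_def level_def)
      qed
      then have "prob (disagree S (cell_perm n p) (piece m i))
          = prob (sym_diff (B i) (level n (p ` I i)))"
        by (rule measure_eq_AE) (use E B level_sets in auto)
      also have "\<dots> \<le> prob (sym_diff (B i) (level n (J i))) + prob (sym_diff (level n (J i)) (level n (p ` I i)))"
        by (intro measure_sym_diff_triangle) auto
      \<comment> \<open>Nestedness turns the symmetric difference into a difference of measures. As
        the second measure equals that of \<open>B i\<close>, it is bounded by the approximation
        error of \<open>J i\<close> once more.\<close>
      also have "prob (sym_diff (level n (J i)) (level n (p ` I i))) = \<bar>prob (level n (J i)) - prob (level n (p ` I i))\<bar>"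
        using match[OF i]
      proof
        assume sub: "p ` I i \<subseteq> J i"
        then have "sym_diff (level n (J i)) (level n (p ` I i)) = level n (J i) - level n (p ` I i)"
          and le: "level n (p ` I i) \<subseteq> level n (J i)" by (auto simp: level_def)
        then show ?thesis
          using finite_measure_Diff[of "level n (J i)" "level n (p ` I i)"] finite_measure_mono[OF le] by simp
      next
        assume sub: "J i \<subseteq> p ` I i"
        then have "sym_diff (level n (J i)) (level n (p ` I i)) = level n (p ` I i) - level n (J i)"
          and le: "level n (J i) \<subseteq> level n (p ` I i)" by (auto simp: level_def)
        then show ?thesis
          using finite_measure_Diff[of "level n (p ` I i)" "level n (J i)"] finite_measure_mono[OF le] by simp
      qed
      also have "\<dots> \<le> prob (sym_diff (B i) (level n (J i)))"
      proof -
        have "prob (level n (J i)) \<le> prob (B i \<union> sym_diff (B i) (level n (J i)))"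
          by (rule finite_measure_mono) auto
        also have "\<dots> \<le> prob (B i) + prob (sym_diff (B i) (level n (J i)))"
          by (rule measure_Un_le) auto
        finally have 1: "prob (level n (J i)) \<le> prob (B i) + prob (sym_diff (B i) (level n (J i)))" .
        have "prob (B i) \<le> prob (level n (J i) \<union> sym_diff (B i) (level n (J i)))"
          by (rule finite_measure_mono) auto
        also have "\<dots> \<le> prob (level n (J i)) + prob (sym_diff (B i) (level n (J i)))"
          by (rule measure_Un_le) auto
        finally show ?thesis using 1 mp by simp
      qed
      finally show ?thesis using J_approx[OF i] by simp
    qed
    have "aut_class M (cell_perm n p) \<in> U"
    proof (rule U')
      show "aut_class M (cell_perm n p) \<in> carrier (Aut M)" by (intro aut_class_in_carrier cell_perm_mp_auts p)
      show "\<forall>k<m. dist_at k \<tau> (aut_class M (cell_perm n p)) < e"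
        unfolding S(2)
      proof (intro allI impI dist_at_less[OF S(1) cell_perm_mp_auts[OF p] e])
        fix n' j assume n': "n' \<le> m"
        let ?E = "\<lambda>i. disagree S (cell_perm n p) (piece m i)"
        \<comment> \<open>Positions of level \<open>m\<close> determine those of every coarser
          level, so a coarse disagreement is also one at level \<open>m\<close>.\<close>
        have "disagree S (cell_perm n p) (piece n' j) \<subseteq> (\<Union>i<2 ^ m. ?E i)"
        proof
          fix x assume x: "x \<in> disagree S (cell_perm n p) (piece n' j)"
          then have xs: "x \<in> space M" "mp_inv M S x \<in> space M" "mp_inv M (cell_perm n p) x \<in> space M"
            using mp_auts_simps(2)[OF S(1)] mp_auts_simps(2)[OF cell_perm_mp_auts[OF p]] by auto
          then have "pos m (mp_inv M S x) \<noteq> pos m (mp_inv M (cell_perm n p) x)"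
            using x pos_div[OF n'] by (auto simp: piece_def)
          then have "x \<in> ?E (pos m (mp_inv M S x))" using xs by (auto simp: piece_def)
          then show "x \<in> (\<Union>i<2 ^ m. ?E i)" using pos_less by blast
        qed
        then have "prob (disagree S (cell_perm n p) (piece n' j)) \<le> prob (\<Union>i<2 ^ m. ?E i)"
          by (rule finite_measure_mono) measurable
        also have "\<dots> \<le> (\<Sum>i<2 ^ m. prob (?E i))"
          by (rule measure_UNION_le) auto
        also have "\<dots> < (\<Sum>i<(2::nat) ^ m. 2 * \<delta>)"
          by (rule sum_strict_mono) (use err in \<open>auto simp: lessThan_empty_iff bot_nat_def\<close>)
        also have "\<dots> = e\<^sup>2" by (simp add: \<delta>_def)
        finally show "prob (disagree S (cell_perm n p) (piece n' j)) < e\<^sup>2" .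
      qed
    qed
    then show ?thesis using p by blast
  qed
  then show ?thesis by blast
qed

end

section \<open>Haar measure on a finite subgroup\<close>

context
  fixes G :: "'g monoid" and T :: "'g topology" and H :: "'g set"
  assumes G: "group G" and T: "Hausdorff_space T" "topspace T = carrier G"
    and H: "subgroup H G" "finite H"
begin

text \<open>A finite Hausdorff space is discrete, so all its subsets are Borel.\<close>

lemma finite_subgroup_sets: "sets (borel_of (subtopology T H)) = Pow H"
proof
  have top: "topspace (subtopology T H) = H"
    using subgroup.subset[OF H(1)] T(2) by auto
  show "sets (borel_of (subtopology T H)) \<subseteq> Pow H"
    using sets.sets_into_space[of _ "borel_of (subtopology T H)"] top by auto
  have single: "{h} \<in> sets (borel_of (subtopology T H))" if "h \<in> H" for h
  proof -
    have "closedin (subtopology T H) (H - {h})"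
      using Hausdorff_imp_t1_space[OF Hausdorff_space_subtopology[OF T(1)]] H(2) top
      by (intro t1_space_closedin_finite[THEN iffD1, rule_format]) auto
    then have "openin (subtopology T H) (H - (H - {h}))" using top by (metis openin_diff openin_topspace)
    moreover have "H - (H - {h}) = {h}" using that by auto
    ultimately show ?thesis by (simp add: borel_of_open)
  qed
  show "Pow H \<subseteq> sets (borel_of (subtopology T H))"
  proof
    fix A assume "A \<in> Pow H"
    then have "A = (\<Union>h\<in>A. {h})" "finite A" using H(2) by (auto intro: finite_subset)
    then show "A \<in> sets (borel_of (subtopology T H))"
      using single \<open>A \<in> Pow H\<close> by (metis (no_types, lifting) PowD sets.finite_UN subsetD)
  qed
qed

text \<open>\<open>normalized_haar\<close> is a choice, so a witness must be exhibited before its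
  properties can be used; for a finite group it is the uniform counting measure.\<close>

lemma normalized_haar_finite_subgroup:
  "is_normalized_haar (G\<lparr>carrier := H\<rparr>) (subtopology T H) (normalized_haar (G\<lparr>carrier := H\<rparr>) (subtopology T H))"
  unfolding normalized_haar_def
proof (rule someI[of "is_normalized_haar (G\<lparr>carrier := H\<rparr>) (subtopology T H)"])
  interpret group G by (rule G)
  interpret H: subgroup H G by (rule H)
  let ?\<mu> = "uniform_count_measure H"
  show "is_normalized_haar (G\<lparr>carrier := H\<rparr>) (subtopology T H) ?\<mu>"
    unfolding is_normalized_haar_def finite_subgroup_sets
  proof (intro conjI ballI)
    show "sets ?\<mu> = Pow H" by (rule sets_uniform_count_measure)
    show "emeasure ?\<mu> (space ?\<mu>) = 1"
      using prob_space.emeasure_space_1[OF prob_space_uniform_count_measure[OF H(2)]] H.one_closed by blast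
    fix x A assume x: "x \<in> carrier (G\<lparr>carrier := H\<rparr>)" and A: "A \<in> sets ?\<mu>"
    then have xH: "x \<in> H" and AH: "A \<subseteq> H" by (auto simp: sets_uniform_count_measure)
    have eq: "x <#\<^bsub>G\<lparr>carrier := H\<rparr>\<^esub> A = (\<lambda>a. x \<otimes>\<^bsub>G\<^esub> a) ` A" by (auto simp: l_coset_def)
    have "inj_on (\<lambda>a. x \<otimes>\<^bsub>G\<^esub> a) A"
    proof (rule inj_onI)
      fix a b assume ab: "a \<in> A" "b \<in> A" "x \<otimes>\<^bsub>G\<^esub> a = x \<otimes>\<^bsub>G\<^esub> b"
      then have "x \<in> Units G" "a \<in> carrier G" "b \<in> carrier G"
        using xH AH H.subset by (auto simp: Units_eq)
      then show "a = b" using ab(3) by simp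
    qed
    then have "card ((\<lambda>a. x \<otimes>\<^bsub>G\<^esub> a) ` A) = card A" by (rule card_image)
    moreover have "(\<lambda>a. x \<otimes>\<^bsub>G\<^esub> a) ` A \<subseteq> H" using xH AH by auto
    ultimately show "emeasure ?\<mu> (x <#\<^bsub>G\<lparr>carrier := H\<rparr>\<^esub> A) = emeasure ?\<mu> A"
      unfolding eq using AH H(2) by (simp add: emeasure_uniform_count_measure)
  qed
qed

text \<open>Translating the identity shows that all points have the same mass, and normalisation
  fixes it. The chosen measure is thereby identified, whatever the choice was.\<close>

lemma normalized_haar_eq_card:
  assumes \<mu>: "is_normalized_haar (G\<lparr>carrier := H\<rparr>) (subtopology T H) \<mu>" and A: "A \<subseteq> H"
  shows "emeasure \<mu> A = ennreal (card A / card H)"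
proof -
  interpret group G by (rule G)
  interpret H: subgroup H G by (rule H)
  have sets: "sets \<mu> = Pow H" using \<mu> finite_subgroup_sets by (simp add: is_normalized_haar_def)
  have space: "space \<mu> = H"
    using sets_eq_imp_space_eq[of \<mu> "count_space H"] sets by simp
  have single: "emeasure \<mu> {h} = emeasure \<mu> {\<one>\<^bsub>G\<^esub>}" if "h \<in> H" for h
  proof -
    have "emeasure \<mu> (h <#\<^bsub>G\<lparr>carrier := H\<rparr>\<^esub> {\<one>\<^bsub>G\<^esub>}) = emeasure \<mu> {\<one>\<^bsub>G\<^esub>}"
      using \<mu> that sets unfolding is_normalized_haar_def by auto
    moreover have "h <#\<^bsub>G\<lparr>carrier := H\<rparr>\<^esub> {\<one>\<^bsub>G\<^esub>} = {h}"
      using that H.subset by (auto simp: l_coset_def)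
    ultimately show ?thesis by simp
  qed
  have card: "emeasure \<mu> B = of_nat (card B) * emeasure \<mu> {\<one>\<^bsub>G\<^esub>}" if "B \<subseteq> H" for B
  proof -
    have "finite B" using that H(2) by (rule finite_subset)
    then have "emeasure \<mu> B = (\<Sum>h\<in>B. emeasure \<mu> {h})"
      using that sets by (intro emeasure_eq_sum_singleton) auto
    also have "\<dots> = (\<Sum>h\<in>B. emeasure \<mu> {\<one>\<^bsub>G\<^esub>})" 
      using that by (intro sum.cong refl single) auto
    finally show ?thesis by simp
  qed
  have one: "of_nat (card H) * emeasure \<mu> {\<one>\<^bsub>G\<^esub>} = 1"
    using card[of H] \<mu> space by (simp add: is_normalized_haar_def)
  have "H \<noteq> {}" using H.one_closed by blast
  then have N: "card H > 0" using H(2) by (simp add: card_gt_0_iff)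
  then have "emeasure \<mu> {\<one>\<^bsub>G\<^esub>} \<noteq> Orderings.top"
    using one by (auto simp: ennreal_mult_top of_nat_eq_0_iff)
  then obtain c where c: "emeasure \<mu> {\<one>\<^bsub>G\<^esub>} = ennreal c" "0 \<le> c"
    by (cases "emeasure \<mu> {\<one>\<^bsub>G\<^esub>}") auto
  have "ennreal (card H * c) = 1"
    using one c by (simp add: ennreal_mult ennreal_of_nat_eq_real_of_nat)
  then have "card H * c = 1" by simp
  then have "c = 1 / card H" using N by (simp add: field_simps)
  then show ?thesis
    using card[OF A] c by (simp add: ennreal_mult[symmetric] ennreal_of_nat_eq_real_of_nat)
qed

lemma emeasure_haar_on_finite_subgroup:
  assumes A: "A \<in> sets (borel_of T)"
  shows "emeasure (haar_on G T H) A = ennreal (card (A \<inter> H) / card H)"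
proof -
  let ?\<mu> = "normalized_haar (G\<lparr>carrier := H\<rparr>) (subtopology T H)"
  have sets: "sets ?\<mu> = Pow H"
    using normalized_haar_finite_subgroup finite_subgroup_sets by (simp add: is_normalized_haar_def)
  have space: "space ?\<mu> = H"
    using sets_eq_imp_space_eq[of ?\<mu> "count_space H"] sets by simp
  have "(\<lambda>x. x) \<in> measurable ?\<mu> (borel_of T)"
    unfolding measurable_def using sets space subgroup.subset[OF H(1)] T(2) by auto
  then have "emeasure (haar_on G T H) A = emeasure ?\<mu> (A \<inter> H)"
    unfolding haar_on_def using A by (simp add: emeasure_distr space vimage_def Int_def)
  also have "\<dots> = ennreal (card (A \<inter> H) / card H)"
    by (rule normalized_haar_eq_card[OF normalized_haar_finite_subgroup]) simp
  finally show ?thesis .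
qed

lemma sets_haar_on: "sets (haar_on G T H) = sets (borel_of T)"
  by (simp add: haar_on_def)

lemma prob_space_haar_on: "prob_space (haar_on G T H)"
proof
  have "space (haar_on G T H) = carrier G"
    using T(2) by (simp add: haar_on_def)
  moreover have "emeasure (haar_on G T H) (carrier G) = ennreal (card (carrier G \<inter> H) / card H)"
    using T(2) sets.top[of "borel_of T"] by (intro emeasure_haar_on_finite_subgroup) simp
  moreover have "carrier G \<inter> H = H" using subgroup.subset[OF H(1)] by auto
  moreover have "card H \<noteq> 0" using H(2) subgroup.one_closed[OF H(1)] by auto
  ultimately show "emeasure (haar_on G T H) (space (haar_on G T H)) = 1" by simp
qed

end

lemma openin_eps_nbhd:
  assumes "Metric_space Y d" "A \<subseteq> Y"
  shows "openin (Metric_space.mtopology Y d) (eps_nbhd Y d A e)"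
proof -
  interpret Metric_space Y d by fact
  have "eps_nbhd Y d A e = (\<Union>a\<in>A. mball a e)"
    using assms(2) by (auto simp: eps_nbhd_def commute) blast
  then show ?thesis by (auto intro: openin_Union)
qed

section \<open>The L\'evy property\<close>

context uniform_coding
begin

abbreviation perm_class :: "nat \<Rightarrow> (nat \<Rightarrow> nat) \<Rightarrow> ('a \<Rightarrow> 'a) set" where
  "perm_class n p \<equiv> aut_class M (cell_perm n p)"

definition perm_group :: "nat \<Rightarrow> ('a \<Rightarrow> 'a) set set" where
  "perm_group n = perm_class n ` {p. level_perm n p}"

lemma perm_class_in_carrier: "level_perm n p \<Longrightarrow> perm_class n p \<in> carrier (Aut M)"
  by (intro aut_class_in_carrier cell_perm_mp_auts)

lemma perm_class_mult:
  assumes "level_perm n p" "level_perm n s"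
  shows "perm_class n p \<otimes>\<^bsub>Aut M\<^esub> perm_class n s = perm_class n (p \<circ> s)"
proof -
  have "compose (space M) (cell_perm n p) (cell_perm n s) = cell_perm n (p \<circ> s)"
    by (rule ext) (simp add: compose_def cell_perm_comp[OF _ assms], simp add: cell_perm_def)
  then show ?thesis using assms by (simp add: mult_aut_class cell_perm_mp_auts)
qed

lemma perm_class_inverse:
  assumes "level_perm n p"
  shows "perm_class n p \<otimes>\<^bsub>Aut M\<^esub> perm_class n (inv_into UNIV p) = \<one>\<^bsub>Aut M\<^esub>"
    "perm_class n (inv_into UNIV p) \<otimes>\<^bsub>Aut M\<^esub> perm_class n p = \<one>\<^bsub>Aut M\<^esub>"
  using permutes_inv_o[OF assms] by (simp_all add: perm_class_mult assms permutes_inv aut_class_cell_perm_id)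

lemma perm_group_subgroup: "subgroup (perm_group n) (Aut M)"
proof -
  interpret group "Aut M" by (rule group_Aut)
  show ?thesis
  proof (rule subgroupI)
    show "perm_group n \<subseteq> carrier (Aut M)" by (auto simp: perm_group_def perm_class_in_carrier)
    show "perm_group n \<noteq> {}" unfolding perm_group_def using permutes_id[of "{..<2 ^ n}"] by blast
    fix x assume "x \<in> perm_group n"
    then obtain p where p: "level_perm n p" "x = perm_class n p" by (auto simp: perm_group_def)
    have "inv\<^bsub>Aut M\<^esub> x = perm_class n (inv_into UNIV p)"
      unfolding p(2) by (intro inv_equality perm_class_inverse perm_class_in_carrier permutes_inv p(1))
    then show "inv\<^bsub>Aut M\<^esub> x \<in> perm_group n" using permutes_inv[OF p(1)] by (auto simp: perm_group_def)
    fix y assume "y \<in> perm_group n"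
    then obtain s where s: "level_perm n s" "y = perm_class n s" by (auto simp: perm_group_def)
    show "x \<otimes>\<^bsub>Aut M\<^esub> y \<in> perm_group n"
      using permutes_compose[OF s(1) p(1)] by (auto simp: perm_group_def p s perm_class_mult)
  qed
qed

lemma finite_perm_group: "finite (perm_group n)"
  unfolding perm_group_def by (intro finite_imageI finite_permutations) simp

text \<open>Permutations that differ at an index differ on a whole piece, which has positive
  measure. Hence Haar measure on the group counts permutations, and the combinatorial estimate
  applies.\<close>

lemma inj_perm_class: "inj_on (perm_class n) {p. level_perm n p}"
proof (rule inj_onI, unfold mem_Collect_eq, rule ccontr)
  fix p s :: "nat \<Rightarrow> nat"
  assume p: "level_perm n p" and s: "level_perm n s" and eq: "perm_class n p = perm_class n s" and "p \<noteq> s"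
  then obtain j where j: "p j \<noteq> s j" by (meson ext)
  then have jn: "j < 2 ^ n" using permutes_not_in[OF p, of j] permutes_not_in[OF s, of j] by force
  have "AE x in M. cell_perm n p x = cell_perm n s x"
    using eq by (simp add: aut_class_eq_iff cell_perm_mp_auts p s)
  then have "AE x in M. x \<notin> piece n j"
    using core_props(2)
  proof eventually_elim
    case (elim x)
    then have "p (pos n x) = s (pos n x)"
      using pos_cell_perm[OF elim(2) p] pos_cell_perm[OF elim(2) s] by simp
    then show ?case using j by (auto simp: piece_def)
  qed
  then have "measure M (piece n j) = 0"
    using AE_iff_null_sets[OF piece_sets, of n j] by (intro measure_eq_0_null_sets) blast
  then show False using measure_piece[OF jn] by simp
qed

lemma card_perm_group: "card (perm_group n) = fact (2 ^ n)"
  unfolding perm_group_def card_image[OF inj_perm_class] by (simp add: card_permutations)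

lemma Hausdorff_Aut: "Hausdorff_space (Aut_strong_topology M)"
  using metrizable_Aut by (rule metrizable_imp_Hausdorff_space)

lemma measure_haar_perm_group:
  assumes "A \<in> sets (borel_of (Aut_strong_topology M))"
  shows "emeasure (haar_on (Aut M) (Aut_strong_topology M) (perm_group n)) A
      = ennreal (card {p. level_perm n p \<and> perm_class n p \<in> A} / fact (2 ^ n))"
proof -
  have "A \<inter> perm_group n = perm_class n ` {p. level_perm n p \<and> perm_class n p \<in> A}"
    by (auto simp: perm_group_def)
  moreover have "card (perm_class n ` {p. level_perm n p \<and> perm_class n p \<in> A}) = card {p. level_perm n p \<and> perm_class n p \<in> A}"
    by (intro card_image inj_on_subset[OF inj_perm_class]) auto
  ultimately show ?thesis
    using emeasure_haar_on_finite_subgroup[OF group_Aut Hausdorff_Aut topspace_Aut perm_group_subgroup finite_perm_group assms, of n]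
    by (simp add: card_perm_group)
qed

text \<open>Right invariance reduces this to a neighbourhood of the identity, whence the uniformity in \<open>n\<close>.\<close>

lemma close_if_few_differences:
  assumes d: "compatible_right_invariant_metric (Aut M) (Aut_strong_topology M) d" and "e > 0"
  shows "\<exists>\<eta>>0 :: real. \<forall>n p s. level_perm n p \<longrightarrow> level_perm n s \<longrightarrow>
    real (card {i\<in>{..<2 ^ n}. p i \<noteq> s i}) < \<eta> * 2 ^ n \<longrightarrow> d (perm_class n p) (perm_class n s) < e"
proof -
  interpret group "Aut M" by (rule group_Aut)
  interpret d: Metric_space "carrier (Aut M)" d
    using d by (simp add: compatible_right_invariant_metric_def)
  have "openin (Aut_strong_topology M) (d.mball \<one>\<^bsub>Aut M\<^esub> e)"
    using d d.openin_mball by (metis compatible_right_invariant_metric_def)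
  moreover have "\<one>\<^bsub>Aut M\<^esub> \<in> d.mball \<one>\<^bsub>Aut M\<^esub> e" using \<open>e > 0\<close> by simp
  ultimately obtain \<eta> :: real where \<eta>: "\<eta> > 0"
    and near: "\<And>n p. level_perm n p \<Longrightarrow> real (card {i\<in>{..<2 ^ n}. p i \<noteq> i}) < \<eta> * 2 ^ n \<Longrightarrow>
      perm_class n p \<in> d.mball \<one>\<^bsub>Aut M\<^esub> e"
    using near_one by blast
  have "d (perm_class n p) (perm_class n s) < e"
    if p: "level_perm n p" and s: "level_perm n s"
      and few: "real (card {i\<in>{..<2 ^ n}. p i \<noteq> s i}) < \<eta> * 2 ^ n" for n p s
  proof -
    let ?s' = "inv_into UNIV s"
    have s': "level_perm n ?s'" by (rule permutes_inv[OF s])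
    have st: "level_perm n (p \<circ> ?s')" by (rule permutes_compose[OF s' p])
    \<comment> \<open>The composite moves \<open>i\<close> precisely when \<open>p\<close> and
      \<open>s\<close> differ at the \<open>s\<close>-preimage of \<open>i\<close>.\<close>
    have "{i\<in>{..<2 ^ n}. (p \<circ> ?s') i \<noteq> i} \<subseteq> s ` {i\<in>{..<2 ^ n}. p i \<noteq> s i}"
    proof
      fix i assume i: "i \<in> {i\<in>{..<2 ^ n}. (p \<circ> ?s') i \<noteq> i}"
      then have "s (?s' i) = i" "?s' i \<in> {..<2 ^ n}"
        using permutes_inverses(1)[OF s] permutes_in_image[OF s', of i] by auto
      then show "i \<in> s ` {i\<in>{..<2 ^ n}. p i \<noteq> s i}"
        using i by (intro image_eqI[of _ _ "?s' i"]) auto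
    qed
    then have "card {i\<in>{..<2 ^ n}. (p \<circ> ?s') i \<noteq> i} \<le> card (s ` {i\<in>{..<2 ^ n}. p i \<noteq> s i})"
      by (intro card_mono) auto
    also have "\<dots> \<le> card {i\<in>{..<2 ^ n}. p i \<noteq> s i}" by (rule card_image_le) auto
    finally have "real (card {i\<in>{..<2 ^ n}. (p \<circ> ?s') i \<noteq> i}) < \<eta> * 2 ^ n" using few by linarith
    then have "perm_class n (p \<circ> ?s') \<in> d.mball \<one>\<^bsub>Aut M\<^esub> e" by (rule near[OF st])
    then have "d \<one>\<^bsub>Aut M\<^esub> (perm_class n (p \<circ> ?s')) < e" by simp
    moreover have "d (perm_class n p \<otimes>\<^bsub>Aut M\<^esub> perm_class n ?s') (perm_class n s \<otimes>\<^bsub>Aut M\<^esub> perm_class n ?s') = d (perm_class n p) (perm_class n s)"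
      using d perm_class_in_carrier[OF p] perm_class_in_carrier[OF s] perm_class_in_carrier[OF s']
      by (simp add: compatible_right_invariant_metric_def)
    moreover have "perm_class n s \<otimes>\<^bsub>Aut M\<^esub> perm_class n ?s' = \<one>\<^bsub>Aut M\<^esub>" by (rule perm_class_inverse[OF s])
    moreover have "perm_class n p \<otimes>\<^bsub>Aut M\<^esub> perm_class n ?s' = perm_class n (p \<circ> ?s')" by (rule perm_class_mult[OF p s'])
    ultimately show ?thesis by (simp add: d.commute)
  qed
  then show ?thesis using \<eta> by blast
qed

lemma levy_family_perm_groups:
  assumes d: "compatible_right_invariant_metric (Aut M) (Aut_strong_topology M) d"
  shows "levy_family (UNIV :: nat set) (\<le>) (\<lambda>_. carrier (Aut M)) (\<lambda>_. d)
    (\<lambda>n. haar_on (Aut M) (Aut_strong_topology M) (perm_group n))"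
  unfolding levy_family_def
proof (intro conjI ballI allI impI)
  let ?\<nu> = "\<lambda>n. haar_on (Aut M) (Aut_strong_topology M) (perm_group n)"
  have d_metric: "Metric_space (carrier (Aut M)) d"
    and d_top: "Metric_space.mtopology (carrier (Aut M)) d = Aut_strong_topology M"
    using d by (simp_all add: compatible_right_invariant_metric_def)
  interpret d: Metric_space "carrier (Aut M)" d by (rule d_metric)
  have dir: "directed_set (UNIV :: nat set) (\<le>)"
    unfolding directed_set_def by (auto intro: max.cobounded1 max.cobounded2)
  note ev = eventually_net_filter[OF dir]
  note haar = group_Aut Hausdorff_Aut topspace_Aut perm_group_subgroup finite_perm_group
  have prob: "prob_space (?\<nu> n)" for n by (rule prob_space_haar_on[OF haar])
  have sets: "sets (?\<nu> n) = sets (borel_of (Aut_strong_topology M))" for n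
    by (rule sets_haar_on[OF haar])
  show "mm_space (carrier (Aut M)) d (?\<nu> n)" for n
    unfolding mm_space_def d_top using d_metric prob sets by blast
  fix A :: "nat \<Rightarrow> ('a \<Rightarrow> 'a) set set" and e :: real
  assume A: "\<forall>n\<in>UNIV. A n \<in> sets (?\<nu> n)"
    and lim: "0 < Liminf (net_filter UNIV (\<le>)) (\<lambda>n. emeasure (?\<nu> n) (A n))" and e: "0 < e"
  have A': "A n \<in> sets (borel_of (Aut_strong_topology M))" for n using A sets by blast
  have sub: "A n \<subseteq> carrier (Aut M)" for n
    using sets.sets_into_space[OF A', of n] by (simp add: topspace_Aut)
  define E where "E n = eps_nbhd (carrier (Aut M)) d (A n) e" for n
  have E: "E n \<in> sets (borel_of (Aut_strong_topology M))" for n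
    unfolding E_def d_top[symmetric] by (intro borel_of_open openin_eps_nbhd d_metric sub)
  obtain \<delta>' where \<delta>': "0 < \<delta>'" "\<delta>' < Liminf (net_filter UNIV (\<le>)) (\<lambda>n. emeasure (?\<nu> n) (A n))"
    using dense[OF lim] by blast
  obtain n0 where n0: "\<And>n. n \<ge> n0 \<Longrightarrow> \<delta>' < emeasure (?\<nu> n) (A n)"
    using less_LiminfD[OF \<delta>'(2)] unfolding ev by blast
  \<comment> \<open>Finiteness turns the lower bound into a real proportion, the form that the
    counting estimate takes.\<close>
  have "\<delta>' \<noteq> Orderings.top" using \<delta>'(2) by (metis not_top_less top.not_eq_extremum)
  then obtain \<delta> where \<delta>: "\<delta>' = ennreal \<delta>" "0 < \<delta>"
    using \<delta>'(1) by (cases \<delta>') auto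
  obtain \<eta> :: real where \<eta>: "\<eta> > 0"
    and close: "\<And>n p s. level_perm n p \<Longrightarrow> level_perm n s \<Longrightarrow>
      real (card {i\<in>{..<2 ^ n}. p i \<noteq> s i}) < \<eta> * 2 ^ n \<Longrightarrow> d (perm_class n p) (perm_class n s) < e"
    using close_if_few_differences[OF d e] by blast
  show "((\<lambda>n. measure (?\<nu> n) (eps_nbhd (carrier (Aut M)) d (A n) e)) \<longlongrightarrow> 1) (net_filter UNIV (\<le>))"
    unfolding E_def[symmetric]
  proof (rule order_tendstoI)
    fix r :: real assume r: "1 < r"
    have "measure (?\<nu> n) (E n) < r" for n
      using prob_space.prob_le_1[OF prob, of n "E n"] r by linarith
    then show "\<forall>\<^sub>F n in net_filter UNIV (\<le>). measure (?\<nu> n) (E n) < r" by simp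
  next
    fix r :: real assume r: "r < 1"
    have "\<exists>N. \<forall>n\<ge>N. C \<le> 2 ^ n" for C :: real
    proof -
      obtain N where N: "C < 2 ^ N" using real_arch_pow[of 2 C] by auto
      have "C \<le> 2 ^ n" if "n \<ge> N" for n
        using N power_increasing[OF that, of "2 :: real"] by linarith
      then show ?thesis by blast
    qed
    note large = this
    obtain n1 where n1: "\<And>n. n \<ge> n1 \<Longrightarrow> 36 / (\<delta> * \<eta>\<^sup>2) \<le> 2 ^ n" using large by blast
    \<comment> \<open>The added 1 makes the later inequality strict.\<close>
    obtain n2 where n2: "\<And>n. n \<ge> n2 \<Longrightarrow> 36 / (\<eta>\<^sup>2 * (1 - r)) + 1 \<le> 2 ^ n" using large by blast
    have "r < measure (?\<nu> n) (E n)" if n: "n \<ge> max n0 (max n1 n2)" for n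
    proof -
      let ?P = "{p. p permutes {..<2 ^ n :: nat}}"
      let ?A = "{p. level_perm n p \<and> perm_class n p \<in> A n}"
      let ?E = "{p. level_perm n p \<and> perm_class n p \<in> E n}"
      let ?bad = "{p. level_perm n p \<and> (\<forall>s\<in>?A. \<eta> * card {..<2 ^ n :: nat} \<le> card {i\<in>{..<2 ^ n}. p i \<noteq> s i})}"
      have "ennreal \<delta> < ennreal (card ?A / fact (2 ^ n))"
        using n0[of n] n \<delta>(1) measure_haar_perm_group[OF A', of n n] by simp
      then have "\<delta> < card ?A / fact (2 ^ n)" using \<delta>(2) by (simp add: ennreal_less_iff)
      then have "\<delta> * fact (card {..<2 ^ n :: nat}) \<le> card ?A" by (simp add: pos_less_divide_eq)
      then have "card ?bad \<le> 36 / (\<eta>\<^sup>2 * card {..<2 ^ n :: nat}) * fact (card {..<2 ^ n :: nat})"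
        by (intro permutation_concentration_bound[where \<delta> = \<delta>]) (use \<eta> \<delta> n1[of n] n in \<open>auto simp: lessThan_empty_iff bot_nat_def\<close>)
      then have bad: "card ?bad \<le> 36 / (\<eta>\<^sup>2 * 2 ^ n) * fact (2 ^ n)" by simp
      \<comment> \<open>Outside \<open>?bad\<close> some member of the set lies at normalised
        Hamming distance below \<open>\<eta>\<close>, which \<open>close\<close> converts to a
        distance below \<open>e\<close> in the group.\<close>
      have "?P - ?bad \<subseteq> ?E"
      proof
        fix p assume "p \<in> ?P - ?bad"
        then obtain s where p: "level_perm n p" and s: "level_perm n s" "perm_class n s \<in> A n"
          and "real (card {i\<in>{..<2 ^ n}. p i \<noteq> s i}) < \<eta> * 2 ^ n"
          by (auto simp: not_le)
        then have "d (perm_class n p) (perm_class n s) < e" by (intro close)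
        then show "p \<in> ?E" using p s perm_class_in_carrier[OF p] by (auto simp: E_def eps_nbhd_def)
      qed
      moreover have finP: "finite ?P" by (rule finite_permutations) simp
      ultimately have "card (?P - ?bad) \<le> card ?E"
        by (intro card_mono) (auto intro: finite_subset[OF _ finP])
      moreover have "card (?P - ?bad) = card ?P - card ?bad"
        by (rule card_Diff_subset) (auto intro: finite_subset[OF _ finP])
      moreover have "card ?P = fact (2 ^ n)" by (simp add: card_permutations)
      ultimately have "fact (2 ^ n) \<le> card ?E + card ?bad" by linarith
      then have "real (fact (2 ^ n)) \<le> real (card ?E + card ?bad)" by (rule of_nat_mono)
      then have "fact (2 ^ n) - real (card ?bad) \<le> card ?E"
        unfolding of_nat_fact of_nat_add by linarith
      then have "(1 - 36 / (\<eta>\<^sup>2 * 2 ^ n)) * fact (2 ^ n) \<le> card ?E"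
        using bad by (simp add: left_diff_distrib)
      then have "1 - 36 / (\<eta>\<^sup>2 * 2 ^ n) \<le> card ?E / fact (2 ^ n)" by (simp add: pos_le_divide_eq)
      moreover have "r < 1 - 36 / (\<eta>\<^sup>2 * 2 ^ n)"
      proof -
        have "36 / (\<eta>\<^sup>2 * (1 - r)) < 2 ^ n" using n2[of n] n by simp
        then have "36 < 2 ^ n * (\<eta>\<^sup>2 * (1 - r))" using \<eta> r by (simp add: pos_divide_less_eq)
        then have "36 / (\<eta>\<^sup>2 * 2 ^ n) < 1 - r" using \<eta> by (simp add: pos_divide_less_eq mult_ac)
        then show ?thesis by simp
      qed
      moreover have "measure (?\<nu> n) (E n) = card ?E / fact (2 ^ n)"
        unfolding measure_def measure_haar_perm_group[OF E] by simp
      ultimately show ?thesis by simp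
    qed
    then show "\<forall>\<^sub>F n in net_filter UNIV (\<le>). r < measure (?\<nu> n) (E n)"
      unfolding ev by blast
  qed
qed

lemma perm_groups_dense:
  assumes d: "compatible_right_invariant_metric (Aut M) (Aut_strong_topology M) d"
    and S: "finite S" "S \<subseteq> carrier (Aut M)" and e: "e > 0"
  shows "\<exists>N. \<forall>n\<ge>N. \<forall>s\<in>S. (INF h\<in>perm_group n. d s h) < e"
  using S
proof (induction rule: finite_induct)
  case (insert s S)
  interpret d: Metric_space "carrier (Aut M)" d
    using d by (simp add: compatible_right_invariant_metric_def)
  have "openin (Aut_strong_topology M) (d.mball s e)"
    using d d.openin_mball by (metis compatible_right_invariant_metric_def)
  moreover have "s \<in> d.mball s e" using insert.prems e by simp
  ultimately have "\<exists>N. \<forall>n\<ge>N. \<exists>p. level_perm n p \<and> perm_class n p \<in> d.mball s e" by (rule cell_perms_dense)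
  then obtain N1 where N1: "\<And>n. n \<ge> N1 \<Longrightarrow> \<exists>p. level_perm n p \<and> perm_class n p \<in> d.mball s e"
    by blast
  obtain N2 where N2: "\<And>n. n \<ge> N2 \<Longrightarrow> \<forall>s\<in>S. (INF h\<in>perm_group n. d s h) < e"
    using insert.IH insert.prems by auto
  have "(INF h\<in>perm_group n. d s h) < e" if n: "n \<ge> N1" for n
  proof -
    obtain p where p: "level_perm n p" "perm_class n p \<in> d.mball s e" using N1[OF n] by blast
    \<comment> \<open>A single witness bounds the infimum, since distances are bounded below by
      0.\<close>
    have "(INF h\<in>perm_group n. d s h) \<le> d s (perm_class n p)"
      using p(1) by (intro cINF_lower bdd_belowI2[where m = 0]) (auto simp: perm_group_def)
    also have "\<dots> < e" using p(2) by simp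
    finally show ?thesis .
  qed
  then show ?case using N2 by (intro exI[of _ "max N1 N2"]) auto
qed simp

text \<open>The net is a sequence; \<open>levy_groupI\<close> moves its index set from
  \<open>nat\<close> to the index type fixed in \<open>levy_group\<close>.\<close>

lemma levy_group_Aut: "levy_group (Aut M) (Aut_strong_topology M)"
proof (rule levy_groupI)
  show "topological_group (Aut M) (Aut_strong_topology M)" by (rule topological_group_Aut)
  show "metrizable_space (Aut_strong_topology M)" by (rule metrizable_Aut)
  show "levy_net (Aut M) (Aut_strong_topology M) (UNIV :: nat set) (\<le>) perm_group"
    unfolding levy_net_def
  proof (intro conjI ballI allI impI)
    show "directed_set (UNIV :: nat set) (\<le>)"
      unfolding directed_set_def by (auto intro: max.cobounded1 max.cobounded2)
    show "subgroup (perm_group n) (Aut M)" for n by (rule perm_group_subgroup)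
    show "compactin (Aut_strong_topology M) (perm_group n)" for n
      using subgroup.subset[OF perm_group_subgroup, of n]
      by (intro finite_imp_compactin finite_perm_group) (simp add: topspace_Aut)
    fix d assume d: "compatible_right_invariant_metric (Aut M) (Aut_strong_topology M) d"
    show "levy_family (UNIV :: nat set) (\<le>) (\<lambda>_. carrier (Aut M)) (\<lambda>_. d)
        (\<lambda>n. haar_on (Aut M) (Aut_strong_topology M) (perm_group n))"
      by (rule levy_family_perm_groups[OF d])
    fix S and e :: real assume S: "finite S" "S \<subseteq> carrier (Aut M)" "0 < e"
    show "\<exists>N\<in>UNIV. \<forall>n\<in>UNIV. N \<le> n \<longrightarrow> (\<forall>s\<in>S. (INF h\<in>perm_group n. d s h) < e)"
      using perm_groups_dense[OF d S] by simp
  qed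
qed

end

theorem theorem2p1:
  fixes M :: "'a measure"
  assumes "standard_borel M" and "prob_space M" and "non_atomic M"
  shows "levy_group (Aut M) (Aut_strong_topology M)"
proof -
  obtain g :: "'a \<Rightarrow> real" and q where
    gq: "g \<in> borel_measurable M" "q \<in> measurable borel M" "\<forall>x. 0 < g x \<and> g x < 1"
      "\<forall>B\<in>sets borel. emeasure M (g -` B \<inter> space M) = emeasure lborel (B \<inter> {0<..<1})"
      "AE x in M. q (g x) = x"
    using non_atomic_uniform_coding[OF assms] by blast
  interpret prob_space M by fact
  interpret uniform_coding M g q
    by unfold_locales (use gq in auto)
  show ?thesis by (rule levy_group_Aut)
qed

end
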